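(* Let $d>0$ and let $F\in\mathcal S_d$ be such that $N_F(\sigma,T)=o(T)$ as $T\to\infty$ for every fixed $\sigma>1/2$. Let $p$ be a prime number and $h>0$. Then the following statements are equivalent: (i) for every $a \pmod p$ with $a\not\equiv 0\pmod p$, the linear twist $F(s,a/p)$ belongs to $M(d,h)$; (ii) for every Dirichlet character $\chi \pmod p$ with $\chi\neq\chi_0$ (the principal character), the twist $F(s,\chi)$ belongs to $M(d,h)$, and $$F_p(s)=\prod_{j=1}^{\partial_p}\Big(1-\frac{\alpha_j(p)}{p^s}\Big)^{-1}\quad\text{with } |\alpha_j(p)|\le 1 \text{ and } \partial_p\le\left[\frac{\log(h/q_F)}{\log p}\right],$$ where $[x]$ denotes the integer part.
   Context: Write $s=\sigma+it$, $e(x)=e^{2\pi i x}$, and $\bar f(s)=\overline{f(\overline s)}$. Extended Selberg class $\mathcal S^\sharp$: the non-zero functions $F$ such that (i) $F(s)=\sum_{n\ge1}a(n)n^{-s}$ is an absolutely convergent Dirichlet series for $\sigma>1$; (ii) $(s-1)^mF(s)$ is an entire function of finite order for some integer $m\ge0$; (iii) $\Phi(s)=\omega\bar\Phi(1-s)$, where $|\omega|=1$ and $\Phi(s)=Q^s\prod_{j=1}^r\Gamma(\lambda_js+\mu_j)F(s)$ with $r\ge0$, $Q>0$, $\lambda_j>0$, $\Re\mu_j\ge0$. The degree and conductor are $d_F=2\sum_{j=1}^r\lambda_j$ and $q_F=(2\pi)^{d_F}Q^2\prod_{j=1}^r\lambda_j^{2\lambda_j}$ (they depend only on $F$). Selberg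 class $\mathcal S$: the $F\in\mathcal S^\sharp$ which moreover satisfy (iv) $a(n)\ll n^\epsilon$ for every $\epsilon>0$; (v) $\log F(s)=\sum_n b(n)n^{-s}$ with $b(n)=0$ unless $n=p^m$ with $p$ prime, $m\ge1$, and $b(n)\ll n^\vartheta$ for some $\vartheta<1/2$. Thus $F(s)=\prod_pF_p(s)$ for $\sigma>1$, with local factors $F_p(s)=\exp\big(\sum_{m\ge1}b(p^m)p^{-ms}\big)=\sum_{m\ge0}a(p^m)p^{-ms}$. $\mathcal S_d$ is the set of $F\in\mathcal S$ with $d_F=d$. $N_F(\sigma,T)=|\{\rho=\beta+i\gamma:F(\rho)=0,\ \beta>\sigma,\ |\gamma|\le T\}|$. Twists, for $\sigma>1$: $F(s,\alpha)=\sum_{n\ge1}a(n)e(-n\alpha)n^{-s}$ ($\alpha\in\mathbb R$) and $F(s,\chi)=\sum_{n\ge1}a(n)\chi(n)n^{-s}$. Class $M(d,h)$ for real $d,h>0$: $f\in M(d,h)$ if $f$ is meromorphic on $\mathbb C$ and holomorphic for $\sigma<1$, and for every $A<B$ there exists a constant $C=C(A,B)$ such that $f(\sigma+it)\ll|\sigma|^{d|\sigma|}\big(\frac{h}{(2\pi e)^d}\big)^{|\sigma|}|\sigma|^C$ as $\sigma\to-\infty$, uniformly for $A\le t\le B$ (the implied constant may depend on $d,h,A,B,f$). A Dirichlet series is said to belong to $M(d,h)$ if it has a meromorphic continuation to $\mathbb C$ belonging to $M(d,h)$. *)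

theory Defs
  imports "HOL-Complex_Analysis.Complex_Analysis" "HOL-Library.Landau_Symbols"
begin

text \<open>Coefficient sequences have type \<^typ>\<open>nat \<Rightarrow> complex\<close>; their value at 0 plays no role.\<close>

definition dirichlet_term :: "(nat \<Rightarrow> complex) \<Rightarrow> complex \<Rightarrow> nat \<Rightarrow> complex" where
  "dirichlet_term c s n = c (Suc n) * of_nat (Suc n) powr (- s)"

definition abs_dirichlet_expansion :: "(nat \<Rightarrow> complex) \<Rightarrow> (complex \<Rightarrow> complex) \<Rightarrow> bool" where
  "abs_dirichlet_expansion c F \<longleftrightarrow>
     (\<forall>s. Re s > 1 \<longrightarrow> summable (\<lambda>n. norm (dirichlet_term c s n)) \<and> dirichlet_term c s sums F s)"

definition entire_finite_order :: "(complex \<Rightarrow> complex) \<Rightarrow> bool" where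
  "entire_finite_order g \<longleftrightarrow> g holomorphic_on UNIV \<and>
     (\<exists>\<rho>::real. eventually (\<lambda>z. norm (g z) \<le> exp (norm z powr \<rho>)) at_infinity)"

text \<open>The data \<open>Q\<close>, \<open>\<omega>\<close>, \<open>[(\<lambda>\<^sub>1, \<mu>\<^sub>1), \<dots>, (\<lambda>\<^sub>r, \<mu>\<^sub>r)]\<close> of a functional equation.\<close>

record fe_data =
  fe_Q :: real
  fe_root :: complex
  fe_gamma :: "(real \<times> complex) list"

definition completed :: "fe_data \<Rightarrow> (complex \<Rightarrow> complex) \<Rightarrow> complex \<Rightarrow> complex" where
  "completed D F s =
     of_real (fe_Q D) powr s * (\<Prod>(l, m) \<leftarrow> fe_gamma D. Gamma (of_real l * s + m)) * F s"

text \<open>The functional equation is an identity of meromorphic functions; it is stated off a sparse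
  set because the totalised \<^const>\<open>Gamma\<close> takes the value 0 at its poles.\<close>

definition functional_equation :: "fe_data \<Rightarrow> (complex \<Rightarrow> complex) \<Rightarrow> bool" where
  "functional_equation D F \<longleftrightarrow>
     fe_Q D > 0 \<and> norm (fe_root D) = 1 \<and>
     (\<forall>(l, m) \<in> set (fe_gamma D). l > 0 \<and> Re m \<ge> 0) \<and>
     eventually (\<lambda>s. completed D F s = fe_root D * cnj (completed D F (cnj (1 - s))))
       (cosparse UNIV)"

text \<open>\<open>F\<close> is the meromorphic continuation of the series with coefficients \<open>a\<close>, normalised so that
  it is analytic wherever it has no pole, and has value 0 at the pole \<open>s = 1\<close>, if there is one.\<close>

definition extended_selberg :: "(nat \<Rightarrow> complex) \<Rightarrow> (complex \<Rightarrow> complex) \<Rightarrow> bool" where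
  "extended_selberg a F \<longleftrightarrow>
     F nicely_meromorphic_on UNIV \<and> (\<exists>s. F s \<noteq> 0) \<and>
     abs_dirichlet_expansion a F \<and>
     (\<exists>(m::nat) g. entire_finite_order g \<and> (\<forall>s. s \<noteq> 1 \<longrightarrow> g s = (s - 1) ^ m * F s)) \<and>
     (\<exists>D. functional_equation D F)"

text \<open>Degree and conductor do not depend on the chosen functional equation of \<open>F\<close>; both are read
  off the same choice.\<close>

definition fe_of :: "(complex \<Rightarrow> complex) \<Rightarrow> fe_data" where
  "fe_of F = (SOME D. functional_equation D F)"

definition selberg_degree :: "(complex \<Rightarrow> complex) \<Rightarrow> real" where
  "selberg_degree F = 2 * (\<Sum>(l, m) \<leftarrow> fe_gamma (fe_of F). l)"

definition selberg_conductor :: "(complex \<Rightarrow> complex) \<Rightarrow> real" where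
  "selberg_conductor F =
     (2 * pi) powr selberg_degree F * (fe_Q (fe_of F))\<^sup>2 *
     (\<Prod>(l, m) \<leftarrow> fe_gamma (fe_of F). l powr (2 * l))"

text \<open>The coefficients \<open>b\<close> are those of \<open>log F\<close> for \<open>\<sigma> > 1\<close>. Absolute convergence of
  \<open>\<Sum> b(n) n\<^sup>-\<^sup>s\<close> there is no additional restriction: it follows from \<open>b(p) = a(p) \<lless> p\<^sup>\<epsilon>\<close> and
  \<open>b(p\<^sup>m) \<lless> p\<^sup>m\<^sup>\<theta>\<close>, \<open>\<theta> < 1/2\<close>, for \<open>m \<ge> 2\<close>.\<close>

definition selberg :: "(nat \<Rightarrow> complex) \<Rightarrow> (complex \<Rightarrow> complex) \<Rightarrow> bool" where
  "selberg a F \<longleftrightarrow>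
     extended_selberg a F \<and>
     (\<forall>\<epsilon>::real. \<epsilon> > 0 \<longrightarrow> (\<lambda>n. norm (a n)) \<in> O(\<lambda>n. real n powr \<epsilon>)) \<and>
     (\<exists>(b :: nat \<Rightarrow> complex) logF (\<theta>::real).
        abs_dirichlet_expansion b logF \<and>
        (\<forall>s. Re s > 1 \<longrightarrow> F s = exp (logF s)) \<and>
        (\<forall>n\<ge>1. b n \<noteq> 0 \<longrightarrow> (\<exists>p m. prime p \<and> m \<ge> 1 \<and> n = p ^ m)) \<and>
        \<theta> < 1 / 2 \<and> (\<lambda>n. norm (b n)) \<in> O(\<lambda>n. real n powr \<theta>))"

text \<open>The Dirichlet series expansion \<open>\<Sum>\<^sub>m a(p\<^sup>m) p\<^sup>-\<^sup>m\<^sup>s\<close> of the local Euler factor, for \<open>\<sigma> > 1\<close>.\<close>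

definition local_factor :: "(nat \<Rightarrow> complex) \<Rightarrow> nat \<Rightarrow> complex \<Rightarrow> complex" where
  "local_factor a p s = (\<Sum>m. a (p ^ m) * of_nat (p ^ m) powr (- s))"

definition zero_count :: "(complex \<Rightarrow> complex) \<Rightarrow> real \<Rightarrow> real \<Rightarrow> nat" where
  "zero_count F \<sigma> T =
     card {\<rho>. F \<rho> = 0 \<and> \<not> is_pole F \<rho> \<and> Re \<rho> > \<sigma> \<and> \<bar>Im \<rho>\<bar> \<le> T}"

definition linear_twist :: "(nat \<Rightarrow> complex) \<Rightarrow> real \<Rightarrow> nat \<Rightarrow> complex" where
  "linear_twist a \<alpha> n = a n * exp (2 * of_real pi * \<i> * of_real (- (real n * \<alpha>)))"

definition char_twist :: "(nat \<Rightarrow> complex) \<Rightarrow> (nat \<Rightarrow> complex) \<Rightarrow> nat \<Rightarrow> complex" where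
  "char_twist a X n = a n * X n"

definition dirichlet_character :: "nat \<Rightarrow> (nat \<Rightarrow> complex) \<Rightarrow> bool" where
  "dirichlet_character N X \<longleftrightarrow>
     (\<forall>m n. X (m * n) = X m * X n) \<and>
     (\<forall>n. X (n + N) = X n) \<and>
     (\<forall>n. X n = 0 \<longleftrightarrow> \<not> coprime n N)"

definition principal_character :: "nat \<Rightarrow> nat \<Rightarrow> complex" where
  "principal_character N n = (if coprime n N then 1 else 0)"

definition class_M :: "real \<Rightarrow> real \<Rightarrow> (complex \<Rightarrow> complex) set" where
  "class_M d h = {f.
     f meromorphic_on UNIV \<and> f holomorphic_on {s. Re s < 1} \<and>
     (\<forall>A B. A < B \<longrightarrow> (\<exists>C K.
        eventually (\<lambda>\<sigma>. \<forall>t\<in>{A..B}. norm (f (Complex \<sigma> t)) \<le>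
            K * (\<bar>\<sigma>\<bar> powr (d * \<bar>\<sigma>\<bar>) * (h / (2 * pi * exp 1) powr d) powr \<bar>\<sigma>\<bar> * \<bar>\<sigma>\<bar> powr C))
          at_bot))}"

definition series_in_M :: "real \<Rightarrow> real \<Rightarrow> (nat \<Rightarrow> complex) \<Rightarrow> bool" where
  "series_in_M d h c \<longleftrightarrow> (\<exists>f \<in> class_M d h. \<forall>s. Re s > 1 \<longrightarrow> dirichlet_term c s sums f s)"

end

(*
  Finite Fourier analysis mod p turns (i) into: F(s,chi) lies in M(d,h) for chi /= chi_0, and so does
  F(s) (p - 1 - p / F_p(s)).  By the functional equation and Stirling's formula F itself lies in
  M(d,q_F), and on lines Im s = t with t large |F| also has the matching lower bound.  This gives
  (ii) ==> (i) at once.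

  For (i) ==> (ii), the function p - 1 - p / F_p(s) is W(p^(-s)), where W is a power series converging
  for |z| < p^(-theta), theta < 1/2.  As f = F W(p^(-s)) continues to the left, a pole of W(p^(-s)) could
  only sit at a zero of F; it would repeat with period 2 pi i / log p, and reflecting these zeros
  in the critical line contradicts N_F(sigma,T) = o(T).  So W is entire, and the growth of f/F makes
  it a polynomial of degree at most log(h/q_F) / log p.  Since W(0) = -1 is not 0, also h >= q_F.
  Finally F_p(s) converges for sigma > 0, hence 1/F_p has no zeros there and |alpha_j| <= 1.
*)
theory Submission
  imports Defs "HOL-Computational_Algebra.Fundamental_Theorem_Algebra"
    "HOL-Number_Theory.Number_Theory" "HOL-Real_Asymp.Real_Asymp"
begin

section \<open>Absolutely convergent Dirichlet series\<close>

text \<open>The obstacle is the division by F. To the left, F has trivial zeros on finitely many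
  horizontal lines, and further zeros of which only a density is known. The period 2 pi i / log p of
  p^(-s) deals with both. The quotient may be measured in any window of t of that length, in
  particular above all trivial zeros, where Stirling's formula bounds F from below. And a point is
  lost only if F vanishes at all its translates, a whole arithmetic progression of zeros. The bound
  theta < 1/2 puts the reflection of such a progression strictly to the right of the critical line,
  where zeros number o(T). The function p - 1 - p / F_p comes from the sum of e(-nk/p) over 1 <= k <
  p, which is p - 1 if p divides n and -1 otherwise; since the coefficients are multiplicative,
  restricting the series to n coprime to p divides F by F_p. Multiplicativity and the nonvanishing
  of F_p are both drawn from the logarithm through the differential equation F' = (log F)' F, so
  that no Dirichlet series has to be exponentiated.\<close>

lemma norm_of_nat_powr: "n > 0 \<Longrightarrow> norm (of_nat n powr (s::complex)) = real n powr Re s"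
  by (simp add: norm_powr_real_powr)

lemma has_sum_prod:
  fixes f :: "'a \<Rightarrow> complex" and g :: "'b \<Rightarrow> complex"
  assumes f: "(f has_sum x) A" and g: "(g has_sum y) B"
  shows "((\<lambda>(i, j). f i * g j) has_sum (x * y)) (A \<times> B)"
proof (rule has_sum_SigmaI)
  show "((\<lambda>j. case (i, j) of (i, j) \<Rightarrow> f i * g j) has_sum (f i * y)) B" for i
    using has_sum_cmult_right[OF g, of "f i"] by simp
  show "((\<lambda>i. f i * y) has_sum (x * y)) A"
    using has_sum_cmult_left[OF f, of y] by simp
  have nf: "(\<lambda>i. norm (f i)) summable_on A" and ng: "(\<lambda>j. norm (g j)) summable_on B"
    using f g by (simp_all add: has_sum_imp_summable flip: summable_on_iff_abs_summable_on_complex)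
  have "(\<lambda>(i, j). norm (f i) * norm (g j)) summable_on (A \<times> B)"
  proof (rule summable_on_SigmaI)
    show "((\<lambda>j. case (i, j) of (i, j) \<Rightarrow> norm (f i) * norm (g j)) has_sum
            (norm (f i) * infsum (\<lambda>j. norm (g j)) B)) B" for i
      using has_sum_cmult_right[OF has_sum_infsum[OF ng], of "norm (f i)"] by simp
    show "(\<lambda>i. norm (f i) * infsum (\<lambda>j. norm (g j)) B) summable_on A"
      by (rule summable_on_cmult_left[OF nf])
  qed auto
  also have "(\<lambda>(i, j). norm (f i) * norm (g j)) = (\<lambda>z. norm (case z of (i, j) \<Rightarrow> f i * g j))"
    by (auto simp: norm_mult)
  finally show "(\<lambda>(i, j). f i * g j) summable_on (A \<times> B)"
    by (simp add: summable_on_iff_abs_summable_on_complex)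
qed

text \<open>Unordered sums over n >= 1 absorb both the absolute convergence and the index shift by
  \<open>Suc\<close>, and they allow the regroupings by divisors and by powers of \<open>p\<close>
  made below.\<close>

lemma abs_dirichlet_expansion_iff:
  "abs_dirichlet_expansion c F \<longleftrightarrow>
     (\<forall>s. Re s > 1 \<longrightarrow> ((\<lambda>n. c n * of_nat n powr (- s)) has_sum F s) {1..})"
proof -
  have "(summable (\<lambda>n. norm (dirichlet_term c s n)) \<and> dirichlet_term c s sums F s) \<longleftrightarrow>
        ((\<lambda>n. c n * of_nat n powr (- s)) has_sum F s) {1..}" for s
  proof -
    have eq: "(dirichlet_term c s has_sum F s) UNIV \<longleftrightarrow>
        ((\<lambda>n. c n * of_nat n powr (- s)) has_sum F s) {1..}"
      by (rule has_sum_reindex_bij_witness[of _ "\<lambda>n. n - 1" Suc]) (auto simp: dirichlet_term_def)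
    have "summable (\<lambda>n. norm (dirichlet_term c s n))" if "(dirichlet_term c s has_sum F s) UNIV"
      using that summable_on_UNIV_nonneg_real_iff[of "\<lambda>n. norm (dirichlet_term c s n)"]
      by (simp add: has_sum_imp_summable flip: summable_on_iff_abs_summable_on_complex)
    with eq show ?thesis
      using norm_summable_imp_has_sum has_sum_imp_sums by blast
  qed
  then show ?thesis
    by (auto simp: abs_dirichlet_expansion_def)
qed

lemmas abs_dirichlet_expansionD = abs_dirichlet_expansion_iff[THEN iffD1, rule_format]

lemma sums_if_has_sum:
  assumes "((\<lambda>n. c n * of_nat n powr (- s)) has_sum S) {1..}"
  shows "dirichlet_term c s sums S"
proof -
  have "(dirichlet_term c s has_sum S) UNIV \<longleftrightarrow>
        ((\<lambda>n. c n * of_nat n powr (- s)) has_sum S) {1..}"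
    by (rule has_sum_reindex_bij_witness[of _ "\<lambda>n. n - 1" Suc]) (auto simp: dirichlet_term_def)
  with assms show ?thesis
    using has_sum_imp_sums by blast
qed

text \<open>For k > n and Re s >= 2, k^(2 - Re s) is at most (n+1)^(2 - Re s), so the tail is
  controlled by its value at exponent 2; this is where the constant (n+1)^2 S comes from. It serves
  to read off coefficients one by one, and with n = 1 to keep F near 1 far to the right.\<close>

lemma dirichlet_tail_bound:
  assumes F: "abs_dirichlet_expansion c F" and n: "n \<ge> 1" and z: "\<And>k. 1 \<le> k \<Longrightarrow> k < n \<Longrightarrow> c k = 0"
  obtains K where "K \<ge> 0"
    "\<And>s. Re s \<ge> 2 \<Longrightarrow> norm (F s * of_nat n powr s - c n) \<le> K * (real n / real (n + 1)) powr (Re s)"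
proof -
  define S where "S = infsum (\<lambda>k. norm (c k * of_nat k powr (-2))) {Suc n..}"
  have sumS: "(\<lambda>k. norm (c k * of_nat k powr (-2))) summable_on {Suc n..}"
  proof -
    have "(\<lambda>k. c k * of_nat k powr (-2)) summable_on {1..}"
      using abs_dirichlet_expansionD[OF F, of 2] by (auto intro: has_sum_imp_summable)
    then have "(\<lambda>k. c k * of_nat k powr (-2)) summable_on {Suc n..}"
      by (rule summable_on_subset_banach) auto
    then show ?thesis
      by (simp add: summable_on_iff_abs_summable_on_complex)
  qed
  show thesis
  proof (rule that)
    show "real (n + 1) powr 2 * S \<ge> 0"
      unfolding S_def by (intro mult_nonneg_nonneg infsum_nonneg) auto
    fix s :: complex assume s: "Re s \<ge> 2"
    have hs: "((\<lambda>k. c k * of_nat k powr (- s)) has_sum F s) {1..}"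
      using abs_dirichlet_expansionD[OF F, of s] s by simp
    also have "?this \<longleftrightarrow> ((\<lambda>k. c k * of_nat k powr (- s)) has_sum F s) {n..}"
      by (rule has_sum_cong_neutral) (use z n in \<open>auto simp: not_le Suc_le_eq\<close>)
    finally have h1: "((\<lambda>k. c k * of_nat k powr (- s)) has_sum F s) {n..}" .
    have sm: "(\<lambda>k. c k * of_nat k powr (- s)) summable_on {Suc n..}"
      by (rule summable_on_subset_banach[OF has_sum_imp_summable[OF h1]]) auto
    define R where "R = infsum (\<lambda>k. c k * of_nat k powr (- s)) {Suc n..}"
    have R: "((\<lambda>k. c k * of_nat k powr (- s)) has_sum R) {Suc n..}"
      unfolding R_def using sm by (rule has_sum_infsum)
    have "((\<lambda>k. c k * of_nat k powr (- s)) has_sum (c n * of_nat n powr (- s) + R)) (insert n {Suc n..})"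
      by (rule has_sum_insert) (use R in auto)
    moreover have "insert n {Suc n..} = {n..}" by auto
    ultimately have Feq: "F s = c n * of_nat n powr (- s) + R"
      using h1 has_sum_unique by metis
    have "norm R \<le> real (n + 1) powr (2 - Re s) * S"
    proof (rule norm_infsum_le[where f = "\<lambda>k. c k * of_nat k powr (- s)" and X = "{Suc n..}"
            and g = "\<lambda>k. real (n+1) powr (2 - Re s) * norm (c k * of_nat k powr (-2))"])
      show "((\<lambda>k. real (n+1) powr (2 - Re s) * norm (c k * of_nat k powr (-2)))
              has_sum (real (n + 1) powr (2 - Re s) * S)) {Suc n..}"
        unfolding S_def by (rule has_sum_cmult_right[OF has_sum_infsum[OF sumS]])
      show "((\<lambda>k. c k * of_nat k powr (- s)) has_sum R) {Suc n..}" by fact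
      fix k assume k: "k \<in> {Suc n..}"
      then have k0: "k > 0" by auto
      have "norm (c k * of_nat k powr (- s)) = norm (c k) * (real k powr (2 - Re s) * real k powr (-2))"
        using k0 by (simp add: norm_mult norm_of_nat_powr flip: powr_add)
      also have "\<dots> \<le> norm (c k) * (real (n + 1) powr (2 - Re s) * real k powr (-2))"
        using k s by (intro mult_left_mono mult_right_mono powr_mono2') auto
      also have "\<dots> = real (n+1) powr (2 - Re s) * norm (c k * of_nat k powr (-2))"
        using k0 by (simp add: norm_mult norm_of_nat_powr)
      finally show "norm (c k * of_nat k powr (- s)) \<le>
          real (n+1) powr (2 - Re s) * norm (c k * of_nat k powr (-2))" .
    qed
    moreover have "F s * of_nat n powr s - c n = R * of_nat n powr s"
      using n by (simp add: Feq ring_distribs powr_minus field_simps)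
    ultimately have "norm (F s * of_nat n powr s - c n) \<le>
        (real (n + 1) powr (2 - Re s) * S) * real n powr (Re s)"
      using n by (simp add: norm_mult norm_of_nat_powr mult_right_mono)
    also have "\<dots> = real (n + 1) powr 2 * S * (real n / real (n + 1)) powr (Re s)"
      by (simp add: powr_diff powr_divide field_simps)
    finally show "norm (F s * of_nat n powr s - c n) \<le>
        real (n + 1) powr 2 * S * (real n / real (n + 1)) powr (Re s)" .
  qed
qed

lemma dirichlet_leading_coeff:
  assumes F: "abs_dirichlet_expansion c F" and n: "n \<ge> 1" and z: "\<And>k. 1 \<le> k \<Longrightarrow> k < n \<Longrightarrow> c k = 0"
  shows "((\<lambda>x::real. F (of_real x) * of_nat n powr (of_real x)) \<longlongrightarrow> c n) at_top"
proof -
  obtain K where K: "K \<ge> 0"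
    "\<And>s. Re s \<ge> 2 \<Longrightarrow> norm (F s * of_nat n powr s - c n) \<le> K * (real n / real (n + 1)) powr (Re s)"
    using dirichlet_tail_bound[OF assms] by metis
  have "((\<lambda>x. (real n / real (n + 1)) powr x) \<longlongrightarrow> 0) at_top"
    using n by real_asymp
  then have "((\<lambda>x. K * (real n / real (n + 1)) powr x) \<longlongrightarrow> 0) at_top"
    by (rule tendsto_mult_right_zero)
  moreover have "\<forall>\<^sub>F x in at_top. norm (F (of_real x) * of_nat n powr (of_real x) - c n) \<le>
      K * (real n / real (n + 1)) powr x"
    using eventually_ge_at_top[of 2] by eventually_elim (use K(2)[of "of_real _"] in simp)
  ultimately have "((\<lambda>x::real. F (of_real x) * of_nat n powr (of_real x) - c n) \<longlongrightarrow> 0) at_top"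
    by (rule Lim_null_comparison[rotated])
  then show ?thesis by (simp add: LIM_zero_iff)
qed

lemma abs_dirichlet_expansion_unique:
  assumes "abs_dirichlet_expansion c F" "abs_dirichlet_expansion c' F" "n \<ge> 1"
  shows "c n = c' n"
proof -
  have d: "abs_dirichlet_expansion (\<lambda>n. c n - c' n) (\<lambda>_. 0)"
    unfolding abs_dirichlet_expansion_iff
  proof safe
    fix s :: complex assume s: "Re s > 1"
    show "((\<lambda>n. (c n - c' n) * of_nat n powr (- s)) has_sum 0) {1..}"
      using has_sum_add[OF abs_dirichlet_expansionD[OF assms(1) s]
          has_sum_uminusI[OF abs_dirichlet_expansionD[OF assms(2) s]]]
      by (simp add: ring_distribs)
  qed
  have "n \<ge> 1 \<Longrightarrow> c n - c' n = 0"
  proof (induction n rule: less_induct)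
    case (less n)
    have "((\<lambda>x::real. 0 * of_nat n powr (of_real x)) \<longlongrightarrow> c n - c' n) at_top"
      by (rule dirichlet_leading_coeff[OF d]) (use less in auto)
    then show ?case
      using tendsto_unique[of "at_top :: real filter", OF _ tendsto_const, of 0 "c n - c' n"] by simp
  qed
  with assms(3) show ?thesis by simp
qed

lemma abs_dirichlet_expansion_mult:
  assumes "abs_dirichlet_expansion c F" "abs_dirichlet_expansion c' G"
  shows "abs_dirichlet_expansion (\<lambda>n. \<Sum>d | d dvd n. c d * c' (n div d)) (\<lambda>s. F s * G s)"
  unfolding abs_dirichlet_expansion_iff
proof safe
  fix s :: complex assume s: "Re s > 1"
  define f where "f = (\<lambda>(n, d). c d * c' (n div d) * of_nat n powr (- s))"
  have "((\<lambda>(i, j). (c i * of_nat i powr (- s)) * (c' j * of_nat j powr (- s)))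
          has_sum (F s * G s)) ({1..} \<times> {1..})"
    by (rule has_sum_prod; rule abs_dirichlet_expansionD) (use assms s in auto)
  also have "?this \<longleftrightarrow> (f has_sum (F s * G s)) (Sigma {1..} (\<lambda>n. {d. d dvd n}))"
  proof (rule has_sum_reindex_bij_witness[of _ "\<lambda>(n, d). (d, n div d)" "\<lambda>(i, j). (i * j, i)"])
    fix b :: "nat \<times> nat" assume b: "b \<in> (SIGMA n:{1..}. {d. d dvd n})"
    then show "(case case b of (n, d) \<Rightarrow> (d, n div d) of (i, j) \<Rightarrow> (i * j, i)) = b" by auto
    show "(case b of (n, d) \<Rightarrow> (d, n div d)) \<in> {1..} \<times> {1..}"
      using b by (auto simp: Suc_le_eq intro!: Nat.gr0I)
  next
    fix a :: "nat \<times> nat" assume a: "a \<in> {1..} \<times> {1..}"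
    then show "f (case a of (i, j) \<Rightarrow> (i * j, i)) =
        (case a of (i, j) \<Rightarrow> (c i * of_nat i powr (- s)) * (c' j * of_nat j powr (- s)))"
      by (auto simp: f_def powr_times_real)
  qed auto
  finally have *: "(f has_sum (F s * G s)) (Sigma {1..} (\<lambda>n. {d. d dvd n}))" .
  show "((\<lambda>n. (\<Sum>d | d dvd n. c d * c' (n div d)) * of_nat n powr (- s)) has_sum (F s * G s)) {1..}"
  proof (rule has_sum_SigmaD[OF *])
    fix n :: nat assume "n \<in> {1..}"
    then have "finite {d. d dvd n}" by auto
    from has_sum_finite[OF this] 
    show "((\<lambda>d. f (n, d)) has_sum (\<Sum>d | d dvd n. c d * c' (n div d)) * of_nat n powr (- s)) {d. d dvd n}"
      unfolding f_def by (simp add: sum_distrib_right)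
  qed
qed

text \<open>Termwise differentiation. The majorant near \<open>x\<close> is the series at the real
  point halfway between Re x and 1. The same half distance \<open>d\<close> pays for the logarithm
  in the differentiated series, by ln n <= n^d / d.\<close>

lemma abs_dirichlet_expansion_deriv:
  assumes F: "abs_dirichlet_expansion c F"
  shows "abs_dirichlet_expansion (\<lambda>n. - of_real (ln (real n)) * c n) (deriv F)"
    and "Re s > 1 \<Longrightarrow> (F has_field_derivative deriv F s) (at s)"
proof -
  have abs: "summable (\<lambda>n. norm (dirichlet_term c s n))" if "Re s > 1" for s
    using F that by (auto simp: abs_dirichlet_expansion_def)
  have sums: "dirichlet_term c s sums F s" if "Re s > 1" for s
    using F that by (auto simp: abs_dirichlet_expansion_def)
  let ?f' = "\<lambda>n x. - of_real (ln (real (Suc n))) * c (Suc n) * of_nat (Suc n) powr (- x)"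
  have der: "((\<lambda>x. dirichlet_term c x n) has_field_derivative ?f' n x) (at x)" for n x
  proof -
    have "((\<lambda>x. of_nat (Suc n) powr (- x)) has_field_derivative
        Ln (of_nat (Suc n)) * of_nat (Suc n) powr (- x) * (- 1)) (at x)"
      by (rule DERIV_chain'[OF _ has_field_derivative_powr_right]) (auto intro!: derivative_eq_intros simp del: of_nat_Suc)
    from DERIV_cmult[OF this, of "c (Suc n)"] show ?thesis
      unfolding dirichlet_term_def by (simp add: Ln_of_nat mult_ac del: of_nat_Suc)
  qed
  have loc: "\<exists>d h. 0 < d \<and> summable h \<and> range h \<subseteq> \<real>\<^sub>\<ge>\<^sub>0 \<and>
         (\<forall>\<^sub>F n in sequentially. \<forall>y\<in>ball x d \<inter> {s. Re s > 1}. cmod (dirichlet_term c y n) \<le> cmod (h n))"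
    if x: "x \<in> {s. Re s > 1}" for x
  proof (intro exI conjI)
    define d where "d = (Re x - 1) / 2"
    show d: "0 < d" using x by (simp add: d_def)
    let ?h = "\<lambda>n. of_real (norm (dirichlet_term c (of_real (Re x - d)) n)) :: complex"
    show "summable ?h"
      unfolding summable_of_real_iff by (rule abs) (use d x in \<open>auto simp: d_def field_simps\<close>)
    show "range ?h \<subseteq> \<real>\<^sub>\<ge>\<^sub>0" by (auto simp: nonneg_Reals_of_real_iff)
    show "\<forall>\<^sub>F n in sequentially. \<forall>y\<in>ball x d \<inter> {s. Re s > 1}. cmod (dirichlet_term c y n) \<le> cmod (?h n)"
    proof (intro always_eventually allI ballI)
      fix n y assume y: "y \<in> ball x d \<inter> {s. Re s > 1}"
      then have "\<bar>Re (x - y)\<bar> < d"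
        using abs_Re_le_cmod[of "x - y"] by (auto simp: dist_norm)
      then have "Re y \<ge> Re x - d" by auto
      then have "real (Suc n) powr (- Re y) \<le> real (Suc n) powr (- (Re x - d))"
        by (intro powr_mono) auto
      then show "cmod (dirichlet_term c y n) \<le> cmod (?h n)"
        unfolding dirichlet_term_def norm_mult
        by (subst (1 2) norm_mult | subst norm_of_real | subst norm_of_nat_powr)+ (auto intro!: mult_left_mono simp del: of_nat_Suc simp: norm_of_nat_powr norm_mult)
    qed
  qed
  have op: "open {s. Re s > 1}" by (simp add: open_halfspace_Re_gt)
  obtain g g' where gg: "\<And>x. Re x > 1 \<Longrightarrow>
      ((\<lambda>n. dirichlet_term c x n) sums g x) \<and> ((\<lambda>n. ?f' n x) sums g' x) \<and> (g has_field_derivative g' x) (at x)"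
    using series_and_derivative_comparison_complex[OF op der loc] by auto
  have gF: "g x = F x" if "Re x > 1" for x
    using gg[OF that] sums[OF that] sums_unique2 by blast
  have dF: "(F has_field_derivative g' x) (at x)" if "Re x > 1" for x
  proof (rule has_field_derivative_transform_within_open[OF _ op])
    show "(g has_field_derivative g' x) (at x)" using gg[OF that] by blast
  qed (use that gF in auto)
  then show "Re s > 1 \<Longrightarrow> (F has_field_derivative deriv F s) (at s)"
    using DERIV_imp_deriv by metis
  show "abs_dirichlet_expansion (\<lambda>n. - of_real (ln (real n)) * c n) (deriv F)"
    unfolding abs_dirichlet_expansion_def
  proof (intro allI impI conjI)
    fix s :: complex assume s: "Re s > 1"
    show "dirichlet_term (\<lambda>n. - of_real (ln (real n)) * c n) s sums deriv F s"
      using gg[OF s] DERIV_imp_deriv[OF dF[OF s]] by (simp add: dirichlet_term_def[abs_def])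
    define d where "d = (Re s - 1) / 2"
    have d: "d > 0" using s by (simp add: d_def)
    show "summable (\<lambda>n. norm (dirichlet_term (\<lambda>n. - of_real (ln (real n)) * c n) s n))"
    proof (rule summable_comparison_test')
      show "summable (\<lambda>n. 1 / d * norm (dirichlet_term c (s - of_real d) n))"
        by (rule summable_mult, rule abs) (use s in \<open>auto simp: d_def field_simps\<close>)
      fix n :: nat
      have "ln (real (Suc n)) \<le> real (Suc n) powr d / d"
        by (rule ln_powr_bound) (use d in auto)
      then have "ln (real (Suc n)) * (norm (c (Suc n)) * real (Suc n) powr (- Re s)) \<le>
          real (Suc n) powr d / d * (norm (c (Suc n)) * real (Suc n) powr (- Re s))"
        by (intro mult_right_mono) auto
      also have "\<dots> = 1 / d * (norm (c (Suc n)) * real (Suc n) powr (d - Re s))"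
        by (simp add: powr_diff powr_minus field_simps)
      finally show "norm (norm (dirichlet_term (\<lambda>n. - of_real (ln (real n)) * c n) s n)) \<le>
          1 / d * norm (dirichlet_term c (s - of_real d) n)"
        by (simp add: dirichlet_term_def norm_mult norm_of_nat_powr del: of_nat_Suc)
    qed
  qed
qed

section \<open>Multiplicativity and the splitting of an Euler factor\<close>

text \<open>Compares coefficients in F' = L' F. This recurrence is the only form in which the Euler
  product enters: it determines \<open>a\<close> from \<open>b\<close> without expanding
  exp(L).\<close>

lemma dirichlet_log_coeffs:
  assumes F: "abs_dirichlet_expansion a F" and L: "abs_dirichlet_expansion b L"
    and FL: "\<And>s. Re s > 1 \<Longrightarrow> F s = exp (L s)" and n: "n \<ge> 1"
  shows "of_real (ln (real n)) * a n = (\<Sum>d | d dvd n. of_real (ln (real d)) * b d * a (n div d))"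
proof -
  have dF: "deriv F s = deriv L s * F s" if s: "Re s > 1" for s
  proof (rule DERIV_imp_deriv, rule has_field_derivative_transform_within_open)
    show "((\<lambda>s. exp (L s)) has_field_derivative deriv L s * F s) (at s)"
      using abs_dirichlet_expansion_deriv(2)[OF L s] FL[OF s] by (auto intro!: derivative_eq_intros)
    show "open {s. Re s > 1}" by (simp add: open_halfspace_Re_gt)
  qed (use s FL in auto)
  have "abs_dirichlet_expansion
      (\<lambda>n. \<Sum>d | d dvd n. (- of_real (ln (real d)) * b d) * a (n div d)) (\<lambda>s. deriv L s * F s)"
    by (rule abs_dirichlet_expansion_mult[OF abs_dirichlet_expansion_deriv(1)[OF L] F])
  also have "?this \<longleftrightarrow> abs_dirichlet_expansion
      (\<lambda>n. \<Sum>d | d dvd n. (- of_real (ln (real d)) * b d) * a (n div d)) (deriv F)"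
    by (simp add: abs_dirichlet_expansion_iff dF)
  finally have "- of_real (ln (real n)) * a n =
      (\<Sum>d | d dvd n. (- of_real (ln (real d)) * b d) * a (n div d))"
    using abs_dirichlet_expansion_unique[OF abs_dirichlet_expansion_deriv(1)[OF F] _ n] by blast
  then show ?thesis
    by (simp add: sum_negf)
qed

text \<open>The recurrence of \<open>dirichlet_log_coeffs\<close> reads 0 = 0 at n = 1, so the
  initial value has to come from the limit of F = exp(L) as s tends to +infinity along the real
  axis.\<close>

lemma dirichlet_exp_leading_coeff:
  assumes F: "abs_dirichlet_expansion a F" and L: "abs_dirichlet_expansion b L"
    and FL: "\<And>s. Re s > 1 \<Longrightarrow> F s = exp (L s)"
  shows "a 1 = exp (b 1)"
proof -
  have "((\<lambda>x::real. F (of_real x)) \<longlongrightarrow> a 1) at_top"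
    using dirichlet_leading_coeff[OF F, of 1] by simp
  moreover have "((\<lambda>x::real. L (of_real x)) \<longlongrightarrow> b 1) at_top"
    using dirichlet_leading_coeff[OF L, of 1] by simp
  then have "((\<lambda>x::real. exp (L (of_real x))) \<longlongrightarrow> exp (b 1)) at_top"
    by (rule tendsto_exp)
  moreover have "\<forall>\<^sub>F x in at_top. F (of_real x) = exp (L (of_real x))"
    using eventually_gt_at_top[of 1] by eventually_elim (simp add: FL)
  ultimately have "((\<lambda>x::real. exp (L (of_real x))) \<longlongrightarrow> a 1) at_top"
    "((\<lambda>x::real. exp (L (of_real x))) \<longlongrightarrow> exp (b 1)) at_top"
    by (simp_all add: tendsto_cong)
  then show ?thesis
    using tendsto_unique trivial_limit_at_top_linorder by blast
qed

text \<open>In the recurrence at u v only prime powers d contribute, and a prime power dividing u v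
  divides u or v because these are coprime. Induction splits each a(u v / d), the two groups of
  terms add up to (ln u + ln v) a(u) a(v), and the positive factor ln(u v) cancels.\<close>

lemma prime_power_support_multiplicative:
  fixes a b :: "nat \<Rightarrow> complex"
  assumes rec: "\<And>n. n \<ge> 1 \<Longrightarrow>
      of_real (ln (real n)) * a n = (\<Sum>d | d dvd n. of_real (ln (real d)) * b d * a (n div d))"
    and a1: "a 1 = 1"
    and supp: "\<And>n. n \<ge> 1 \<Longrightarrow> b n \<noteq> 0 \<Longrightarrow> \<exists>p m. prime p \<and> m \<ge> 1 \<and> n = p ^ m"
    and "coprime u v" "u \<ge> 1" "v \<ge> 1"
  shows "a (u * v) = a u * a v"
  using assms(4-6)
proof (induction "u * v" arbitrary: u v rule: less_induct)
  case (less u v)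
  show ?case
  proof (cases "u * v = 1")
    case False
    with less.prems have uv: "u * v > 1"
      by (metis One_nat_def Suc_lessI less_eq_Suc_le nat_0_less_mult_iff)
    define g where "g = (\<lambda>d. of_real (ln (real d)) * b d * a (u * v div d))"
    \<comment> \<open>The divisor 1 is common to u and v; its zero weight makes the double count
      harmless.\<close>
    have g1: "g 1 = 0" by (simp add: g_def)
    have fin: "finite {d. d dvd u * v}" "finite {d. d dvd u}" "finite {d. d dvd v}"
      using uv less.prems by auto
    have inter: "{d. d dvd u} \<inter> {d. d dvd v} = {1}"
      using less.prems(1) by (auto simp: coprime_def)
    have "(\<Sum>d | d dvd u * v. g d) = (\<Sum>d\<in>{d. d dvd u} \<union> {d. d dvd v}. g d)"
    proof (rule sum.mono_neutral_right[OF fin(1)])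
      show "\<forall>d\<in>{d. d dvd u * v} - ({d. d dvd u} \<union> {d. d dvd v}). g d = 0"
      proof (rule ballI, rule ccontr)
        fix d assume "d \<in> {d. d dvd u * v} - ({d. d dvd u} \<union> {d. d dvd v})" "g d \<noteq> 0"
        then have d: "d dvd u * v" "\<not> d dvd v" "g d \<noteq> 0" "\<not> d dvd u" by auto
        then have "d \<ge> 1" "b d \<noteq> 0"
          using uv by (auto simp: g_def Suc_le_eq intro!: Nat.gr0I)
        then obtain q j where q: "prime q" "j \<ge> 1" "d = q ^ j" using supp by blast
        have "\<not> q dvd u \<or> \<not> q dvd v"
          using less.prems(1) q(1) by (metis coprime_common_divisor not_prime_unit)
        then have "coprime d u \<or> coprime d v"
          using q by (auto simp: prime_imp_coprime)
        with d show False
          by (auto simp: coprime_dvd_mult_left_iff coprime_dvd_mult_right_iff)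
      qed
    qed auto
    also have "\<dots> = (\<Sum>d | d dvd u. g d) + (\<Sum>d | d dvd v. g d)"
      using sum.union_inter[of "{d. d dvd u}" "{d. d dvd v}" g] fin g1 by (simp add: inter)
    also have "(\<Sum>d | d dvd u. g d) = (\<Sum>d | d dvd u. of_real (ln (real d)) * b d * a (u div d) * a v)"
    proof (rule sum.cong[OF refl])
      fix d assume "d \<in> {d. d dvd u}"
      then have d: "d dvd u" by auto
      show "g d = of_real (ln (real d)) * b d * a (u div d) * a v"
      proof (cases "d = 1")
        case False
        have "u * v div d = (u div d) * v" using d by auto
        moreover have "a ((u div d) * v) = a (u div d) * a v"
        proof (rule less.hyps)
          from d obtain e where e: "u = d * e" by auto
          with less.prems False have "d > 1" "e > 0" by (auto intro!: Nat.gr0I Suc_lessI)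
          then show "u div d * v < u * v" "u div d \<ge> 1" using less.prems by (auto simp: e)
          show "coprime (u div d) v" using less.prems(1) \<open>d > 1\<close> by (simp add: e)
        qed (use less.prems in auto)
        ultimately show ?thesis by (simp add: g_def)
      qed (simp add: g_def)
    qed
    also have "\<dots> = of_real (ln (real u)) * a u * a v"
      using rec[OF less.prems(2)] by (simp add: sum_distrib_right)
    also have "(\<Sum>d | d dvd v. g d) = (\<Sum>d | d dvd v. of_real (ln (real d)) * b d * a (v div d) * a u)"
    proof (rule sum.cong[OF refl])
      fix d assume "d \<in> {d. d dvd v}"
      then have d: "d dvd v" by auto
      show "g d = of_real (ln (real d)) * b d * a (v div d) * a u"
      proof (cases "d = 1")
        case False
        have "u * v div d = u * (v div d)" using d by auto
        moreover have "a (u * (v div d)) = a u * a (v div d)"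
        proof (rule less.hyps)
          from d obtain e where e: "v = d * e" by auto
          with less.prems False have "d > 1" "e > 0" by (auto intro!: Nat.gr0I Suc_lessI)
          then show "u * (v div d) < u * v" "v div d \<ge> 1" using less.prems by (auto simp: e)
          show "coprime u (v div d)" using less.prems(1) \<open>d > 1\<close> by (simp add: e)
        qed (use less.prems in auto)
        ultimately show ?thesis by (simp add: g_def mult_ac)
      qed (simp add: g_def)
    qed
    also have "\<dots> = of_real (ln (real v)) * a v * a u"
      using rec[OF less.prems(3)] by (simp add: sum_distrib_right)
    finally have "of_real (ln (real (u * v))) * a (u * v) =
        of_real (ln (real u)) * a u * a v + of_real (ln (real v)) * a v * a u"
      using rec[OF less_imp_le[OF uv]] by (simp add: g_def del: of_nat_mult)
    also have "\<dots> = of_real (ln (real (u * v))) * (a u * a v)"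
      using less.prems by (simp add: ln_mult algebra_simps)
    finally show ?thesis
      using uv ln_gt_zero[of "real (u * v)"]
      by (subst (asm) mult_cancel_left) (auto simp del: of_nat_mult)
  qed (use a1 in auto)
qed

lemma selberg_multiplicative:
  assumes "selberg a F"
  shows "a 1 = 1" and "\<And>u v. coprime u v \<Longrightarrow> u \<ge> 1 \<Longrightarrow> v \<ge> 1 \<Longrightarrow> a (u * v) = a u * a v"
proof -
  from assms obtain b L where bL: "abs_dirichlet_expansion b L"
      "\<And>s. Re s > 1 \<Longrightarrow> F s = exp (L s)"
      "\<And>n. n \<ge> 1 \<Longrightarrow> b n \<noteq> 0 \<Longrightarrow> (\<exists>p m. prime p \<and> m \<ge> 1 \<and> n = p ^ m)"
    and F: "abs_dirichlet_expansion a F"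
    unfolding selberg_def extended_selberg_def by blast
  have "\<not> (\<exists>p m. prime p \<and> m \<ge> 1 \<and> (1::nat) = p ^ m)"
    by (metis One_nat_def not_prime_unit le_zero_eq nat.simps(3) nat_power_eq_Suc_0_iff nat_dvd_1_iff_1)
  then have "b 1 = 0" using bL(3)[of 1] by auto
  then show a1: "a 1 = 1"
    using dirichlet_exp_leading_coeff[OF F bL(1,2)] by simp
  show "\<And>u v. coprime u v \<Longrightarrow> u \<ge> 1 \<Longrightarrow> v \<ge> 1 \<Longrightarrow> a (u * v) = a u * a v"
    by (rule prime_power_support_multiplicative[OF dirichlet_log_coeffs[OF F bL(1,2)] a1 bL(3)])
qed

text \<open>Writes each n as p^m n' with n' prime to p and uses multiplicativity. \<open>G\<close>
  is the twist by the principal character, that is F / F_p; the product form avoids dividing by a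
  local factor not yet known to be nonzero.\<close>

lemma euler_factor_split:
  assumes F: "abs_dirichlet_expansion a F" and p: "prime p"
    and mult: "\<And>u v. coprime u v \<Longrightarrow> u \<ge> 1 \<Longrightarrow> v \<ge> 1 \<Longrightarrow> a (u * v) = a u * a v"
    and s: "Re s > 1"
  obtains G where "((\<lambda>n. a n * principal_character p n * of_nat n powr (- s)) has_sum G) {1..}"
    and "F s = local_factor a p s * G"
proof -
  let ?t = "\<lambda>n. a n * of_nat n powr (- s)"
  have hF: "(?t has_sum F s) {1..}" by (rule abs_dirichlet_expansionD[OF F s])
  have p1: "p > 1" using p by (rule prime_gt_1_nat)
  define C where "C = {n. n \<ge> 1 \<and> coprime n p}"
  have sC: "?t summable_on C" and sP: "?t summable_on range (\<lambda>m. p ^ m)"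
    by (rule summable_on_subset_banach[OF has_sum_imp_summable[OF hF]], use p1 in \<open>force simp: C_def\<close>)+
  define G where "G = infsum ?t C"
  have G: "(?t has_sum G) C" unfolding G_def using sC by (rule has_sum_infsum)
  have inj: "inj (\<lambda>m. p ^ m)" using p1 by (auto simp: inj_on_def)
  have sP': "(\<lambda>m. ?t (p ^ m)) summable_on UNIV"
    using sP by (subst (asm) summable_on_reindex[OF inj]) (simp add: o_def)
  have "(\<lambda>m. ?t (p ^ m)) sums infsum (\<lambda>m. ?t (p ^ m)) UNIV"
    by (rule has_sum_imp_sums[OF has_sum_infsum[OF sP']])
  then have "infsum (\<lambda>m. ?t (p ^ m)) UNIV = local_factor a p s"
    unfolding local_factor_def by (simp add: sums_iff)
  with has_sum_infsum[OF sP'] have L: "((\<lambda>m. ?t (p ^ m)) has_sum local_factor a p s) UNIV" by simp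
  have "((\<lambda>(m, n). ?t (p ^ m) * ?t n) has_sum (local_factor a p s * G)) (UNIV \<times> C)"
    by (rule has_sum_prod[OF L G])
  also have "?this \<longleftrightarrow> (?t has_sum (local_factor a p s * G)) {1..}"
  proof (rule has_sum_reindex_bij_witness[of _ "\<lambda>n. (multiplicity p n, n div p ^ multiplicity p n)"
        "\<lambda>(m, n). p ^ m * n"])
    fix x assume x: "x \<in> (UNIV :: nat set) \<times> C"
    then obtain m n where mn: "x = (m, n)" "n \<ge> 1" "coprime n p" by (auto simp: C_def)
    have "multiplicity p (p ^ m * n) = m"
    proof -
      have "\<not> p dvd n" using mn(3) p by (metis coprime_absorb_left coprime_commute not_prime_unit)
      then show ?thesis using p mn(2)
        by (intro multiplicity_eqI) (auto simp: p1)
    qed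
    then show "(multiplicity p (case x of (m, n) \<Rightarrow> p ^ m * n),
        (case x of (m, n) \<Rightarrow> p ^ m * n) div p ^ multiplicity p (case x of (m, n) \<Rightarrow> p ^ m * n)) = x"
      using p1 by (simp add: mn(1))
    show "(case x of (m, n) \<Rightarrow> p ^ m * n) \<in> {1..}"
      using p1 mn by (auto simp: Suc_le_eq)
    have "a (p ^ m * n) = a (p ^ m) * a n"
      by (rule mult) (use mn p1 in \<open>auto simp: coprime_commute\<close>)
    then show "?t (case x of (m, n) \<Rightarrow> p ^ m * n) = (case x of (m, n) \<Rightarrow> ?t (p ^ m) * ?t n)"
      by (simp add: mn powr_times_real flip: of_nat_power)
  next
    fix n :: nat assume n: "n \<in> {1..}"
    then show "(case (multiplicity p n, n div p ^ multiplicity p n) of (m, n) \<Rightarrow> p ^ m * n) = n"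
      by (simp add: multiplicity_dvd)
    have "\<not> p dvd n div p ^ multiplicity p n"
      using p1 n by (intro multiplicity_decompose) auto
    then have "coprime (n div p ^ multiplicity p n) p"
      using p by (simp add: coprime_commute prime_imp_coprime)
    moreover have "n div p ^ multiplicity p n \<ge> 1"
      using n by (metis \<open>\<not> p dvd n div p ^ multiplicity p n\<close> dvd_0_right less_one not_le)
    ultimately show "(multiplicity p n, n div p ^ multiplicity p n) \<in> UNIV \<times> C"
      by (auto simp: C_def)
  qed simp
  finally have "F s = local_factor a p s * G"
    using hF has_sum_unique by blast
  moreover have "((\<lambda>n. a n * principal_character p n * of_nat n powr (- s)) has_sum G) {1..} \<longleftrightarrow> (?t has_sum G) C"
    by (rule has_sum_cong_neutral) (auto simp: C_def principal_character_def)
  ultimately show ?thesis using G by (intro that[of G]) auto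
qed

section \<open>Local factors as power series in z = p^(-s)\<close>

lemma fps_conv_radius_prime_powers:
  fixes c :: "nat \<Rightarrow> complex"
  assumes c: "(\<lambda>n. norm (c n)) \<in> O(\<lambda>n. real n powr \<theta>)" and p: "p > 1"
  shows "fps_conv_radius (Abs_fps (\<lambda>k. c (p ^ k))) \<ge> real p powr (- \<theta>)"
  unfolding fps_conv_radius_def
proof (rule conv_radius_geI_ex)
  fix r :: real assume r: "r > 0" "ereal r < ereal (real p powr (- \<theta>))"
  have lim: "filterlim (\<lambda>k. p ^ k) at_top sequentially"
    by (rule filterlim_at_top_mono[OF filterlim_ident]) (use p in \<open>auto intro!: always_eventually less_imp_le power_gt_expt\<close>)
  have "(\<lambda>k. norm (c (p ^ k))) \<in> O(\<lambda>k. real (p ^ k) powr \<theta>)"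
    by (rule landau_o.big.compose[OF c lim])
  then have "(\<lambda>k. norm (c (p ^ k)) * r ^ k) \<in> O(\<lambda>k. real (p ^ k) powr \<theta> * r ^ k)"
    by (rule landau_o.big.mult_right)
  moreover have "(\<lambda>k. real (p ^ k) powr \<theta> * r ^ k) = (\<lambda>k. (real p powr \<theta> * r) ^ k)"
    using p by (auto simp: power_mult_distrib powr_powr mult_ac simp flip: powr_realpow)
  moreover have "summable (\<lambda>k. norm ((real p powr \<theta> * r) ^ k))"
  proof -
    have "norm (real p powr \<theta> * r) < 1"
      using r p by (simp add: abs_mult powr_minus field_simps)
    then show ?thesis
      unfolding norm_power by (intro summable_geometric) simp
  qed
  ultimately have "summable (\<lambda>k. norm (c (p ^ k)) * r ^ k)"
    using summable_comparison_test_bigo by metis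
  then have "summable (\<lambda>k. norm (c (p ^ k) * of_real r ^ k))"
    using r(1) by (simp add: norm_mult norm_power)
  then have "summable (\<lambda>k. c (p ^ k) * of_real r ^ k)"
    by (rule summable_norm_cancel)
  then show "\<exists>z. norm z = r \<and> summable (\<lambda>k. fps_nth (Abs_fps (\<lambda>k. c (p ^ k))) k * z ^ k)"
    using r(1) by (intro exI[of _ "of_real r"]) auto
qed

lemma local_factor_eq_eval_fps:
  assumes "p > 0"
  shows "local_factor a p s = eval_fps (Abs_fps (\<lambda>k. a (p ^ k))) (of_nat p powr (- s))"
proof -
  have "of_nat (p ^ m) powr (- s) = (of_nat p powr (- s)) ^ m" for m
    using assms by (induction m) (auto simp: powr_times_real simp flip: of_nat_power)
  then show ?thesis
    by (simp add: local_factor_def eval_fps_def)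
qed

text \<open>On n = p^(k+1) the recurrence involves only powers of p, and ln(p^i) = i ln p turns the
  logarithmic weights into the factors i of a formal derivative once ln p is cancelled.\<close>

lemma local_log_ode:
  fixes a b :: "nat \<Rightarrow> complex"
  assumes rec: "\<And>n. n \<ge> 1 \<Longrightarrow>
      of_real (ln (real n)) * a n = (\<Sum>d | d dvd n. of_real (ln (real d)) * b d * a (n div d))"
    and p: "prime p"
  shows "fps_deriv (Abs_fps (\<lambda>k. a (p ^ k))) = fps_deriv (Abs_fps (\<lambda>k. b (p ^ k))) * Abs_fps (\<lambda>k. a (p ^ k))"
proof (rule fps_ext)
  fix k
  have p1: "p > 1" using p by (rule prime_gt_1_nat)
  have lp: "ln (real p) \<noteq> 0" using p1 by auto
  have "{d. d dvd p ^ Suc k} = (\<lambda>i. p ^ i) ` {..Suc k}"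
    using divides_primepow_nat[OF p, of _ "Suc k"] by auto
  then have "of_real (ln (real (p ^ Suc k))) * a (p ^ Suc k) =
      (\<Sum>i\<le>Suc k. of_real (ln (real (p ^ i))) * b (p ^ i) * a (p ^ Suc k div p ^ i))"
    using p1 rec[of "p ^ Suc k"] by (subst rec) (auto simp: sum.reindex inj_on_def simp del: power_Suc)
  \<comment> \<open>The term i = 0 drops out since ln 1 = 0; the rest is shifted by one.\<close>
  also have "\<dots> = (\<Sum>i\<le>k. of_real (ln (real (p ^ Suc i))) * b (p ^ Suc i) * a (p ^ (k - i)))"
  proof (subst sum.atMost_Suc_shift, simp del: power_Suc, rule sum.cong[OF refl])
    fix i assume "i \<in> {..k}"
    then have "p ^ Suc k = p ^ Suc i * p ^ (k - i)" by (simp flip: power_add)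
    then have "p ^ Suc k div p ^ Suc i = p ^ (k - i)" using p1 by simp
    then show "of_real (ln (real p ^ Suc i)) * b (p ^ Suc i) * a (p ^ Suc k div p ^ Suc i) =
        of_real (ln (real p ^ Suc i)) * b (p ^ Suc i) * a (p ^ (k - i))" by simp
  qed
  finally have "of_real (ln (real p)) * (of_nat (Suc k) * a (p ^ Suc k)) =
      of_real (ln (real p)) * (\<Sum>i\<le>k. of_nat (Suc i) * b (p ^ Suc i) * a (p ^ (k - i)))"
    using p1 by (simp add: ln_realpow sum_distrib_left mult_ac del: power_Suc of_nat_Suc)
  then have "of_nat (Suc k) * a (p ^ Suc k) = (\<Sum>i\<le>k. of_nat (Suc i) * b (p ^ Suc i) * a (p ^ (k - i)))"
    using lp by (subst (asm) mult_cancel_left) auto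
  then show "fps_nth (fps_deriv (Abs_fps (\<lambda>k. a (p ^ k)))) k =
      fps_nth (fps_deriv (Abs_fps (\<lambda>k. b (p ^ k))) * Abs_fps (\<lambda>k. a (p ^ k))) k"
    by (simp add: fps_mult_nth atLeast0AtMost)
qed

text \<open>The derivative of A exp(-B) is (A' - B' A) exp(-B) = 0. This exhibits 1/A as an
  exponential, so that A has no zeros in the disc.\<close>

lemma eval_fps_exp_ode:
  fixes A B :: "complex fps"
  assumes ode: "fps_deriv A = fps_deriv B * A" and init: "fps_nth A 0 = 1" "fps_nth B 0 = 0"
    and R: "ereal R \<le> fps_conv_radius A" "ereal R \<le> fps_conv_radius B" and z: "norm z < R"
  shows "eval_fps A z * exp (- eval_fps B z) = 1"
proof -
  let ?h = "\<lambda>z. eval_fps A z * exp (- eval_fps B z)"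
  have R0: "R > 0" using z norm_ge_zero[of z] by linarith
  have "\<exists>c. \<forall>x\<in>ball 0 R. ?h x = c"
  proof (rule has_field_derivative_zero_constant)
    fix x :: complex assume "x \<in> ball 0 R"
    then have "ereal (norm x) < ereal R" by simp
    then have x: "ereal (norm x) < fps_conv_radius A" "ereal (norm x) < fps_conv_radius B"
      using R by (meson less_le_trans)+
    have xd: "ereal (norm x) < fps_conv_radius (fps_deriv B)"
      using x(2) fps_conv_radius_deriv[of B] by (meson less_le_trans)
    have "eval_fps (fps_deriv A) x = eval_fps (fps_deriv B) x * eval_fps A x"
      unfolding ode by (rule eval_fps_mult[OF xd x(1)])
    then have "(?h has_field_derivative 0) (at x)"
      using x by (auto intro!: derivative_eq_intros simp: algebra_simps)
    then show "(?h has_field_derivative 0) (at x within ball 0 R)"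
      by (rule has_field_derivative_at_within)
  qed auto
  moreover have "?h 0 = 1" using init by (simp add: eval_fps_at_0)
  ultimately show ?thesis
    using z R0 by (metis ball_eq_empty centre_in_ball dist_0_norm mem_ball)
qed

text \<open>\<open>P\<close> is 1/F_p in the variable z = p^(-s), built as exp(-B) where the series
  of log F_p converges. Replacing the exponent by its maximum with 0 keeps this disc inside the unit
  disc. The radius 1 of F_p itself is recorded separately: it rests on a(n) << n^eps and later
  yields the bound on the alpha_j.\<close>

lemma selberg_local_factor:
  assumes S: "selberg a F" and p: "prime p"
  obtains \<theta> P where "0 \<le> \<theta>" "\<theta> < 1 / 2" "P holomorphic_on ball 0 (real p powr (- \<theta>))" "P 0 = 1"
    "\<And>z. norm z < real p powr (- \<theta>) \<Longrightarrow> eval_fps (Abs_fps (\<lambda>k. a (p ^ k))) z * P z = 1"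
    "1 \<le> fps_conv_radius (Abs_fps (\<lambda>k. a (p ^ k)))"
proof -
  have p1: "p > 1" using p by (rule prime_gt_1_nat)
  from S obtain b L \<theta>0 where bL: "abs_dirichlet_expansion b L"
      "\<And>s. Re s > 1 \<Longrightarrow> F s = exp (L s)"
      "\<And>n. n \<ge> 1 \<Longrightarrow> b n \<noteq> 0 \<Longrightarrow> (\<exists>p m. prime p \<and> m \<ge> 1 \<and> n = p ^ m)"
      and \<theta>0: "\<theta>0 < 1 / 2" "(\<lambda>n. norm (b n)) \<in> O(\<lambda>n. real n powr \<theta>0)"
    and F: "abs_dirichlet_expansion a F"
    and a: "\<And>\<epsilon>::real. \<epsilon> > 0 \<Longrightarrow> (\<lambda>n. norm (a n)) \<in> O(\<lambda>n. real n powr \<epsilon>)"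
    unfolding selberg_def extended_selberg_def by blast
  define \<theta> where "\<theta> = max 0 \<theta>0"
  let ?A = "Abs_fps (\<lambda>k. a (p ^ k))" and ?B = "Abs_fps (\<lambda>k. b (p ^ k))"
  have "\<not> (\<exists>p m. prime p \<and> m \<ge> 1 \<and> (1::nat) = p ^ m)"
    by (metis One_nat_def not_prime_unit le_zero_eq nat.simps(3) nat_power_eq_Suc_0_iff nat_dvd_1_iff_1)
  then have b1: "b 1 = 0" using bL(3)[of 1] by auto
  have rA: "1 \<le> fps_conv_radius ?A"
  proof (rule ccontr)
    assume "\<not> 1 \<le> fps_conv_radius ?A"
    then have "fps_conv_radius ?A < 1" by simp
    then obtain r where r: "fps_conv_radius ?A < ereal r" "ereal r < ereal 1"
      using ereal_dense2[of "fps_conv_radius ?A" 1] by (auto simp: one_ereal_def)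
    have r0: "r > 0" using r(1) conv_radius_nonneg[of "fps_nth ?A"]
      by (metis ereal_less(2) fps_conv_radius_def order.strict_trans1)
    \<comment> \<open>Chosen so that p^(-eps) = r, a radius strictly between the supposed radius of
      convergence and 1.\<close>
    define \<epsilon> where "\<epsilon> = - ln r / ln (real p)"
    have "\<epsilon> > 0" using r(2) r0 p1 by (auto simp: \<epsilon>_def divide_neg_pos)
    have "real p powr (- \<epsilon>) = r" using r0 p1 by (simp add: \<epsilon>_def powr_def)
    with fps_conv_radius_prime_powers[OF a[OF \<open>\<epsilon> > 0\<close>] p1] r(1) show False by simp
  qed
  have le1: "real p powr (- \<theta>) \<le> 1" using p1 powr_mono[of "-\<theta>" 0 "real p"] by (simp add: \<theta>_def)
  have RA: "ereal (real p powr (- \<theta>)) \<le> fps_conv_radius ?A"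
    using le1 rA by (metis ereal_less_eq(3) one_ereal_def order_trans)
  have "ereal (real p powr (- \<theta>)) \<le> ereal (real p powr (- \<theta>0))"
    using p1 by (auto simp: \<theta>_def intro!: powr_mono)
  also have "\<dots> \<le> fps_conv_radius ?B"
    by (rule fps_conv_radius_prime_powers[OF \<theta>0(2) p1])
  finally have RB: "ereal (real p powr (- \<theta>)) \<le> fps_conv_radius ?B" .
  have ode: "fps_deriv ?A = fps_deriv ?B * ?A"
    by (rule local_log_ode[OF dirichlet_log_coeffs[OF F bL(1,2)] p])
  show thesis
  proof (rule that[of \<theta> "\<lambda>z. exp (- eval_fps ?B z)"])
    show "(\<lambda>z. exp (- eval_fps ?B z)) holomorphic_on ball 0 (real p powr (- \<theta>))"
      using RB by (intro holomorphic_intros ball_eball_mono)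
    show "exp (- eval_fps ?B 0) = 1" using b1 by (simp add: eval_fps_at_0)
    show "eval_fps ?A z * exp (- eval_fps ?B z) = 1" if "norm z < real p powr (- \<theta>)" for z
      by (rule eval_fps_exp_ode[OF ode _ _ RA RB that]) (use b1 selberg_multiplicative(1)[OF S] in auto)
  qed (use \<theta>0 rA in \<open>auto simp: \<theta>_def\<close>)
qed

section \<open>Additive and multiplicative characters\<close>

text \<open>This is e(k/N).\<close>

definition unit_root :: "nat \<Rightarrow> int \<Rightarrow> complex" where
  "unit_root N k = exp (2 * of_real pi * \<i> * (of_int k / of_nat N))"

lemma unit_root_add: "unit_root N (k + l) = unit_root N k * unit_root N l"
  by (simp add: unit_root_def add_divide_distrib ring_distribs exp_add)

lemma unit_root_0 [simp]: "unit_root N 0 = 1"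
  by (simp add: unit_root_def)

lemma unit_root_mult: "unit_root N (int m * k) = unit_root N k ^ m"
  by (induction m) (auto simp: unit_root_add ring_distribs)

lemma unit_root_eq_1_iff:
  assumes "N > 0"
  shows "unit_root N k = 1 \<longleftrightarrow> int N dvd k"
proof -
  have "unit_root N k = 1 \<longleftrightarrow> (\<exists>n::int. 2 * pi * (of_int k / of_nat N) = 2 * real_of_int n * pi)"
    by (auto simp: unit_root_def exp_eq_1)
  also have "\<dots> \<longleftrightarrow> (\<exists>n::int. real_of_int k = real_of_int (n * int N))"
    using assms by (auto simp: field_simps)
  also have "\<dots> \<longleftrightarrow> int N dvd k"
    unfolding of_int_eq_iff by (auto simp: dvd_def mult.commute)
  finally show ?thesis .
qed

lemma unit_root_cong:
  assumes "N > 0" "[k = l] (mod int N)"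
  shows "unit_root N k = unit_root N l"
proof -
  obtain q where "k = l + int N * q"
    using assms(2) by (metis cong_iff_lin cong_sym)
  moreover have "unit_root N (int N * q) = 1"
    using assms(1) by (subst unit_root_eq_1_iff) auto
  ultimately show ?thesis by (simp add: unit_root_add)
qed

lemma sum_unit_roots:
  assumes "N > 0"
  shows "(\<Sum>m<N. unit_root N (int m * k)) = (if int N dvd k then of_nat N else 0)"
proof (cases "int N dvd k")
  case True
  then have "unit_root N k = 1" using unit_root_eq_1_iff[OF assms] by simp
  with True show ?thesis by (simp add: unit_root_mult)
next
  case False
  then have "unit_root N k \<noteq> 1" using unit_root_eq_1_iff[OF assms] by simp
  moreover have "unit_root N k ^ N = 1"
    using unit_root_mult[of N N k] unit_root_eq_1_iff[OF assms, of "int N * k"] by simp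
  ultimately show ?thesis
    using False geometric_sum[of "unit_root N k" N] by (simp add: unit_root_mult)
qed

lemma linear_twist_eq:
  "linear_twist a (of_int k / of_nat N) n = a n * unit_root N (- (int n * k))"
  by (simp add: linear_twist_def unit_root_def)

text \<open>Used twice: with N = p to write Dirichlet characters through additive ones, and with N =
  p - 1 on the exponents of a primitive root, for the converse.\<close>

lemma finite_fourier:
  fixes X :: "nat \<Rightarrow> complex"
  assumes N: "N > 0" and per: "\<And>n. X (n + N) = X n"
  shows "X n = (\<Sum>k<N. ((\<Sum>m<N. X m * unit_root N (int m * int k)) / of_nat N) * unit_root N (- (int n * int k)))"
proof -
  have mod: "X (n mod N) = X n"
  proof -
    have "X (r + N * q) = X r" for r q
      using per[of "r + N * _"] by (induction q) (auto simp: algebra_simps)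
    from this[of "n mod N" "n div N"] show ?thesis by simp
  qed
  have "(\<Sum>k<N. ((\<Sum>m<N. X m * unit_root N (int m * int k)) / of_nat N) * unit_root N (- (int n * int k))) =
      (\<Sum>k<N. \<Sum>m<N. X m / of_nat N * unit_root N (int k * (int m - int n)))"
    by (intro sum.cong refl)
      (simp add: sum_distrib_left sum_divide_distrib unit_root_add diff_conv_add_uminus algebra_simps del: add_uminus_conv_diff)
  also have "\<dots> = (\<Sum>m<N. X m / of_nat N * (\<Sum>k<N. unit_root N (int k * (int m - int n))))"
    by (subst sum.swap) (simp add: sum_distrib_left)
  also have "\<dots> = (\<Sum>m<N. if m = n mod N then X m else 0)"
  proof (intro sum.cong refl)
    fix m assume "m \<in> {..<N}"
    then have "int N dvd int m - int n \<longleftrightarrow> m = n mod N"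
      by (metis cong_iff_dvd_diff cong_int_iff cong_def lessThan_iff mod_less)
    then show "X m / of_nat N * (\<Sum>k<N. unit_root N (int k * (int m - int n))) = (if m = n mod N then X m else 0)"
      using N by (subst sum_unit_roots) auto
  qed
  also have "\<dots> = X (n mod N)" using N by simp
  finally show ?thesis by (simp add: mod)
qed

lemma periodic_mod:
  fixes X :: "nat \<Rightarrow> 'a"
  assumes per: "\<And>n. X (n + N) = X n"
  shows "X (n mod N) = X n"
proof -
  have "X (r + N * q) = X r" for r q
    using per[of "r + N * _"] by (induction q) (auto simp: algebra_simps)
  from this[of "n mod N" "n div N"] show ?thesis by simp
qed

lemma periodic_cong:
  fixes X :: "nat \<Rightarrow> 'a"
  assumes per: "\<And>n. X (n + N) = X n" and "[m = n] (mod N)"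
  shows "X m = X n"
  using periodic_mod[of X N m, OF per] periodic_mod[of X N n, OF per] assms(2) by (simp add: cong_def)

lemma dirichlet_character_sum_zero:
  assumes X: "dirichlet_character N X" and ne: "X \<noteq> principal_character N" and N: "N > 1"
  shows "(\<Sum>m<N. X m) = 0"
proof -
  have mult: "X (m * n) = X m * X n" and per: "X (n + N) = X n" and z: "X n = 0 \<longleftrightarrow> \<not> coprime n N" for m n
    using X by (auto simp: dirichlet_character_def)
  from ne obtain n where "X n \<noteq> principal_character N n" by auto
  then have n: "coprime n N" "X n \<noteq> 1"
    using z[of n] by (auto simp: principal_character_def split: if_splits)
  have inj: "inj_on (\<lambda>m. n * m mod N) {..<N}"
  proof (rule inj_onI)
    fix x y assume xy: "x \<in> {..<N}" "y \<in> {..<N}" "n * x mod N = n * y mod N"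
    then have "[x = y] (mod N)"
      using cong_mult_lcancel_nat[OF n(1), of x y] by (simp add: cong_def)
    with xy show "x = y" by (simp add: cong_def)
  qed
  have "(\<lambda>m. n * m mod N) ` {..<N} = {..<N}"
    by (rule endo_inj_surj[OF _ _ inj]) (use N in auto)
  with inj have "bij_betw (\<lambda>m. n * m mod N) {..<N} {..<N}"
    by (simp add: bij_betw_def)
  then have "(\<Sum>m<N. X m) = (\<Sum>m<N. X (n * m mod N))"
    by (rule sum.reindex_bij_betw[symmetric])
  also have "\<dots> = X n * (\<Sum>m<N. X m)"
    by (simp add: periodic_mod[of X, OF per] mult sum_distrib_left)
  finally show ?thesis using n(2) by (simp add: mult_cancel_right1)
qed

text \<open>The Fourier coefficient at frequency 0 is the mean of X, which vanishes for a
  nonprincipal character. Hence only the frequencies k not divisible by N occur, just the linear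
  twists for which (i) speaks.\<close>

lemma dirichlet_character_as_additive:
  assumes X: "dirichlet_character N X" and ne: "X \<noteq> principal_character N" and N: "N > 1"
  obtains c where "\<And>n. X n = (\<Sum>k=1..<N. c k * unit_root N (- (int n * int k)))"
proof -
  have per: "X (n + N) = X n" for n
    using X by (auto simp: dirichlet_character_def)
  let ?c = "\<lambda>k. (\<Sum>m<N. X m * unit_root N (int m * int k)) / of_nat N"
  have "X n = (\<Sum>k=1..<N. ?c k * unit_root N (- (int n * int k)))" for n
  proof -
    have "X n = (\<Sum>k<N. ?c k * unit_root N (- (int n * int k)))"
      by (rule finite_fourier) (use N per in auto)
    also have "\<dots> = (\<Sum>k=1..<N. ?c k * unit_root N (- (int n * int k)))"
      by (rule sum.mono_neutral_right)
        (use dirichlet_character_sum_zero[OF assms] in \<open>auto simp: not_le\<close>)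
    finally show ?thesis .
  qed
  then show ?thesis by (rule that)
qed

text \<open>With g a primitive root mod p, m -> phi(g^m) has period p - 1, and its Fourier expansion
  is an expansion in the characters n -> e(-j ind(n) / (p-1)). This replaces an appeal to
  orthogonality of characters.\<close>

lemma periodic_as_characters:
  fixes \<phi> :: "nat \<Rightarrow> complex"
  assumes p: "prime p" and per: "\<And>n. \<phi> (n + p) = \<phi> n"
  obtains c X where "\<And>j. dirichlet_character p (X j)"
    "\<And>n. coprime n p \<Longrightarrow> \<phi> n = (\<Sum>j<p-1. c j * X j n)"
proof -
  have p1: "p > 1" using p by (rule prime_gt_1_nat)
  obtain g where g: "residue_primroot p g"
  proof -
    have "p \<in> cyclic_moduli"
    proof (cases "p = 2")
      case False
      then have "odd p" using p primes_dvd_imp_eq two_is_prime_nat by blast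
      then have "\<exists>q k. p = q ^ k \<and> prime q \<and> odd q \<and> k > 0"
        using p by (intro exI[of _ p] exI[of _ 1]) auto
      then show ?thesis by (auto simp: cyclic_moduli_def)
    qed (simp add: cyclic_moduli_def)
    then show ?thesis using that residue_primroot_iff_in_cyclic_moduli by blast
  qed
  have cop: "coprime p g" using g by (simp add: residue_primroot_def)
  have ordg: "ord p g = p - 1" using g p by (simp add: residue_primroot_def totient_prime)
  have bij: "bij_betw (\<lambda>i. g ^ i mod p) {..<p - 1} (totatives p)"
    using residue_primroot_is_generator[OF _ g] p1 p by (simp add: totient_prime)
  have "\<exists>i. [g ^ i = n] (mod p)" if "coprime n p" for n
  proof -
    have "n mod p \<in> totatives p"
      using that p1 p by (auto simp: totatives_def coprime_commute intro!: Nat.gr0I)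
    then have "n mod p \<in> (\<lambda>i. g ^ i mod p) ` {..<p - 1}"
      using bij by (simp add: bij_betw_def)
    then obtain i where "n mod p = g ^ i mod p" by blast
    then show ?thesis by (auto simp: cong_def)
  qed
  then obtain ind where ind: "\<And>n. coprime n p \<Longrightarrow> [g ^ ind n = n] (mod p)" by metis
  \<comment> \<open>\<open>ind\<close> is an arbitrary choice of discrete logarithm, determined only
    mod p - 1; this makes the characters independent of the choice.\<close>
  have eqI: "unit_root (p - 1) (- (int i * int j)) = unit_root (p - 1) (- (int i' * int j))"
    if "[g ^ i = g ^ i'] (mod p)" for i i' j
  proof (rule unit_root_cong)
    have "[i = i'] (mod p - 1)"
      using order_divides_expdiff[OF cop, of i i'] that by (simp add: ordg)
    then have "[int i = int i'] (mod int (p - 1))" by (simp add: cong_int_iff)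
    then show "[- (int i * int j) = - (int i' * int j)] (mod int (p - 1))"
      by (simp add: cong_minus_minus_iff cong_scalar_right)
  qed (use p1 in auto)
  define X where "X = (\<lambda>j n. if coprime n p then unit_root (p - 1) (- (int (ind n) * int j)) else 0)"
  show thesis
  proof (rule that)
    show "dirichlet_character p (X j)" for j
      unfolding dirichlet_character_def
    proof (intro conjI allI)
      fix m n
      show "X j (m * n) = X j m * X j n"
      proof (cases "coprime m p \<and> coprime n p")
        case True
        then have "[g ^ ind (m * n) = m * n] (mod p)" "[g ^ ind m = m] (mod p)" "[g ^ ind n = n] (mod p)"
          by (simp_all add: ind)
        then have "[g ^ ind (m * n) = g ^ (ind m + ind n)] (mod p)"
          unfolding power_add by (meson cong_mult cong_sym cong_trans)
        from eqI[OF this, of j]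
        have "unit_root (p - 1) (- (int (ind (m * n)) * int j)) =
            unit_root (p - 1) (- (int (ind m) * int j) + - (int (ind n) * int j))"
          by (simp add: ring_distribs)
        then show ?thesis
          unfolding unit_root_add using True by (simp add: X_def)
      qed (auto simp: X_def)
      have cop_add: "coprime (n + p) p \<longleftrightarrow> coprime n p"
        by (simp only: coprime_iff_gcd_eq_1 gcd_add1)
      show "X j (n + p) = X j n"
      proof (cases "coprime n p")
        case True
        then have "coprime (n + p) p" using cop_add by blast
        then have "[g ^ ind (n + p) = g ^ ind n] (mod p)"
          using ind[of "n + p"] ind[of n] True by (auto simp: cong_def)
        from eqI[OF this, of j] True \<open>coprime (n + p) p\<close> show ?thesis by (simp add: X_def)
      next
        case False
        then have "\<not> coprime (n + p) p" using cop_add by blast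
        with False show ?thesis by (simp add: X_def)
      qed
      show "X j n = 0 \<longleftrightarrow> \<not> coprime n p" by (auto simp: X_def unit_root_def)
    qed
    have per': "\<phi> (g ^ (i + (p - 1))) = \<phi> (g ^ i)" for i
    proof -
      have "[g ^ (i + (p - 1)) = g ^ i] (mod p)"
        using order_divides_expdiff[OF cop, of "i + (p - 1)" i] by (simp add: ordg cong_def)
      then show ?thesis by (rule periodic_cong[of \<phi>, OF per])
    qed
    let ?c = "\<lambda>k. (\<Sum>m<p-1. \<phi> (g ^ m) * unit_root (p-1) (int m * int k)) / of_nat (p-1)"
    show "\<phi> n = (\<Sum>j<p-1. ?c j * X j n)" if "coprime n p" for n
    proof -
      have "\<phi> n = \<phi> (g ^ ind n)"
        by (rule periodic_cong[of \<phi>, OF per cong_sym[OF ind[OF that]]])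
      also have "\<dots> = (\<Sum>k<p-1. ?c k * unit_root (p-1) (- (int (ind n) * int k)))"
        by (rule finite_fourier) (use p1 per' in auto)
      finally show ?thesis using that by (simp add: X_def)
    qed
  qed
qed

section \<open>Vertical growth of the Gamma function\<close>

text \<open>With L = ln(1 + 1/y) one has f(y+1) - f(y) = 1 - (y+1) L, which lies in [-1/y, 0]. Since
  1/y <= 2/(y+1) <= 2 L, the loss is stated as a difference of logarithms, which telescopes when the
  step is iterated.\<close>

lemma stirling_real_step:
  fixes y :: real
  assumes "y \<ge> 1"
  defines "f \<equiv> (\<lambda>y::real. ln (Gamma y) - (y * ln y - y))"
  shows "f (y + 1) \<le> f y" "f (y + 1) \<ge> f y - 2 * (ln (y + 1) - ln y)"
proof -
  have "Gamma (y + 1) = y * Gamma y"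
    using assms(1) by (intro Gamma_plus1) (auto simp: nonpos_Ints_def)
  moreover have "Gamma y > 0" using assms(1) by simp
  then have "Gamma y \<noteq> 0" by linarith
  ultimately have f1: "f (y + 1) = f y + 1 - (y + 1) * (ln (y + 1) - ln y)"
    using assms(1) by (simp add: f_def ln_mult algebra_simps)
  define L where "L = ln (y + 1) - ln y"
  have L: "L = ln (1 + 1 / y)" "L = - ln (1 - 1 / (y + 1))"
    using assms(1) by (auto simp: L_def field_simps simp flip: ln_div ln_inverse) (simp_all add: ln_div field_simps)
  have "L \<le> 1 / y" unfolding L(1) using assms(1) by (intro ln_add_one_self_le_self) auto
  then have "(y + 1) * L \<le> (y + 1) * (1 / y)" using assms(1) by (intro mult_left_mono) auto
  then have u: "(y + 1) * L \<le> 1 + 1 / y" using assms(1) by (simp add: add_divide_distrib)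
  have "ln (1 + - (1 / (y + 1))) \<le> - (1 / (y + 1))"
    using assms(1) by (intro ln_add_one_self_le_self2) auto
  then have l: "L \<ge> 1 / (y + 1)" by (simp add: L(2))
  then have "1 \<le> (y + 1) * L" using assms(1) by (simp add: field_simps)
  then show "f (y + 1) \<le> f y"
    unfolding f1 L_def[symmetric] by linarith
  have "1 / y \<le> 2 * (1 / (y + 1))" using assms(1) by (simp add: field_simps)
  with l u show "f (y + 1) \<ge> f y - 2 * (ln (y + 1) - ln y)"
    unfolding f1 L_def[symmetric] by linarith
qed

text \<open>The error term moves little from \<open>y\<close> to \<open>y + 1\<close>, so compactness of \<open>[1, 2]\<close> suffices.\<close>

lemma stirling_real_bound:
  obtains K where "\<And>y::real. y \<ge> 1 \<Longrightarrow> \<bar>ln (Gamma y) - (y * ln y - y)\<bar> \<le> K + 2 * ln y"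
proof -
  define f where "f = (\<lambda>y::real. ln (Gamma y) - (y * ln y - y))"
  have "continuous_on {1..2} f"
  proof (rule continuous_at_imp_continuous_on, rule ballI)
    fix x :: real assume x: "x \<in> {1..2}"
    then have "isCont Gamma x" by (intro isCont_Gamma) (auto simp: nonpos_Ints_def)
    with x Gamma_real_pos[of x] show "isCont f x"
      unfolding f_def by (intro continuous_intros) (auto simp del: Gamma_real_pos)
  qed
  then have "compact (f ` {1..2})" by (rule compact_continuous_image) auto
  then obtain K where K: "\<And>y. y \<in> {1..2} \<Longrightarrow> \<bar>f y\<bar> \<le> K"
    using compact_imp_bounded[of "f ` {1..2}"] by (auto simp: bounded_iff simp del: atLeastAtMost_iff)
  have *: "- K - 2 * ln (y + real n) \<le> f (y + real n) \<and> f (y + real n) \<le> K" if y: "y \<in> {1..2}" for y n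
  proof (induction n)
    case 0
    have "0 \<le> ln y" using y by simp
    then show ?case using K[OF y] by (simp add: abs_le_iff)
  next
    case (Suc n)
    then show ?case
      using stirling_real_step[of "y + real n"] y by (auto simp: f_def algebra_simps)
  qed
  show thesis
  proof (rule that)
    fix y :: real assume y: "y \<ge> 1"
    define n where "n = nat \<lfloor>y - 1\<rfloor>"
    have "y - real n \<in> {1..2}" using y by (auto simp: n_def) linarith+
    from *[OF this, of n] ln_ge_zero[OF y] show "\<bar>ln (Gamma y) - (y * ln y - y)\<bar> \<le> K + 2 * ln y"
      using K[of 1] by (auto simp: f_def)
  qed
qed

text \<open>Gauss's product formula reduces this to its linear factors: |x + iy + k| lies between x
  + k and (x + k) exp(y^2 / (k+1)^2), since x >= 1. \<open>S\<close> is the sum of 1/(k+1)^2. As y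
  stays bounded in the class M, real Stirling together with this comparison is enough.\<close>

lemma norm_Gamma_vertical:
  obtains S :: real where "S \<ge> 0"
    "\<And>x y. x \<ge> 1 \<Longrightarrow> norm (Gamma (Complex x y)) \<le> Gamma x"
    "\<And>x y. x \<ge> 1 \<Longrightarrow> norm (Gamma (Complex x y)) \<ge> Gamma x * exp (- (y\<^sup>2 * S))"
proof -
  let ?t = "\<lambda>k. 1 / (real k + 1)\<^sup>2"
  have sm: "summable ?t"
    using inverse_squares_sums by (simp add: sums_iff add.commute)
  define S where "S = (\<Sum>k. ?t k)"
  have S0: "S \<ge> 0" unfolding S_def using sm by (intro suminf_nonneg) auto
  have series: "Gamma_series x n * exp (- (y\<^sup>2 * S)) \<le> norm (Gamma_series (Complex x y) n)"
    "norm (Gamma_series (Complex x y) n) \<le> Gamma_series x n" if x: "x \<ge> 1" and n: "n > 0" for x y n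
  proof -
    let ?z = "Complex x y"
    have lower: "x + real k \<le> norm (?z + of_nat k)" for k
      using complex_Re_le_cmod[of "?z + of_nat k"] by simp
    have upper: "norm (?z + of_nat k) \<le> (x + real k) * exp (y\<^sup>2 * ?t k)" for k
    proof -
      have "norm (?z + of_nat k) = sqrt ((x + real k)\<^sup>2 + y\<^sup>2)"
        by (simp add: cmod_def)
      also have "\<dots> \<le> sqrt (((x + real k) * exp (y\<^sup>2 * ?t k))\<^sup>2)"
      proof (rule real_sqrt_le_mono)
        have "(real k + 1)\<^sup>2 \<le> (x + real k)\<^sup>2" using x by (intro power_mono) auto
        then have "y\<^sup>2 * (real k + 1)\<^sup>2 \<le> y\<^sup>2 * (x + real k)\<^sup>2" by (intro mult_left_mono) auto
        then have "y\<^sup>2 \<le> (x + real k)\<^sup>2 * (y\<^sup>2 * ?t k)"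
          by (simp add: field_simps)
        then have "(x + real k)\<^sup>2 + y\<^sup>2 \<le> (x + real k)\<^sup>2 * (1 + y\<^sup>2 * ?t k)"
          by (simp add: ring_distribs)
        also have "\<dots> \<le> (x + real k)\<^sup>2 * exp (2 * (y\<^sup>2 * ?t k))"
          using exp_ge_add_one_self[of "2 * (y\<^sup>2 * ?t k)"]
          by (intro mult_left_mono) (smt (verit) zero_le_divide_1_iff zero_le_power2 mult_nonneg_nonneg, auto)
        also have "\<dots> = ((x + real k) * exp (y\<^sup>2 * ?t k))\<^sup>2"
          by (simp only: power_mult_distrib exp_double)
        finally show "(x + real k)\<^sup>2 + y\<^sup>2 \<le> ((x + real k) * exp (y\<^sup>2 * ?t k))\<^sup>2" .
      qed
      finally show ?thesis using x by (simp add: abs_mult)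
    qed
    have P1: "(\<Prod>k=0..n. x + real k) \<le> (\<Prod>k=0..n. norm (?z + of_nat k))"
      using lower x by (intro prod_mono) auto
    have P0: "(\<Prod>k=0..n. x + real k) > 0" using x by (intro prod_pos) auto
    have "(\<Prod>k=0..n. norm (?z + of_nat k)) \<le> (\<Prod>k=0..n. (x + real k) * exp (y\<^sup>2 * ?t k))"
      using upper by (intro prod_mono) auto
    also have "\<dots> = (\<Prod>k=0..n. x + real k) * exp (y\<^sup>2 * (\<Sum>k=0..n. ?t k))"
      by (simp add: prod.distrib exp_sum sum_distrib_left)
    also have "\<dots> \<le> (\<Prod>k=0..n. x + real k) * exp (y\<^sup>2 * S)"
      unfolding S_def using P0 sm by (intro mult_left_mono iffD2[OF exp_le_cancel_iff] sum_le_suminf) auto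
    finally have P2: "(\<Prod>k=0..n. norm (?z + of_nat k)) \<le> (\<Prod>k=0..n. x + real k) * exp (y\<^sup>2 * S)" .
    have g1: "norm (Gamma_series ?z n) = exp (x * ln (real n)) * fact n / (\<Prod>k=0..n. norm (?z + of_nat k))"
      by (simp add: Gamma_series_def pochhammer_prod norm_divide norm_mult prod_norm atLeastLessThanSuc_atLeastAtMost)
    have g2: "Gamma_series x n = exp (x * ln (real n)) * fact n / (\<Prod>k=0..n. x + real k)"
      by (simp add: Gamma_series_def pochhammer_prod atLeastLessThanSuc_atLeastAtMost)
    show "norm (Gamma_series ?z n) \<le> Gamma_series x n"
      unfolding g1 g2 using P0 P1 by (intro divide_left_mono mult_pos_pos) auto
    have "exp (x * ln (real n)) * fact n / ((\<Prod>k=0..n. x + real k) * exp (y\<^sup>2 * S)) \<le> norm (Gamma_series ?z n)"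
      unfolding g1 using P0 P1 P2 by (intro divide_left_mono mult_pos_pos) auto
    then show "Gamma_series x n * exp (- (y\<^sup>2 * S)) \<le> norm (Gamma_series ?z n)"
      by (simp add: g2 exp_minus field_simps)
  qed
  show thesis
  proof (rule that[OF S0])
    fix x y :: real assume x: "x \<ge> 1"
    have ev1: "\<forall>\<^sub>F n in sequentially. norm (Gamma_series (Complex x y) n) \<le> Gamma_series x n"
      using eventually_gt_at_top[of "0::nat"] by eventually_elim (rule series(2)[OF x])
    have ev2: "\<forall>\<^sub>F n in sequentially.
        Gamma_series x n * exp (- (y\<^sup>2 * S)) \<le> norm (Gamma_series (Complex x y) n)"
      using eventually_gt_at_top[of "0::nat"] by eventually_elim (rule series(1)[OF x])
    show "norm (Gamma (Complex x y)) \<le> Gamma x"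
      by (rule tendsto_le[OF _ Gamma_series_LIMSEQ tendsto_norm[OF Gamma_series_LIMSEQ] ev1]) simp
    show "norm (Gamma (Complex x y)) \<ge> Gamma x * exp (- (y\<^sup>2 * S))"
      by (rule tendsto_le[OF _ tendsto_norm[OF Gamma_series_LIMSEQ] tendsto_mult[OF Gamma_series_LIMSEQ tendsto_const] ev2]) simp
  qed
qed

text \<open>The shift \<open>\<kappa>\<close> and the vertical displacement both cost only O(ln x),
  which becomes a power of x after exponentiation and is therefore invisible in the class M.\<close>

lemma Gamma_asymp_horizontal:
  fixes l \<kappa> B :: real
  assumes l: "l > 0"
  shows "\<exists>C. \<forall>\<^sub>F x in at_top. \<forall>y. \<bar>y\<bar> \<le> B \<longrightarrow> norm (Gamma (Complex (l * x + \<kappa>) y)) > 0 \<and>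
    \<bar>ln (norm (Gamma (Complex (l * x + \<kappa>) y))) - (l * x * ln x + l * x * (ln l - 1))\<bar> \<le> C * ln x"
proof -
  obtain K where K: "\<And>y::real. y \<ge> 1 \<Longrightarrow> \<bar>ln (Gamma y) - (y * ln y - y)\<bar> \<le> K + 2 * ln y"
    using stirling_real_bound by metis
  obtain S :: real where S: "S \<ge> 0"
    "\<And>x y. x \<ge> 1 \<Longrightarrow> norm (Gamma (Complex x y)) \<le> Gamma x"
    "\<And>x y. x \<ge> 1 \<Longrightarrow> norm (Gamma (Complex x y)) \<ge> Gamma x * exp (- (y\<^sup>2 * S))"
    using norm_Gamma_vertical by metis
  have "(\<lambda>x. (l * x + \<kappa>) * ln (l * x + \<kappa>) - (l * x + \<kappa>) - (l * x * ln (l * x) - l * x)) \<in> O(\<lambda>x. ln x)"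
    using l by real_asymp
  then obtain C1 where C1: "\<forall>\<^sub>F x in at_top.
      norm ((l * x + \<kappa>) * ln (l * x + \<kappa>) - (l * x + \<kappa>) - (l * x * ln (l * x) - l * x)) \<le> C1 * norm (ln x)"
    by (elim landau_o.bigE)
  have "(\<lambda>x. K + 2 * ln (l * x + \<kappa>) + B\<^sup>2 * S) \<in> O(\<lambda>x. ln x)"
    using l by real_asymp
  then obtain C2 where C2: "\<forall>\<^sub>F x in at_top. norm (K + 2 * ln (l * x + \<kappa>) + B\<^sup>2 * S) \<le> C2 * norm (ln x)"
    by (elim landau_o.bigE)
  have big: "\<forall>\<^sub>F x in at_top. l * x + \<kappa> \<ge> 1" using l by real_asymp
  show ?thesis
  proof (intro exI[of _ "C1 + C2"])
    show "\<forall>\<^sub>F x in at_top. \<forall>y. \<bar>y\<bar> \<le> B \<longrightarrow> norm (Gamma (Complex (l * x + \<kappa>) y)) > 0 \<and>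
      \<bar>ln (norm (Gamma (Complex (l * x + \<kappa>) y))) - (l * x * ln x + l * x * (ln l - 1))\<bar> \<le> (C1 + C2) * ln x"
      using C1 C2 big eventually_ge_at_top[of 1]
    proof eventually_elim
      case (elim x)
      show ?case
      proof (intro allI impI)
        fix y assume y: "\<bar>y\<bar> \<le> B"
        let ?w = "l * x + \<kappa>"
        let ?g = "norm (Gamma (Complex ?w y))"
        have G: "Gamma ?w > 0" using elim by (intro Gamma_real_pos) auto
        have lo: "?g \<ge> Gamma ?w * exp (- (y\<^sup>2 * S))" and hi: "?g \<le> Gamma ?w" using S elim by auto
        have pos: "?g > 0" using lo G by (smt (verit) exp_gt_zero mult_pos_pos)
        have "ln (Gamma ?w * exp (- (y\<^sup>2 * S))) \<le> ln ?g" using lo pos G by (subst ln_le_cancel_iff) auto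
        then have "ln (Gamma ?w) - y\<^sup>2 * S \<le> ln ?g" using G by (simp add: ln_mult)
        moreover have "ln ?g \<le> ln (Gamma ?w)" using hi pos G by (subst ln_le_cancel_iff) auto
        moreover have "y\<^sup>2 * S \<le> B\<^sup>2 * S"
          using y S(1) by (intro mult_right_mono) (auto simp: abs_le_square_iff[symmetric])
        ultimately have "\<bar>ln ?g - ln (Gamma ?w)\<bar> \<le> B\<^sup>2 * S" by linarith
        moreover have "\<bar>ln (Gamma ?w) - (?w * ln ?w - ?w)\<bar> \<le> K + 2 * ln ?w" using K elim by auto
        moreover have "ln x \<ge> 0" using elim by auto
        ultimately have "\<bar>ln ?g - (l * x * ln x + l * x * (ln l - 1))\<bar> \<le> (C1 + C2) * ln x"
          using elim l by (simp add: ln_mult ring_distribs)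
        with pos show "?g > 0 \<and> \<bar>ln ?g - (l * x * ln x + l * x * (ln l - 1))\<bar> \<le> (C1 + C2) * ln x" by blast
      qed
    qed
  qed
qed

section \<open>The functional equation\<close>

lemma extended_selberg_holomorphic:
  assumes "extended_selberg a F"
  shows "F holomorphic_on - {1}"
proof -
  obtain m g where g: "g holomorphic_on UNIV" "\<And>s. s \<noteq> 1 \<Longrightarrow> g s = (s - 1) ^ m * F s"
    using assms by (auto simp: extended_selberg_def entire_finite_order_def)
  have "(\<lambda>s. g s / (s - 1) ^ m) holomorphic_on - {1}"
    by (intro holomorphic_intros holomorphic_on_subset[OF g(1)]) auto
  then show ?thesis
    by (rule holomorphic_transform) (auto simp: g(2))
qed

lemma complex_notin_nonpos_Ints:
  "Re w > 0 \<or> Im w \<noteq> 0 \<Longrightarrow> w \<notin> (\<int>\<^sub>\<le>\<^sub>0 :: complex set)"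
  by (auto elim!: nonpos_Ints_cases)

lemma eventually_at_not_nonpos_Ints:
  "eventually (\<lambda>s::complex. of_real l * s + m \<notin> \<int>\<^sub>\<le>\<^sub>0) (at s0)" if "l > 0"
  unfolding eventually_at
proof (cases "of_real l * s0 + m \<in> \<int>")
  case True
  show "\<exists>d>0. \<forall>s\<in>UNIV. s \<noteq> s0 \<and> dist s s0 < d \<longrightarrow> of_real l * s + m \<notin> \<int>\<^sub>\<le>\<^sub>0"
  proof (intro exI[of _ "1 / l"] conjI ballI impI notI)
    fix s assume s: "s \<noteq> s0 \<and> dist s s0 < 1 / l" "of_real l * s + m \<in> \<int>\<^sub>\<le>\<^sub>0"
    then have "of_real l * s + m \<in> \<int>" using nonpos_Ints_Int by blast
    from Ints_diff[OF this True] have "of_real l * (s - s0) \<in> \<int>" by (simp add: algebra_simps)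
    then obtain n where n: "of_real l * (s - s0) = of_int n" by (auto elim: Ints_cases)
    then have "norm (of_real l * (s - s0)) = \<bar>of_int n\<bar>" by simp
    moreover have "norm (of_real l * (s - s0)) < 1"
    proof -
      have "norm (of_real l * (s - s0)) = l * dist s s0"
        unfolding norm_mult dist_norm using that by simp
      then show ?thesis using s(1) that by (simp add: field_simps)
    qed
    ultimately have "n = 0" by simp
    with n s(1) that show False by auto
  qed (use that in auto)
next
  case False
  have "open ((\<lambda>s. of_real l * s + m) -` (- \<int>))"
    by (intro open_vimage open_Compl closed_Ints continuous_intros)
  then obtain d where "d > 0" "\<And>s. dist s s0 < d \<Longrightarrow> of_real l * s + m \<notin> \<int>"
    using False unfolding open_dist by auto
  then show "\<exists>d>0. \<forall>s\<in>UNIV. s \<noteq> s0 \<and> dist s s0 < d \<longrightarrow> of_real l * s + m \<notin> \<int>\<^sub>\<le>\<^sub>0"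
    using nonpos_Ints_Int by blast
qed

text \<open>The quotient of F(s) by the conjugate of F(1 - conj s). The entire \<open>rGamma\<close>
  stands for 1 / Gamma(l s + m), so the factor has its true value 0 at the trivial zeros, where the
  totalised \<open>Gamma\<close> would mislead.\<close>

definition fe_factor :: "fe_data \<Rightarrow> complex \<Rightarrow> complex" where
  "fe_factor D s = fe_root D * of_real (fe_Q D) powr (1 - 2 * s) *
     (\<Prod>(l, m) \<leftarrow> fe_gamma D. Gamma (of_real l * (1 - s) + cnj m) * rGamma (of_real l * s + m))"

lemma isCont_prod_list_map:
  fixes f :: "'b \<Rightarrow> complex \<Rightarrow> complex"
  assumes "\<And>x. x \<in> set xs \<Longrightarrow> isCont (f x) s"
  shows "isCont (\<lambda>s. \<Prod>x\<leftarrow>xs. f x s) s"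
  using assms by (induction xs) (auto intro!: continuous_intros)

text \<open>The given identity holds off a sparse set, and there the Gamma factors can be divided
  out. Both sides of the resulting equation are continuous for Re s < 1 and s different from 0, so
  it holds at each such s; s = 0 is excluded because it reflects to the possible pole 1.\<close>

lemma functional_equation_pointwise:
  assumes fe: "functional_equation D F" and hol: "F holomorphic_on - {1}"
    and s: "Re s < 1" "s \<noteq> 0"
  shows "F s = fe_factor D s * cnj (F (cnj (1 - s)))"
proof -
  let ?E = "\<lambda>s. fe_factor D s * cnj (F (cnj (1 - s)))"
  have Q: "fe_Q D > 0" and gam: "\<And>l m. (l, m) \<in> set (fe_gamma D) \<Longrightarrow> l > 0 \<and> Re m \<ge> 0"
    and ev: "eventually (\<lambda>s. completed D F s = fe_root D * cnj (completed D F (cnj (1 - s)))) (at s)"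
    using fe by (auto simp: functional_equation_def eventually_cosparse_open_eq)
  have contF: "isCont F w" if "w \<noteq> 1" for w
    using hol that by (metis Compl_iff continuous_on_eq_continuous_at holomorphic_on_imp_continuous_on
        open_Compl closed_singleton singletonD)
  have "isCont F s" using s by (intro contF) auto
  have pos: "Re (of_real l * (1 - z) + cnj m) > 0" if "(l, m) \<in> set (fe_gamma D)" "Re z < 1" for l m z
    using gam[OF that(1)] that(2) by (simp add: add_pos_nonneg)
  have np: "w \<notin> \<int>\<^sub>\<le>\<^sub>0" if "Re w > 0" for w :: complex
    using that complex_notin_nonpos_Ints by blast
  have "isCont (\<lambda>s. Gamma (of_real l * (1 - s) + cnj m) * rGamma (of_real l * s + m)) s"
    if "(l, m) \<in> set (fe_gamma D)" for l m
    by (intro continuous_intros np pos that s)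
  then have "isCont (fe_factor D) s"
    unfolding fe_factor_def using Q
    by (intro continuous_intros isCont_prod_list_map) (auto simp: case_prod_unfold)
  moreover have "isCont (\<lambda>s. F (cnj (1 - s))) s"
    by (rule isCont_o2[where g = F]) (use s in \<open>auto intro!: continuous_intros contF simp: complex_eq_iff\<close>)
  ultimately have contE: "isCont ?E s" by (intro continuous_intros)
  have "eventually (\<lambda>s. \<forall>(l, m)\<in>set (fe_gamma D). of_real l * s + m \<notin> \<int>\<^sub>\<le>\<^sub>0) (at s)"
    by (rule eventually_ball_finite) (auto intro!: eventually_at_not_nonpos_Ints dest: gam)
  moreover have "eventually (\<lambda>s. Re s < 1) (at s)"
    using s by (intro eventually_at_in_open'[of "{s. Re s < 1}", simplified]) (auto simp: open_halfspace_Re_lt)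
  ultimately have "eventually (\<lambda>s. F s = ?E s) (at s)"
    using ev
  proof eventually_elim
    case (elim z)
    have *: "(\<Prod>(l, m)\<leftarrow>xs. Gamma (of_real l * z + m)) * (\<Prod>(l, m)\<leftarrow>xs. Gamma (of_real l * (1 - z) + cnj m) * rGamma (of_real l * z + m)) =
        cnj (\<Prod>(l, m)\<leftarrow>xs. Gamma (of_real l * cnj (1 - z) + m))"
      if "set xs \<subseteq> set (fe_gamma D)" for xs
      using that
    proof (induction xs)
      case (Cons x xs)
      obtain l m where x: "x = (l, m)" by force
      have "of_real l * z + m \<notin> \<int>\<^sub>\<le>\<^sub>0" using elim(1) Cons.prems x by auto
      then have "Gamma (of_real l * z + m) * rGamma (of_real l * z + m) = 1"
        using Gamma_nonzero[of "of_real l * z + m"] by (simp add: rGamma_inverse_Gamma)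
      with Cons show ?case by (simp add: x cnj_Gamma mult_ac)
    qed simp
    define P where "P = (\<Prod>(l, m)\<leftarrow>fe_gamma D. Gamma (of_real l * z + m))"
    define R where "R = (\<Prod>(l, m)\<leftarrow>fe_gamma D. Gamma (of_real l * (1 - z) + cnj m) * rGamma (of_real l * z + m))"
    have "P \<noteq> 0" unfolding P_def prod_list_zero_iff using elim(1) by (auto simp: Gamma_eq_zero_iff)
    have "of_real (fe_Q D) powr z * P * F z =
        fe_root D * (of_real (fe_Q D) powr (1 - z) * (P * R) * cnj (F (cnj (1 - z))))"
      using elim(3) *[OF subset_refl] Q unfolding completed_def P_def[symmetric] R_def[symmetric]
      by (simp add: cnj_powr)
    then have "of_real (fe_Q D) powr z * F z =
        fe_root D * (of_real (fe_Q D) powr (1 - z) * R * cnj (F (cnj (1 - z))))"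
      using \<open>P \<noteq> 0\<close> by (simp add: mult_ac) 
    moreover have "of_real (fe_Q D) powr (1 - z) = of_real (fe_Q D) powr z * (of_real (fe_Q D) powr (1 - 2 * z) :: complex)"
      using Q by (simp flip: powr_add)
    ultimately have "of_real (fe_Q D) powr z * F z = of_real (fe_Q D) powr z * ?E z"
      unfolding fe_factor_def R_def[symmetric] by (simp add: mult_ac)
    then show "F z = ?E z" using Q by simp
  qed
  with \<open>isCont F s\<close> have "(?E \<longlongrightarrow> F s) (at s)"
    unfolding isCont_def by (simp cong: tendsto_cong)
  with contE show ?thesis
    unfolding isCont_def using tendsto_unique[OF at_neq_bot] by blast
qed

text \<open>High up, l s + m has positive imaginary part and so is no pole of Gamma: there are no
  trivial zeros there, \<open>fe_factor\<close> does not vanish, and a zero of F must come from the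
  reflected point.\<close>

lemma functional_equation_zero_reflect:
  assumes fe: "functional_equation D F" and hol: "F holomorphic_on - {1}"
  shows "\<forall>\<^sub>F y in at_top. \<forall>s. Im s = y \<longrightarrow> Re s < 1 \<longrightarrow> F s = 0 \<longrightarrow> F (cnj (1 - s)) = 0"
proof -
  have Q: "fe_Q D > 0" and gam: "\<And>l m. (l, m) \<in> set (fe_gamma D) \<Longrightarrow> l > 0 \<and> Re m \<ge> 0"
    and root: "norm (fe_root D) = 1"
    using fe by (auto simp: functional_equation_def)
  have "\<forall>\<^sub>F y in at_top. l * y + Im m > 0" if "(l, m) \<in> set (fe_gamma D)" for l m
    using gam[OF that] by real_asymp
  then have "\<forall>\<^sub>F y in at_top. \<forall>(l, m)\<in>set (fe_gamma D). l * y + Im m > 0"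
    by (intro eventually_ball_finite) auto
  then show ?thesis
    using eventually_gt_at_top[of 0]
  proof eventually_elim
    case (elim y)
    show ?case
    proof (intro allI impI)
      fix s assume s: "Im s = y" "Re s < 1" "F s = 0"
      have "(\<Prod>(l, m)\<leftarrow>fe_gamma D. Gamma (of_real l * (1 - s) + cnj m) * rGamma (of_real l * s + m)) \<noteq> 0"
        unfolding prod_list_zero_iff
      proof
        assume "0 \<in> set (map (\<lambda>(l, m). Gamma (of_real l * (1 - s) + cnj m) * rGamma (of_real l * s + m)) (fe_gamma D))"
        then obtain l m where lm: "(l, m) \<in> set (fe_gamma D)"
          and 0: "Gamma (of_real l * (1 - s) + cnj m) * rGamma (of_real l * s + m) = 0"
          by auto
        have "Im (of_real l * s + m) > 0" using elim(1) lm s by auto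
        moreover have "Re (of_real l * (1 - s) + cnj m) > 0"
          using gam[OF lm] s(2) by (simp add: add_pos_nonneg)
        ultimately show False
          using 0 complex_notin_nonpos_Ints[of "of_real l * s + m"]
            complex_notin_nonpos_Ints[of "of_real l * (1 - s) + cnj m"]
          by (simp add: Gamma_eq_zero_iff rGamma_eq_zero_iff)
      qed
      then have "fe_factor D s \<noteq> 0"
        using root Q by (auto simp: fe_factor_def)
      moreover have "s \<noteq> 0" using s(1) elim(2) by auto
      then have "fe_factor D s * cnj (F (cnj (1 - s))) = 0"
        using functional_equation_pointwise[OF fe hol s(2)] s(3) by simp
      ultimately show "F (cnj (1 - s)) = 0" by simp
    qed
  qed
qed

section \<open>Growth to the left\<close>

text \<open>By the reflection formula, \<open>1 / \<Gamma>(l s + m)\<close> is \<open>\<Gamma>(1 - l s - m)\<close> times a sine over \<open>\<pi>\<close>. The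
  quotient of Gamma factors in the functional equation thus splits into a product of values of
  \<open>\<Gamma>\<close> with large real part, to which Stirling's formula applies in both directions, and sines,
  which alone can vanish.\<close>

definition gamma_pair :: "real \<Rightarrow> complex \<Rightarrow> real \<Rightarrow> real \<Rightarrow> real" where
  "gamma_pair l m x t = norm (Gamma (Complex (l * x + (l + Re m)) (- (l * t + Im m)))) *
     norm (Gamma (Complex (l * x + (1 - Re m)) (- (l * t + Im m))))"

lemma gamma_pair_list_asymp:
  assumes "\<And>l m. (l, m) \<in> set gs \<Longrightarrow> l > 0"
  shows "\<exists>C. \<forall>\<^sub>F x in at_top. \<forall>t\<in>{A..B}. (\<Prod>(l, m)\<leftarrow>gs. gamma_pair l m x t) > 0 \<and>
    \<bar>ln (\<Prod>(l, m)\<leftarrow>gs. gamma_pair l m x t) - (\<Sum>(l, m)\<leftarrow>gs. 2 * (l * x * ln x + l * x * (ln l - 1)))\<bar> \<le> C * ln x"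
  using assms
proof (induction gs)
  case Nil
  show ?case by (intro exI[of _ 0]) auto
next
  case (Cons g gs)
  obtain l m where g: "g = (l, m)" by force
  then have l: "l > 0" using Cons.prems by auto
  obtain C where C: "\<forall>\<^sub>F x in at_top. \<forall>t\<in>{A..B}. (\<Prod>(l, m)\<leftarrow>gs. gamma_pair l m x t) > 0 \<and>
    \<bar>ln (\<Prod>(l, m)\<leftarrow>gs. gamma_pair l m x t) - (\<Sum>(l, m)\<leftarrow>gs. 2 * (l * x * ln x + l * x * (ln l - 1)))\<bar> \<le> C * ln x"
    using Cons by fastforce
  \<comment> \<open>Bounds the imaginary parts of both Gamma arguments uniformly over the window A
    <= t <= B.\<close>
  define H where "H = l * (\<bar>A\<bar> + \<bar>B\<bar>) + \<bar>Im m\<bar>"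
  have H: "\<bar>- (l * t + Im m)\<bar> \<le> H" if "t \<in> {A..B}" for t
  proof -
    have "\<bar>l * t\<bar> \<le> l * (\<bar>A\<bar> + \<bar>B\<bar>)" unfolding abs_mult using that l by (intro mult_mono) auto
    then show ?thesis by (simp add: H_def)
  qed
  obtain C1 where C1: "\<forall>\<^sub>F x in at_top. \<forall>y. \<bar>y\<bar> \<le> H \<longrightarrow> norm (Gamma (Complex (l * x + (l + Re m)) y)) > 0 \<and>
    \<bar>ln (norm (Gamma (Complex (l * x + (l + Re m)) y))) - (l * x * ln x + l * x * (ln l - 1))\<bar> \<le> C1 * ln x"
    using Gamma_asymp_horizontal[OF l] by blast
  obtain C2 where C2: "\<forall>\<^sub>F x in at_top. \<forall>y. \<bar>y\<bar> \<le> H \<longrightarrow> norm (Gamma (Complex (l * x + (1 - Re m)) y)) > 0 \<and>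
    \<bar>ln (norm (Gamma (Complex (l * x + (1 - Re m)) y))) - (l * x * ln x + l * x * (ln l - 1))\<bar> \<le> C2 * ln x"
    using Gamma_asymp_horizontal[OF l] by blast
  show ?case
  proof (intro exI[of _ "C1 + C2 + C"])
    show "\<forall>\<^sub>F x in at_top. \<forall>t\<in>{A..B}. (\<Prod>(l, m)\<leftarrow>g # gs. gamma_pair l m x t) > 0 \<and>
      \<bar>ln (\<Prod>(l, m)\<leftarrow>g # gs. gamma_pair l m x t) - (\<Sum>(l, m)\<leftarrow>g # gs. 2 * (l * x * ln x + l * x * (ln l - 1)))\<bar>
        \<le> (C1 + C2 + C) * ln x"
      using C C1 C2
    proof eventually_elim
      case (elim x)
      show ?case
      proof
        fix t assume t: "t \<in> {A..B}"
        let ?P = "\<Prod>(l, m)\<leftarrow>gs. gamma_pair l m x t"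
        let ?g1 = "norm (Gamma (Complex (l * x + (l + Re m)) (- (l * t + Im m))))"
        let ?g2 = "norm (Gamma (Complex (l * x + (1 - Re m)) (- (l * t + Im m))))"
        define M where "M = l * x * ln x + l * x * (ln l - 1)"
        define S where "S = (\<Sum>(l, m)\<leftarrow>gs. 2 * (l * x * ln x + l * x * (ln l - 1)))"
        have e1: "?P > 0" "\<bar>ln ?P - S\<bar> \<le> C * ln x"
          using elim(1) t unfolding S_def by auto
        have e2: "?g1 > 0" "\<bar>ln ?g1 - M\<bar> \<le> C1 * ln x"
          using elim(2)[rule_format, OF H[OF t]] unfolding M_def by blast+
        have e3: "?g2 > 0" "\<bar>ln ?g2 - M\<bar> \<le> C2 * ln x"
          using elim(3)[rule_format, OF H[OF t]] unfolding M_def by blast+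
        have eq: "(\<Prod>(l, m)\<leftarrow>g # gs. gamma_pair l m x t) = ?g1 * ?g2 * ?P"
          by (simp add: g gamma_pair_def)
        have eq2: "(\<Sum>(l, m)\<leftarrow>g # gs. 2 * (l * x * ln x + l * x * (ln l - 1))) = 2 * M + S"
          by (simp add: g M_def S_def)
        have "ln (?g1 * ?g2 * ?P) = ln ?g1 + ln ?g2 + ln ?P"
          using e1(1) e2(1) e3(1) by (simp only: ln_mult_pos mult_pos_pos)
        then show "(\<Prod>(l, m)\<leftarrow>g # gs. gamma_pair l m x t) > 0 \<and>
          \<bar>ln (\<Prod>(l, m)\<leftarrow>g # gs. gamma_pair l m x t) - (\<Sum>(l, m)\<leftarrow>g # gs. 2 * (l * x * ln x + l * x * (ln l - 1)))\<bar>
          \<le> (C1 + C2 + C) * ln x"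
          unfolding eq eq2 using e1 e2 e3 by (auto simp only: ring_distribs mult_pos_pos)
      qed
    qed
  qed
qed

lemma norm_sin_upper: "norm (sin (z :: complex)) \<le> exp \<bar>Im z\<bar>"
proof -
  have "norm (sin z) ^ 2 \<le> (exp (2 * Im z) + inverse (exp (2 * Im z)) + 2) / 4"
    unfolding norm_sin_squared using cos_ge_minus_one[of "2 * Re z"]
    by (intro divide_right_mono) linarith+
  also have "\<dots> \<le> exp (2 * \<bar>Im z\<bar>)"
  proof -
    have "exp (2 * Im z) \<le> exp (2 * \<bar>Im z\<bar>)" "exp (- (2 * Im z)) \<le> exp (2 * \<bar>Im z\<bar>)"
      "1 \<le> exp (2 * \<bar>Im z\<bar>)" by simp_all
    moreover have "u \<le> M \<Longrightarrow> v \<le> M \<Longrightarrow> 1 \<le> M \<Longrightarrow> (u + v + 2) / 4 \<le> M" for u v M :: real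
      by simp
    ultimately show ?thesis unfolding exp_minus[symmetric] by blast
  qed
  also have "\<dots> = (exp \<bar>Im z\<bar>) ^ 2" by (rule exp_double)
  finally show ?thesis by (rule power2_le_imp_le) auto
qed

text \<open>The threshold 3 is met as soon as the imaginary part is pi times a number that is at
  least 1.\<close>

lemma norm_sin_lower: "1 \<le> norm (sin (z :: complex))" if "Im z \<ge> 3"
proof -
  have "exp (2 * Im z) \<ge> 1 + 2 * Im z" by (rule exp_ge_add_one_self)
  then have "4 \<le> exp (2 * Im z) + inverse (exp (2 * Im z)) - 2 * cos (2 * Re z)"
    using that cos_le_one[of "2 * Re z"] exp_gt_zero[of "2 * Im z"]
      positive_imp_inverse_positive[of "exp (2 * Im z)"] by linarith
  then have "1 ^ 2 \<le> norm (sin z) ^ 2" unfolding norm_sin_squared by simp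
  then show ?thesis by (rule power2_le_imp_le) auto
qed

definition sin_list :: "(real \<times> complex) list \<Rightarrow> complex \<Rightarrow> real" where
  "sin_list gs s = (\<Prod>(l, m)\<leftarrow>gs. norm (sin (of_real pi * (of_real l * s + m))) / pi)"

lemma sin_list_upper:
  assumes "\<And>l m. (l, m) \<in> set gs \<Longrightarrow> l > 0"
  shows "\<exists>H>0. \<forall>s. Im s \<in> {A..B} \<longrightarrow> sin_list gs s \<le> H \<and> 0 \<le> sin_list gs s"
  using assms
proof (induction gs)
  case Nil
  show ?case by (intro exI[of _ 1]) (auto simp: sin_list_def)
next
  case (Cons g gs)
  obtain l m where g: "g = (l, m)" by force
  then have l: "l > 0" using Cons.prems by auto
  obtain H where H: "H > 0" "\<And>s. Im s \<in> {A..B} \<Longrightarrow> sin_list gs s \<le> H \<and> 0 \<le> sin_list gs s"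
    using Cons by fastforce
  define K where "K = exp (pi * (l * (\<bar>A\<bar> + \<bar>B\<bar>) + \<bar>Im m\<bar>)) / pi"
  have K: "norm (sin (of_real pi * (of_real l * s + m))) / pi \<le> K" if s: "Im s \<in> {A..B}" for s
  proof -
    have "\<bar>l * Im s\<bar> \<le> l * (\<bar>A\<bar> + \<bar>B\<bar>)" unfolding abs_mult using s l by (intro mult_mono) auto
    then have "\<bar>l * Im s + Im m\<bar> \<le> l * (\<bar>A\<bar> + \<bar>B\<bar>) + \<bar>Im m\<bar>"
      by linarith
    then have "\<bar>Im (of_real pi * (of_real l * s + m))\<bar> \<le> pi * (l * (\<bar>A\<bar> + \<bar>B\<bar>) + \<bar>Im m\<bar>)"
      by (simp add: abs_mult)
    then show ?thesis
      unfolding K_def by (intro divide_right_mono order_trans[OF norm_sin_upper]) auto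
  qed
  show ?case
  proof (intro exI[of _ "K * H"] conjI allI impI)
    show "K * H > 0" using H(1) by (simp add: K_def)
    fix s assume s: "Im s \<in> {A..B}"
    show "sin_list (g # gs) s \<le> K * H"
      using mult_mono[OF K[OF s], of "sin_list gs s" H] H(2)[OF s] by (simp add: sin_list_def g K_def)
    show "0 \<le> sin_list (g # gs) s"
      using H(2)[OF s] by (simp add: sin_list_def g)
  qed
qed

text \<open>The sines vanish only where some l Im s + Im m is 0. Being at distance 1 above these
  lines bounds every sine below by 1, whatever the real part.\<close>

lemma sin_list_lower:
  assumes "\<And>l m. (l, m) \<in> set gs \<Longrightarrow> l * Im s + Im m \<ge> 1"
  shows "sin_list gs s \<ge> (1 / pi) ^ length gs"
  using assms
proof (induction gs)
  case (Cons g gs)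
  obtain l m where g: "g = (l, m)" by force
  have "l * Im s + Im m \<ge> 1" using Cons.prems g by auto
  then have "pi * 1 \<le> pi * (l * Im s + Im m)"
    by (intro mult_left_mono) auto
  then have "3 \<le> pi * (l * Im s + Im m)"
    using pi_gt3 by linarith
  then have "1 \<le> norm (sin (of_real pi * (of_real l * s + m)))"
    by (intro norm_sin_lower) auto
  then have "1 / pi \<le> norm (sin (of_real pi * (of_real l * s + m))) / pi"
    by (intro divide_right_mono) auto
  from mult_mono[OF this, of "(1 / pi) ^ length gs" "sin_list gs s"] Cons
  show ?case by (auto simp: g sin_list_def)
qed (auto simp: sin_list_def)

lemma norm_fe_factor:
  assumes "fe_Q D > 0" "norm (fe_root D) = 1" and "\<And>l m. (l, m) \<in> set (fe_gamma D) \<Longrightarrow> l * x + (1 - Re m) > 0"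
  shows "norm (fe_factor D (Complex (- x) t)) = fe_Q D powr (1 + 2 * x) *
     ((\<Prod>(l, m)\<leftarrow>fe_gamma D. gamma_pair l m x t) * sin_list (fe_gamma D) (Complex (- x) t))"
proof -
  let ?s = "Complex (- x) t"
  have "norm (\<Prod>(l, m)\<leftarrow>gs. Gamma (of_real l * (1 - ?s) + cnj m) * rGamma (of_real l * ?s + m)) =
      (\<Prod>(l, m)\<leftarrow>gs. gamma_pair l m x t) * sin_list gs ?s" if "set gs \<subseteq> set (fe_gamma D)" for gs
    using that
  proof (induction gs)
    case (Cons g gs)
    obtain l m where g: "g = (l, m)" by force
    let ?w = "of_real l * ?s + m"
    have w1: "1 - ?w = Complex (l * x + (1 - Re m)) (- (l * t + Im m))"
      by (simp add: complex_eq_iff)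
    have w2: "of_real l * (1 - ?s) + cnj m = Complex (l * x + (l + Re m)) (- (l * t + Im m))"
      by (simp add: complex_eq_iff algebra_simps)
    \<comment> \<open>Away from the poles the totalised \<open>Gamma\<close> is nonzero, so the
      reflection formula may be solved for \<open>rGamma ?w\<close>.\<close>
    have "Re (1 - ?w) > 0" using assms(3)[of l m] Cons.prems g by (simp add: w1)
    then have nz: "Gamma (1 - ?w) \<noteq> 0"
      using complex_notin_nonpos_Ints[of "1 - ?w"] by (simp add: Gamma_eq_zero_iff)
    have "rGamma ?w * rGamma (1 - ?w) = sin (of_real pi * ?w) / of_real pi"
      by (rule rGamma_reflection_complex)
    then have "rGamma ?w * inverse (Gamma (1 - ?w)) = sin (of_real pi * ?w) / of_real pi"
      unfolding rGamma_inverse_Gamma[of "1 - ?w"] .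
    moreover have "x * inverse g = y \<Longrightarrow> g \<noteq> 0 \<Longrightarrow> x = g * y" for x y g :: complex by auto
    ultimately have "rGamma ?w = Gamma (1 - ?w) * (sin (of_real pi * ?w) / of_real pi)"
      using nz by blast
    then have pair: "norm (Gamma (of_real l * (1 - ?s) + cnj m) * rGamma ?w) =
        gamma_pair l m x t * (norm (sin (of_real pi * ?w)) / pi)"
      unfolding gamma_pair_def w1[symmetric] w2[symmetric] by (simp add: norm_mult norm_divide)
    have "norm (\<Prod>(l, m)\<leftarrow>g # gs. Gamma (of_real l * (1 - ?s) + cnj m) * rGamma (of_real l * ?s + m)) =
        norm (Gamma (of_real l * (1 - ?s) + cnj m) * rGamma ?w) *
        norm (\<Prod>(l, m)\<leftarrow>gs. Gamma (of_real l * (1 - ?s) + cnj m) * rGamma (of_real l * ?s + m))"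
      by (simp add: g norm_mult)
    also have "\<dots> = gamma_pair l m x t * (norm (sin (of_real pi * ?w)) / pi) *
        ((\<Prod>(l, m)\<leftarrow>gs. gamma_pair l m x t) * sin_list gs ?s)"
      using Cons.prems by (subst Cons.IH) (auto simp only: pair set_simps insert_subset)
    also have "\<dots> = (\<Prod>(l, m)\<leftarrow>g # gs. gamma_pair l m x t) * sin_list (g # gs) ?s"
      by (simp add: g sin_list_def)
    finally show ?case .
  qed (simp add: sin_list_def)
  from this[OF subset_refl] show ?thesis
    using assms(1,2) by (simp add: fe_factor_def norm_mult norm_powr_real_powr)
qed

section \<open>Comparison of |F| with the growth allowed in the class M\<close>

text \<open>The bound of \<open>class_M\<close> at x = -sigma, stripped of the factor
  |sigma|^C.\<close>

definition growth_model :: "real \<Rightarrow> real \<Rightarrow> real \<Rightarrow> real" where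
  "growth_model d h x = x powr (d * x) * (h / (2 * pi * exp 1) powr d) powr x"

lemma ln_growth_model:
  assumes "x > 0" "h > 0"
  shows "growth_model d h x > 0"
    "ln (growth_model d h x) = d * x * ln x + x * (ln h - d * (ln (2 * pi) + 1))"
  using assms by (auto simp: growth_model_def ln_mult ln_div ln_powr)

lemma selberg_conductor_pos:
  assumes "functional_equation (fe_of F) F"
  shows "selberg_conductor F > 0"
    "ln (selberg_conductor F) = selberg_degree F * ln (2 * pi) + 2 * ln (fe_Q (fe_of F)) +
      (\<Sum>(l, m)\<leftarrow>fe_gamma (fe_of F). 2 * l * ln l)"
proof -
  have Q: "fe_Q (fe_of F) > 0" and gam: "\<And>l m. (l, m) \<in> set (fe_gamma (fe_of F)) \<Longrightarrow> l > 0"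
    using assms by (auto simp: functional_equation_def)
  have *: "(\<Prod>(l, m)\<leftarrow>gs. l powr (2 * l)) > 0 \<and>
      ln (\<Prod>(l, m)\<leftarrow>gs. l powr (2 * l)) = (\<Sum>(l, m)\<leftarrow>gs. 2 * l * ln l)"
    if "set gs \<subseteq> set (fe_gamma (fe_of F))" for gs
    using that
  proof (induction gs)
    case (Cons g gs)
    obtain l m where g: "g = (l, m)" by force
    then have "l > 0" using gam Cons.prems by auto
    with Cons show ?case by (auto simp: g ln_mult_pos ln_powr)
  qed simp
  show "selberg_conductor F > 0"
    unfolding selberg_conductor_def using Q *[OF subset_refl] by auto
  show "ln (selberg_conductor F) = selberg_degree F * ln (2 * pi) + 2 * ln (fe_Q (fe_of F)) +
      (\<Sum>(l, m)\<leftarrow>fe_gamma (fe_of F). 2 * l * ln l)"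
    unfolding selberg_conductor_def using Q *[OF subset_refl]
    by (simp add: ln_mult_pos ln_powr ln_realpow del: ln_mult)
qed

lemma fe_of_functional_equation:
  "extended_selberg a F \<Longrightarrow> functional_equation (fe_of F) F"
  unfolding fe_of_def extended_selberg_def by (metis (mono_tags) someI_ex)

text \<open>The conductor is made for this identity: Q^2 and the lambda^(2 lambda) in it are the
  exponential rates left over by Stirling's formula, and the powers of 2 pi cancel. Hence F belongs
  to h = q_F, with no loss beyond a power of x.\<close>

lemma ln_growth_model_selberg:
  assumes "functional_equation (fe_of F) F" "x > 0"
  shows "ln (growth_model (selberg_degree F) (selberg_conductor F) x) =
    2 * x * ln (fe_Q (fe_of F)) +
    (\<Sum>(l, m)\<leftarrow>fe_gamma (fe_of F). 2 * (l * x * ln x + l * x * (ln l - 1)))"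
proof -
  have "(\<Sum>(l, m)\<leftarrow>gs. 2 * (l * x * ln x + l * x * (ln l - 1))) =
      2 * (\<Sum>(l, m)\<leftarrow>gs. l) * (x * ln x - x) + x * (\<Sum>(l, m)\<leftarrow>gs. 2 * l * ln l)"
    for gs :: "(real \<times> complex) list"
    by (induction gs) (auto simp: algebra_simps)
  then show ?thesis
    unfolding ln_growth_model(2)[OF assms(2) selberg_conductor_pos(1)[OF assms(1)]]
      selberg_conductor_pos(2)[OF assms(1)]
    by (simp add: selberg_degree_def algebra_simps)
qed

text \<open>On the reflected line Re s = 1 + x the tail bound with n = 1 gives 1/2 <= |F| <= 2. All
  else in the functional equation is Stirling, except the sines, which are kept explicit on both
  sides so that the upper and the lower bound of |F| come from one computation.\<close>

lemma selberg_growth_sandwich: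
  assumes S: "selberg a F"
  shows "\<exists>C. \<forall>\<^sub>F x in at_top. \<forall>t\<in>{A..B}.
    norm (F (Complex (- x) t)) \<le> growth_model (selberg_degree F) (selberg_conductor F) x * x powr C *
      sin_list (fe_gamma (fe_of F)) (Complex (- x) t) \<and>
    norm (F (Complex (- x) t)) \<ge> growth_model (selberg_degree F) (selberg_conductor F) x * x powr (- C) *
      sin_list (fe_gamma (fe_of F)) (Complex (- x) t)"
proof -
  define D where "D = fe_of F"
  let ?GM = "growth_model (selberg_degree F) (selberg_conductor F)"
  have es: "extended_selberg a F" using S by (simp add: selberg_def)
  have fe: "functional_equation D F" unfolding D_def by (rule fe_of_functional_equation[OF es])
  have hol: "F holomorphic_on - {1}" by (rule extended_selberg_holomorphic[OF es])
  have Q: "fe_Q D > 0" and root: "norm (fe_root D) = 1"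
    and gam: "\<And>l m. (l, m) \<in> set (fe_gamma D) \<Longrightarrow> l > 0"
    using fe by (auto simp: functional_equation_def)
  have exp: "abs_dirichlet_expansion a F" using es by (simp add: extended_selberg_def)
  obtain K where K: "K \<ge> 0" "\<And>s. Re s \<ge> 2 \<Longrightarrow> norm (F s * of_nat 1 powr s - a 1) \<le> K * (real 1 / real (1 + 1)) powr (Re s)"
    using dirichlet_tail_bound[OF exp, of 1] by auto
  obtain C where C: "\<forall>\<^sub>F x in at_top. \<forall>t\<in>{A..B}. (\<Prod>(l, m)\<leftarrow>fe_gamma D. gamma_pair l m x t) > 0 \<and>
    \<bar>ln (\<Prod>(l, m)\<leftarrow>fe_gamma D. gamma_pair l m x t) -
      (\<Sum>(l, m)\<leftarrow>fe_gamma D. 2 * (l * x * ln x + l * x * (ln l - 1)))\<bar> \<le> C * ln x"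
    using gamma_pair_list_asymp[of "fe_gamma D" A B] gam by blast
  have "\<forall>\<^sub>F x in at_top. l * x + (1 - Re m) > 0" if "(l, m) \<in> set (fe_gamma D)" for l m
    using gam[OF that] by real_asymp
  then have ev1: "\<forall>\<^sub>F x in at_top. \<forall>(l, m)\<in>set (fe_gamma D). l * x + (1 - Re m) > 0"
    by (intro eventually_ball_finite) auto
  have "((\<lambda>x. K * (1 / 2) powr (1 + x)) \<longlongrightarrow> 0) at_top" by real_asymp
  then have ev2: "\<forall>\<^sub>F x in at_top. K * (1 / 2) powr (1 + x) < 1 / 2"
    by (rule order_tendstoD) simp
  \<comment> \<open>The extra power of x absorbs the constant factors 2 Q and Q / 2; hence the
    thresholds 2 Q and 2 / Q for x.\<close>
  show ?thesis
  proof (intro exI[of _ "C + 1"])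
    show "\<forall>\<^sub>F x in at_top. \<forall>t\<in>{A..B}.
      norm (F (Complex (- x) t)) \<le> ?GM x * x powr (C + 1) * sin_list (fe_gamma (fe_of F)) (Complex (- x) t) \<and>
      norm (F (Complex (- x) t)) \<ge> ?GM x * x powr (- (C + 1)) * sin_list (fe_gamma (fe_of F)) (Complex (- x) t)"
      using C ev1 ev2 eventually_ge_at_top[of "2 * fe_Q D"] eventually_ge_at_top[of "2 / fe_Q D"]
        eventually_ge_at_top[of 1]
    proof eventually_elim
      case (elim x)
      show ?case
      proof
        fix t assume t: "t \<in> {A..B}"
        let ?s = "Complex (- x) t"
        let ?P = "\<Prod>(l, m)\<leftarrow>fe_gamma D. gamma_pair l m x t"
        have x0: "x > 0" using elim by linarith
        have sl: "sin_list gs ?s \<ge> 0" for gs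
          by (induction gs) (auto simp: sin_list_def)
        have w: "cnj (1 - ?s) = Complex (1 + x) t" by (simp add: complex_eq_iff)
        have a1: "a 1 = 1" by (rule selberg_multiplicative(1)[OF S])
        have "norm (F (Complex (1 + x) t) - 1) \<le> 1 / 2"
          using K(2)[of "Complex (1 + x) t"] elim(3,6) a1 by simp
        then have w12: "norm (F (Complex (1 + x) t)) \<le> 2" "norm (F (Complex (1 + x) t)) \<ge> 1 / 2"
          using norm_triangle_ineq2[of "F (Complex (1 + x) t)" 1] norm_triangle_ineq3[of "F (Complex (1 + x) t)" 1]
          by auto
        define T where "T = fe_Q D powr (1 + 2 * x) * ?P"
        have P: "?P > 0" "\<bar>ln ?P - (\<Sum>(l, m)\<leftarrow>fe_gamma D. 2 * (l * x * ln x + l * x * (ln l - 1)))\<bar> \<le> C * ln x"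
          using elim(1) t by auto
        have GM: "?GM x > 0"
          using ln_growth_model(1)[OF x0 selberg_conductor_pos(1)] fe by (simp add: D_def)
        have T0: "T > 0" using P(1) Q by (simp add: T_def)
        have lnT: "ln T = ln (fe_Q D) + 2 * x * ln (fe_Q D) + ln ?P"
          using P(1) Q by (simp add: T_def ln_mult_pos ln_powr ring_distribs)
        have T1: "\<bar>ln T - ln (fe_Q D) - ln (?GM x)\<bar> \<le> C * ln x"
          using P(2) lnT ln_growth_model_selberg[of F, OF _ x0] fe by (simp add: D_def)
        have "ln T \<le> ln (?GM x * x powr C * fe_Q D)"
          using T1 GM x0 Q by (simp add: ln_mult_pos ln_powr)
        then have Tu: "T \<le> ?GM x * x powr C * fe_Q D"
          using T0 GM x0 Q by (subst (asm) ln_le_cancel_iff) auto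
        have "ln (?GM x * x powr (- C) * fe_Q D) \<le> ln T"
          using T1 GM x0 Q by (simp add: ln_mult_pos ln_powr)
        then have Tl: "?GM x * x powr (- C) * fe_Q D \<le> T"
          using T0 GM x0 Q by (subst (asm) ln_le_cancel_iff) auto
        have "norm (fe_factor D ?s) = T * sin_list (fe_gamma D) ?s"
          unfolding T_def mult.assoc by (rule norm_fe_factor[OF Q root]) (use elim(2) in fast)
        moreover have "F ?s = fe_factor D ?s * cnj (F (cnj (1 - ?s)))"
          by (rule functional_equation_pointwise[OF fe hol]) (use x0 in \<open>auto simp: complex_eq_iff\<close>)
        ultimately have nF: "norm (F ?s) = (T * norm (F (Complex (1 + x) t))) * sin_list (fe_gamma D) ?s"
          unfolding w by (simp add: norm_mult)
        have "T * norm (F (Complex (1 + x) t)) \<le> (?GM x * x powr C * fe_Q D) * 2"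
          using Tu w12(1) T0 by (intro mult_mono) auto
        also have "\<dots> = ?GM x * x powr C * (2 * fe_Q D)" by simp
        also have "\<dots> \<le> ?GM x * x powr C * x"
          using elim(4) GM by (intro mult_left_mono) auto
        also have "\<dots> = ?GM x * x powr (C + 1)" using x0 by (simp add: powr_add)
        finally have up: "T * norm (F (Complex (1 + x) t)) \<le> ?GM x * x powr (C + 1)" .
        have "?GM x * x powr (- (C + 1)) = ?GM x * x powr (- C) * (1 / x)"
          using x0 by (simp add: powr_diff powr_minus field_simps)
        also have "\<dots> \<le> ?GM x * x powr (- C) * (fe_Q D / 2)"
          using elim(5) GM x0 Q by (intro mult_left_mono) (auto simp: field_simps)
        also have "\<dots> = (?GM x * x powr (- C) * fe_Q D) * (1 / 2)" by simp
        also have "\<dots> \<le> T * norm (F (Complex (1 + x) t))"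
          using Tl w12(2) T0 by (intro mult_mono) auto
        finally have lo: "?GM x * x powr (- (C + 1)) \<le> T * norm (F (Complex (1 + x) t))" .
        show "norm (F ?s) \<le> ?GM x * x powr (C + 1) * sin_list (fe_gamma (fe_of F)) ?s \<and>
          norm (F ?s) \<ge> ?GM x * x powr (- (C + 1)) * sin_list (fe_gamma (fe_of F)) ?s"
          unfolding nF D_def[symmetric] using up lo sl by (auto intro!: mult_right_mono)
      qed
    qed
  qed
qed

lemma selberg_growth_upper:
  assumes S: "selberg a F"
  shows "\<exists>C. \<forall>\<^sub>F x in at_top. \<forall>t\<in>{A..B}.
    norm (F (Complex (- x) t)) \<le> growth_model (selberg_degree F) (selberg_conductor F) x * x powr C"
proof -
  let ?GM = "growth_model (selberg_degree F) (selberg_conductor F)"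
  let ?L = "fe_gamma (fe_of F)"
  have fe: "functional_equation (fe_of F) F"
    using S by (intro fe_of_functional_equation) (auto simp: selberg_def)
  obtain C where C0: "\<forall>\<^sub>F x in at_top. \<forall>t\<in>{A..B}.
      norm (F (Complex (- x) t)) \<le> ?GM x * x powr C * sin_list ?L (Complex (- x) t) \<and>
      norm (F (Complex (- x) t)) \<ge> ?GM x * x powr (- C) * sin_list ?L (Complex (- x) t)"
      using selberg_growth_sandwich[OF S, of A B] by blast
    have C: "\<forall>\<^sub>F x in at_top. \<forall>t\<in>{A..B}. norm (F (Complex (- x) t)) \<le> ?GM x * x powr C * sin_list ?L (Complex (- x) t)"
      by (rule eventually_mono[OF C0]) auto
  obtain H where H: "H > 0" "\<And>s. Im s \<in> {A..B} \<Longrightarrow> sin_list ?L s \<le> H"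
    using sin_list_upper[of ?L A B] fe by (auto simp: functional_equation_def)
  show ?thesis
  proof (intro exI[of _ "C + 1"])
    show "\<forall>\<^sub>F x in at_top. \<forall>t\<in>{A..B}. norm (F (Complex (- x) t)) \<le> ?GM x * x powr (C + 1)"
      using C eventually_ge_at_top[of H] eventually_gt_at_top[of 0]
    proof eventually_elim
      case (elim x)
      have GM: "?GM x > 0" by (rule ln_growth_model(1)[OF elim(3) selberg_conductor_pos(1)[OF fe]])
      show ?case
      proof
        fix t assume t: "t \<in> {A..B}"
        have "norm (F (Complex (- x) t)) \<le> ?GM x * x powr C * sin_list ?L (Complex (- x) t)"
          using elim(1) t by auto
        also have "\<dots> \<le> ?GM x * x powr C * x"
          using H(2)[of "Complex (- x) t"] t elim(2) GM by (intro mult_left_mono) auto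
        finally show "norm (F (Complex (- x) t)) \<le> ?GM x * x powr (C + 1)"
          using elim(3) by (simp add: powr_add)
      qed
    qed
  qed
qed

text \<open>The sine product must stay away from 0, so the window has to begin above every line of
  trivial zeros; its upper end is free and is later set one period higher.\<close>

lemma selberg_growth_lower:
  assumes S: "selberg a F"
  shows "\<forall>\<^sub>F A in at_top. \<forall>B. \<exists>C. \<forall>\<^sub>F x in at_top. \<forall>t\<in>{A..B}.
    norm (F (Complex (- x) t)) \<ge> growth_model (selberg_degree F) (selberg_conductor F) x * x powr C"
proof -
  let ?GM = "growth_model (selberg_degree F) (selberg_conductor F)"
  let ?L = "fe_gamma (fe_of F)"
  have fe: "functional_equation (fe_of F) F"
    using S by (intro fe_of_functional_equation) (auto simp: selberg_def)
  have gam: "l > 0" if "(l, m) \<in> set ?L" for l m using fe that by (auto simp: functional_equation_def)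
  have "\<forall>\<^sub>F y in at_top. l * y + Im m \<ge> 1" if "(l, m) \<in> set ?L" for l m
    using gam[OF that] by real_asymp
  then have "\<forall>\<^sub>F A in at_top. \<forall>(l, m)\<in>set ?L. l * A + Im m \<ge> 1"
    by (intro eventually_ball_finite) auto
  then show ?thesis
  proof (eventually_elim, intro allI)
    fix A B :: real assume A: "\<forall>(l, m)\<in>set ?L. l * A + Im m \<ge> 1"
    obtain C where C0: "\<forall>\<^sub>F x in at_top. \<forall>t\<in>{A..B}.
      norm (F (Complex (- x) t)) \<le> ?GM x * x powr C * sin_list ?L (Complex (- x) t) \<and>
      norm (F (Complex (- x) t)) \<ge> ?GM x * x powr (- C) * sin_list ?L (Complex (- x) t)"
      using selberg_growth_sandwich[OF S, of A B] by blast
    have C: "\<forall>\<^sub>F x in at_top. \<forall>t\<in>{A..B}. norm (F (Complex (- x) t)) \<ge> ?GM x * x powr (- C) * sin_list ?L (Complex (- x) t)"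
      by (rule eventually_mono[OF C0]) auto
    show "\<exists>C. \<forall>\<^sub>F x in at_top. \<forall>t\<in>{A..B}. norm (F (Complex (- x) t)) \<ge> ?GM x * x powr C"
    proof (intro exI[of _ "- C - 1"])
      show "\<forall>\<^sub>F x in at_top. \<forall>t\<in>{A..B}. norm (F (Complex (- x) t)) \<ge> ?GM x * x powr (- C - 1)"
        using C eventually_ge_at_top[of "pi ^ length ?L"] eventually_gt_at_top[of 0]
      proof eventually_elim
        case (elim x)
        have GM: "?GM x > 0" by (rule ln_growth_model(1)[OF elim(3) selberg_conductor_pos(1)[OF fe]])
        show ?case
        proof
          fix t assume t: "t \<in> {A..B}"
          have "1 / x \<le> (1 / pi) ^ length ?L"
            using elim(2,3) by (simp add: power_one_over field_simps)
          also have "\<dots> \<le> sin_list ?L (Complex (- x) t)"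
          proof (rule sin_list_lower)
            fix l m assume lm: "(l, m) \<in> set ?L"
            then have "l * A \<le> l * t" using gam[OF lm] t by (intro mult_left_mono) auto
            with A lm show "1 \<le> l * Im (Complex (- x) t) + Im m" by fastforce
          qed
          finally have "?GM x * x powr (- C) * (1 / x) \<le> ?GM x * x powr (- C) * sin_list ?L (Complex (- x) t)"
            using GM by (intro mult_left_mono) auto
          also have "\<dots> \<le> norm (F (Complex (- x) t))" using elim(1) t by auto
          finally show "?GM x * x powr (- C - 1) \<le> norm (F (Complex (- x) t))"
            using elim(3) by (simp add: powr_diff)
        qed
      qed
    qed
  qed
qed

section \<open>The class M and twists\<close>

lemma growth_model_nonneg: "growth_model d h x \<ge> 0"
  by (simp add: growth_model_def)

lemma growth_model_mult:
  assumes "h \<ge> 0" "r \<ge> 0"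
  shows "growth_model d (h * r) x = growth_model d h x * r powr x"
  using assms by (simp add: growth_model_def powr_mult powr_divide)

lemma growth_model_mono:
  assumes "0 < h" "h \<le> h'" "x \<ge> 0"
  shows "growth_model d h x \<le> growth_model d h' x"
  unfolding growth_model_def using assms by (intro mult_left_mono powr_mono2 divide_right_mono) auto

text \<open>For x >= K the multiplicative constant K is absorbed by raising the exponent C by one.
  Later bounds dispose of their constants in the same way.\<close>

lemma class_M_iff:
  "f \<in> class_M d h \<longleftrightarrow> f meromorphic_on UNIV \<and> f holomorphic_on {s. Re s < 1} \<and>
    (\<forall>A B. A < B \<longrightarrow> (\<exists>C. \<forall>\<^sub>F x in at_top. \<forall>t\<in>{A..B}.
      norm (f (Complex (- x) t)) \<le> growth_model d h x * x powr C))"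
proof -
  have "(\<exists>C K. eventually (\<lambda>\<sigma>. \<forall>t\<in>{A..B}. norm (f (Complex \<sigma> t)) \<le>
            K * (\<bar>\<sigma>\<bar> powr (d * \<bar>\<sigma>\<bar>) * (h / (2 * pi * exp 1) powr d) powr \<bar>\<sigma>\<bar> * \<bar>\<sigma>\<bar> powr C)) at_bot) \<longleftrightarrow>
        (\<exists>C. \<forall>\<^sub>F x in at_top. \<forall>t\<in>{A..B}. norm (f (Complex (- x) t)) \<le> growth_model d h x * x powr C)"
    (is "?L \<longleftrightarrow> ?R") for A B
  proof
    assume ?L
    then obtain C K where CK: "\<forall>\<^sub>F x in at_top. \<forall>t\<in>{A..B}. norm (f (Complex (- x) t)) \<le>
        K * (\<bar>x\<bar> powr (d * \<bar>x\<bar>) * (h / (2 * pi * exp 1) powr d) powr \<bar>x\<bar> * \<bar>x\<bar> powr C)"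
      by (auto simp: at_bot_mirror eventually_filtermap)
    show ?R
    proof (intro exI[of _ "C + 1"])
      show "\<forall>\<^sub>F x in at_top. \<forall>t\<in>{A..B}. norm (f (Complex (- x) t)) \<le> growth_model d h x * x powr (C + 1)"
        using CK eventually_ge_at_top[of K] eventually_gt_at_top[of 0]
      proof eventually_elim
        case (elim x)
        show ?case
        proof
          fix t assume "t \<in> {A..B}"
          then have "norm (f (Complex (- x) t)) \<le> K * (growth_model d h x * x powr C)"
            using elim(1,3) by (simp add: growth_model_def)
          also have "\<dots> \<le> x * (growth_model d h x * x powr C)"
            using elim(2) growth_model_nonneg by (intro mult_right_mono) auto
          finally show "norm (f (Complex (- x) t)) \<le> growth_model d h x * x powr (C + 1)"
            using elim(3) by (simp add: powr_add mult_ac)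
        qed
      qed
    qed
  next
    assume ?R
    then obtain C where C: "\<forall>\<^sub>F x in at_top. \<forall>t\<in>{A..B}. norm (f (Complex (- x) t)) \<le> growth_model d h x * x powr C"
      by blast
    have "\<forall>\<^sub>F x in at_top. \<forall>t\<in>{A..B}. norm (f (Complex (- x) t)) \<le>
        1 * (\<bar>x\<bar> powr (d * \<bar>x\<bar>) * (h / (2 * pi * exp 1) powr d) powr \<bar>x\<bar> * \<bar>x\<bar> powr C)"
      using C eventually_gt_at_top[of 0] by eventually_elim (simp add: growth_model_def)
    then have "eventually (\<lambda>\<sigma>. \<forall>t\<in>{A..B}. norm (f (Complex \<sigma> t)) \<le>
            1 * (\<bar>\<sigma>\<bar> powr (d * \<bar>\<sigma>\<bar>) * (h / (2 * pi * exp 1) powr d) powr \<bar>\<sigma>\<bar> * \<bar>\<sigma>\<bar> powr C)) at_bot"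
      by (simp add: at_bot_mirror eventually_filtermap)
    then show ?L by blast
  qed
  then show ?thesis by (simp add: class_M_def)
qed

lemma class_M_add:
  assumes "f \<in> class_M d h" "g \<in> class_M d h"
  shows "(\<lambda>s. f s + g s) \<in> class_M d h"
  unfolding class_M_iff
proof (intro conjI allI impI)
  show "(\<lambda>s. f s + g s) meromorphic_on UNIV" "(\<lambda>s. f s + g s) holomorphic_on {s. Re s < 1}"
    using assms unfolding class_M_iff by (auto intro: meromorphic_intros holomorphic_intros)
  fix A B :: real assume "A < B"
  then obtain C1 C2 where
    C: "\<forall>\<^sub>F x in at_top. \<forall>t\<in>{A..B}. norm (f (Complex (- x) t)) \<le> growth_model d h x * x powr C1"
       "\<forall>\<^sub>F x in at_top. \<forall>t\<in>{A..B}. norm (g (Complex (- x) t)) \<le> growth_model d h x * x powr C2"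
    using assms unfolding class_M_iff by meson
  show "\<exists>C. \<forall>\<^sub>F x in at_top. \<forall>t\<in>{A..B}. norm (f (Complex (- x) t) + g (Complex (- x) t)) \<le> growth_model d h x * x powr C"
  proof (intro exI[of _ "max C1 C2 + 1"])
    show "\<forall>\<^sub>F x in at_top. \<forall>t\<in>{A..B}. norm (f (Complex (- x) t) + g (Complex (- x) t)) \<le>
        growth_model d h x * x powr (max C1 C2 + 1)"
      using C eventually_ge_at_top[of 2]
    proof eventually_elim
      case (elim x)
      show ?case
      proof
        fix t assume t: "t \<in> {A..B}"
        have "x powr C1 \<le> x powr max C1 C2" "x powr C2 \<le> x powr max C1 C2"
          using elim(3) by (auto intro!: powr_mono)
        then have "growth_model d h x * x powr C1 \<le> growth_model d h x * x powr max C1 C2"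
          "growth_model d h x * x powr C2 \<le> growth_model d h x * x powr max C1 C2"
          by (auto intro!: mult_left_mono growth_model_nonneg)
        moreover have "norm (f (Complex (- x) t) + g (Complex (- x) t)) \<le>
            norm (f (Complex (- x) t)) + norm (g (Complex (- x) t))"
          by (rule norm_triangle_ineq)
        ultimately have "norm (f (Complex (- x) t) + g (Complex (- x) t)) \<le>
            2 * (growth_model d h x * x powr max C1 C2)"
          using elim(1,2) t by fastforce
        also have "\<dots> \<le> x * (growth_model d h x * x powr max C1 C2)"
          using elim(3) growth_model_nonneg by (intro mult_right_mono) auto
        finally show "norm (f (Complex (- x) t) + g (Complex (- x) t)) \<le>
            growth_model d h x * x powr (max C1 C2 + 1)"
          using elim(3) by (simp add: powr_add mult_ac)
      qed
    qed
  qed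
qed

text \<open>A factor of size r^|sigma| multiplies h by r. Used with r = 1 for scalars and for
  enlarging h, and with r = p^N for a polynomial of degree N in p^(-s).\<close>

lemma class_M_mult:
  assumes f: "f \<in> class_M d h" and g: "g holomorphic_on UNIV"
    and g_bound: "\<And>s. Re s \<le> 0 \<Longrightarrow> norm (g s) \<le> K * r powr (- Re s)"
    and h: "0 < h" "0 \<le> r" "h * r \<le> h'"
  shows "(\<lambda>s. f s * g s) \<in> class_M d h'"
  unfolding class_M_iff
proof (intro conjI allI impI)
  have "g analytic_on UNIV" using g by (simp add: analytic_on_open)
  then show "(\<lambda>s. f s * g s) meromorphic_on UNIV"
    using f unfolding class_M_iff by (blast intro: meromorphic_on_mult analytic_on_imp_meromorphic_on)
  show "(\<lambda>s. f s * g s) holomorphic_on {s. Re s < 1}"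
    using f g unfolding class_M_iff by (auto intro!: holomorphic_intros intro: holomorphic_on_subset)
  fix A B :: real assume "A < B"
  then obtain C where
    C: "\<forall>\<^sub>F x in at_top. \<forall>t\<in>{A..B}. norm (f (Complex (- x) t)) \<le> growth_model d h x * x powr C"
    using f unfolding class_M_iff by meson
  show "\<exists>C. \<forall>\<^sub>F x in at_top. \<forall>t\<in>{A..B}. norm (f (Complex (- x) t) * g (Complex (- x) t)) \<le> growth_model d h' x * x powr C"
  proof (intro exI[of _ "C + 1"])
    show "\<forall>\<^sub>F x in at_top. \<forall>t\<in>{A..B}. norm (f (Complex (- x) t) * g (Complex (- x) t)) \<le>
        growth_model d h' x * x powr (C + 1)"
      using C eventually_ge_at_top[of K] eventually_gt_at_top[of 0]
    proof eventually_elim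
      case (elim x)
      show ?case
      proof
        fix t assume t: "t \<in> {A..B}"
        have "norm (g (Complex (- x) t)) \<le> K * r powr x"
          using g_bound[of "Complex (- x) t"] elim(3) by simp
        also have "\<dots> \<le> x * r powr x"
          using elim(2) by (intro mult_right_mono) auto
        finally have "norm (f (Complex (- x) t) * g (Complex (- x) t)) \<le> (growth_model d h x * x powr C) * (x * r powr x)"
          unfolding norm_mult using elim(1) t by (intro mult_mono) (auto intro!: mult_nonneg_nonneg growth_model_nonneg)
        also have "\<dots> = growth_model d (h * r) x * x powr (C + 1)"
          using h elim(3) by (simp add: growth_model_mult powr_add mult_ac)
        also have "\<dots> \<le> growth_model d h' x * x powr (C + 1)"
        proof (cases "r = 0")
          case True
          then show ?thesis by (simp add: growth_model_def)
        next
          case False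
          then show ?thesis
            using h elim(3) by (intro mult_right_mono growth_model_mono) auto
        qed
        finally show "norm (f (Complex (- x) t) * g (Complex (- x) t)) \<le> growth_model d h' x * x powr (C + 1)" .
      qed
    qed
  qed
qed

lemma series_in_M_add:
  assumes "series_in_M d h c" "series_in_M d h c'"
  shows "series_in_M d h (\<lambda>n. c n + c' n)"
proof -
  obtain f g where fg: "f \<in> class_M d h" "g \<in> class_M d h"
    "\<And>s. Re s > 1 \<Longrightarrow> dirichlet_term c s sums f s" "\<And>s. Re s > 1 \<Longrightarrow> dirichlet_term c' s sums g s"
    using assms unfolding series_in_M_def by blast
  have "dirichlet_term (\<lambda>n. c n + c' n) s sums (f s + g s)" if "Re s > 1" for s
    using sums_add[OF fg(3,4)[OF that]] by (simp add: dirichlet_term_def[abs_def] ring_distribs)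
  with class_M_add[OF fg(1,2)] show ?thesis
    unfolding series_in_M_def by (intro bexI[of _ "\<lambda>s. f s + g s"]) auto
qed

lemma series_in_M_cmult:
  assumes "series_in_M d h c" "h > 0"
  shows "series_in_M d h (\<lambda>n. z * c n)"
proof -
  obtain f where f: "f \<in> class_M d h" "\<And>s. Re s > 1 \<Longrightarrow> dirichlet_term c s sums f s"
    using assms unfolding series_in_M_def by blast
  have "(\<lambda>s. f s * z) \<in> class_M d h"
    by (rule class_M_mult[OF f(1), of _ "norm z" 1]) (use assms in auto)
  moreover have "dirichlet_term (\<lambda>n. z * c n) s sums (f s * z)" if "Re s > 1" for s
    using sums_mult2[OF f(2)[OF that], of z] by (simp add: dirichlet_term_def[abs_def] mult_ac)
  ultimately show ?thesis
    unfolding series_in_M_def by (intro bexI[of _ "\<lambda>s. f s * z"]) auto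
qed

lemma zero_series_in_M: "series_in_M d h (\<lambda>_. 0)"
proof -
  have "(\<lambda>_. 0) \<in> class_M d h"
    unfolding class_M_iff by (auto simp: growth_model_nonneg)
  then show ?thesis
    unfolding series_in_M_def by (intro bexI[of _ "\<lambda>_. 0"]) (auto simp: dirichlet_term_def[abs_def])
qed

lemma series_in_M_sum:
  assumes "\<And>i. i \<in> I \<Longrightarrow> series_in_M d h (c i)" "h > 0"
  shows "series_in_M d h (\<lambda>n. \<Sum>i\<in>I. z i * c i n)"
  using assms(1)
proof (induction I rule: infinite_finite_induct)
  case (insert i I)
  then show ?case
    by (auto intro!: series_in_M_add series_in_M_cmult assms(2))
qed (auto intro: zero_series_in_M)

lemma selberg_in_class_M:
  assumes S: "selberg a F"
  shows "F \<in> class_M (selberg_degree F) (selberg_conductor F)"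
proof -
  have es: "extended_selberg a F" using S by (simp add: selberg_def)
  have "F holomorphic_on {s. Re s < 1}"
    by (rule holomorphic_on_subset[OF extended_selberg_holomorphic[OF es]]) auto
  moreover have "F meromorphic_on UNIV"
    using es by (auto simp: extended_selberg_def nicely_meromorphic_on_def)
  ultimately show ?thesis
    unfolding class_M_iff using selberg_growth_upper[OF S] by blast
qed

section \<open>Passing between linear twists and character twists\<close>

lemma char_twist_as_linear_twists:
  assumes "\<And>k::int. \<not> int p dvd k \<Longrightarrow> series_in_M d h (linear_twist a (of_int k / of_nat p))"
    and X: "dirichlet_character p X" "X \<noteq> principal_character p" and p: "p > 1" and h: "h > 0"
  shows "series_in_M d h (char_twist a X)"
proof -
  obtain c where c: "\<And>n. X n = (\<Sum>k=1..<p. c k * unit_root p (- (int n * int k)))"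
    using dirichlet_character_as_additive[OF X p] by blast
  have "series_in_M d h (\<lambda>n. \<Sum>k=1..<p. c k * linear_twist a (of_int (int k) / of_nat p) n)"
    by (intro series_in_M_sum assms(1) h) (auto dest: zdvd_imp_le)
  also have "(\<lambda>n. \<Sum>k=1..<p. c k * linear_twist a (of_int (int k) / of_nat p) n) = char_twist a X"
    unfolding linear_twist_eq char_twist_def c by (simp add: sum_distrib_left mult_ac)
  finally show ?thesis .
qed

text \<open>Adds up all the admissible linear twists. The complete sum of e(-nk/p) over k mod p is p
  or 0, and removing k = 0 leaves p - 1 on multiples of p and -1 elsewhere. The principal twist
  cannot be isolated from the untwisted series here: only this combination is available.\<close>

lemma principal_twist_from_linear_twists:
  assumes "\<And>k::int. \<not> int p dvd k \<Longrightarrow> series_in_M d h (linear_twist a (of_int k / of_nat p))"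
    and p: "prime p" and h: "h > 0"
  shows "series_in_M d h (\<lambda>n. a n * (of_nat p - 1 - of_nat p * principal_character p n))"
proof -
  have p1: "p > 1" using p by (rule prime_gt_1_nat)
  have "series_in_M d h (\<lambda>n. \<Sum>k=1..<p. 1 * linear_twist a (of_int (int k) / of_nat p) n)"
    by (intro series_in_M_sum assms(1) h) (auto dest: zdvd_imp_le)
  also have "(\<lambda>n. \<Sum>k=1..<p. 1 * linear_twist a (of_int (int k) / of_nat p) n) =
      (\<lambda>n. a n * (of_nat p - 1 - of_nat p * principal_character p n))"
  proof
    fix n
    have "(\<Sum>k<p. unit_root p (int k * (- int n))) = (if int p dvd - int n then of_nat p else 0)"
      by (rule sum_unit_roots) (use p1 in auto)
    also have "int p dvd - int n \<longleftrightarrow> \<not> coprime n p"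
    proof -
      have "p dvd n \<longleftrightarrow> \<not> coprime n p"
      proof
        assume "p dvd n"
        then show "\<not> coprime n p"
          using p by (meson coprime_common_divisor dvd_refl not_prime_unit)
      qed (use p prime_imp_coprime coprime_commute in blast)
      then show ?thesis by simp
    qed
    also have "(\<Sum>k<p. unit_root p (int k * (- int n))) = 1 + (\<Sum>k=1..<p. unit_root p (int k * (- int n)))"
      using p1 by (simp add: lessThan_atLeast0 sum.atLeast_Suc_lessThan)
    finally have "(\<Sum>k=1..<p. unit_root p (- (int n * int k))) = of_nat p - 1 - of_nat p * principal_character p n"
      by (auto simp: principal_character_def algebra_simps split: if_splits)
    then show "(\<Sum>k=1..<p. 1 * linear_twist a (of_int (int k) / of_nat p) n) =
        a n * (of_nat p - 1 - of_nat p * principal_character p n)"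
      unfolding linear_twist_eq by (simp flip: sum_distrib_left)
  qed
  finally show ?thesis .
qed

text \<open>On n prime to p the additive character is a combination of Dirichlet characters,
  possibly including the principal one. On multiples of p it is 1, and that part of the twist is the
  untwisted series minus its principal twist; this is why both occur among the hypotheses.\<close>

lemma linear_twist_from_char_twists:
  assumes a: "series_in_M d h a" "series_in_M d h (char_twist a (principal_character p))"
    and X: "\<And>X. dirichlet_character p X \<Longrightarrow> X \<noteq> principal_character p \<Longrightarrow> series_in_M d h (char_twist a X)"
    and p: "prime p" and h: "h > 0"
  shows "series_in_M d h (linear_twist a (of_int k / of_nat p))"
proof -
  have p1: "p > 1" using p by (rule prime_gt_1_nat)
  define \<phi> where "\<phi> = (\<lambda>n. unit_root p (- (int n * k)))"
  have per: "\<phi> (n + p) = \<phi> n" for n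
    unfolding \<phi>_def by (rule unit_root_cong) (use p1 in \<open>auto simp: cong_iff_dvd_diff algebra_simps\<close>)
  obtain c Y where Y: "\<And>j. dirichlet_character p (Y j)"
    "\<And>n. coprime n p \<Longrightarrow> \<phi> n = (\<Sum>j<p-1. c j * Y j n)"
    by (rule periodic_as_characters[of p \<phi>, OF p per]) (rule that, auto)
  have "series_in_M d h (char_twist a (Y j))" for j
    using X[OF Y(1)[of j]] a(2) by (cases "Y j = principal_character p") auto
  then have "series_in_M d h (\<lambda>n. a n + ((-1) * char_twist a (principal_character p) n +
      (\<Sum>j<p-1. c j * char_twist a (Y j) n)))"
    by (intro series_in_M_add a(1) series_in_M_cmult a(2) h series_in_M_sum)
  also have "(\<lambda>n. a n + ((-1) * char_twist a (principal_character p) n +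
      (\<Sum>j<p-1. c j * char_twist a (Y j) n))) = linear_twist a (of_int k / of_nat p)"
  proof
    fix n
    show "a n + ((-1) * char_twist a (principal_character p) n +
      (\<Sum>j<p-1. c j * char_twist a (Y j) n)) = linear_twist a (of_int k / of_nat p) n"
    proof (cases "coprime n p")
      case True
      then show ?thesis
        using Y(2)[OF True] unfolding linear_twist_eq char_twist_def \<phi>_def
        by (simp add: principal_character_def sum_distrib_left mult_ac)
    next
      case False
      then have "Y j n = 0" for j using Y(1)[of j] by (auto simp: dirichlet_character_def)
      moreover have "p dvd n" using False p by (metis coprime_commute prime_imp_coprime)
      then have "unit_root p (- (int n * k)) = 1"
        using p1 by (subst unit_root_eq_1_iff) auto
      ultimately show ?thesis
        unfolding linear_twist_eq char_twist_def using False by (simp add: principal_character_def)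
    qed
  qed
  finally show ?thesis .
qed

section \<open>Periodic entire functions\<close>

text \<open>Extends W = f/F to the left without knowing that zeros of F are cancelled by f: at a
  zero of F the value is taken from a translate by a multiple of the period at which F does not
  vanish. Only a point all of whose translates are zeros would obstruct this.\<close>

lemma quotient_periodic_extension:
  fixes F f W :: "complex \<Rightarrow> complex" and \<tau> :: complex and \<theta> :: real
  assumes hF: "F holomorphic_on {s. Re s < 1}" and hf: "f holomorphic_on {s. Re s < 1}"
    and hW: "W holomorphic_on {s. Re s > \<theta>}" and \<theta>: "\<theta> < 1" and \<tau>: "Re \<tau> = 0"
    and per: "\<And>s. Re s > \<theta> \<Longrightarrow> W (s + \<tau>) = W s"
    and eq: "\<And>s. \<theta> < Re s \<Longrightarrow> Re s < 1 \<Longrightarrow> f s = F s * W s"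
    and nz: "\<And>s. Re s \<le> \<theta> \<Longrightarrow> \<exists>k::int. F (s + of_int k * \<tau>) \<noteq> 0"
  obtains V where "V holomorphic_on UNIV" "\<And>s. Re s > \<theta> \<Longrightarrow> V s = W s"
    "\<And>s k. V (s + of_int k * \<tau>) = V s" "\<And>s. Re s \<le> \<theta> \<Longrightarrow> f s = F s * V s"
proof -
  let ?U = "{s :: complex. Re s < 1}"
  have opU: "open ?U" by (simp add: open_halfspace_Re_lt)
  have Re_shift [simp]: "Re (s + of_int k * \<tau>) = Re s" for s k using \<tau> by simp
  have perk: "W (s + of_int k * \<tau>) = W s" if "Re s > \<theta>" for s k
  proof (induction k rule: int_induct[where k = 0])
    case (step1 i)
    then show ?case using per[of "s + of_int i * \<tau>"] that \<tau> by (simp add: algebra_simps)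
  next
    case (step2 i)
    then show ?case using per[of "s + of_int (i - 1) * \<tau>"] that \<tau> by (simp add: algebra_simps)
  qed simp
  \<comment> \<open>For theta < Re s < 1 both sides equal F(s) F(s + k tau) W(s); the identity
    continues to the half-plane and makes the choice of k immaterial.\<close>
  have cross: "f s * F (s + of_int k * \<tau>) = f (s + of_int k * \<tau>) * F s" if s: "Re s < 1" for s k
  proof (rule analytic_continuation_open[of "{s. \<theta> < Re s} \<inter> ?U" ?U
        "\<lambda>s. f s * F (s + of_int k * \<tau>)" "\<lambda>s. f (s + of_int k * \<tau>) * F s"])
    show "open ({s. \<theta> < Re s} \<inter> ?U)"
      by (intro open_Int opU open_halfspace_Re_gt)
    have "of_real ((\<theta> + 1) / 2) \<in> {s. \<theta> < Re s} \<inter> ?U" using \<theta> by auto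
    then show "{s. \<theta> < Re s} \<inter> ?U \<noteq> {}" by blast
    show "connected ?U" by (intro convex_connected convex_halfspace_Re_lt)
    have sh: "(\<lambda>s. g (s + of_int k * \<tau>)) holomorphic_on ?U" if "g holomorphic_on ?U" for g
      by (rule holomorphic_on_compose_gen[OF _ that, unfolded o_def]) (auto intro!: holomorphic_intros simp: \<tau>)
    show "(\<lambda>s. f s * F (s + of_int k * \<tau>)) holomorphic_on ?U"
      "(\<lambda>s. f (s + of_int k * \<tau>) * F s) holomorphic_on ?U"
      by (intro holomorphic_intros hF hf sh)+
    fix z assume "z \<in> {s. \<theta> < Re s} \<inter> ?U"
    then show "f z * F (z + of_int k * \<tau>) = f (z + of_int k * \<tau>) * F z"
      using eq[of z] eq[of "z + of_int k * \<tau>"] perk[of z k] \<tau> by simp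
  qed (use s opU in auto)
  \<comment> \<open>\<open>SOME\<close> picks a translate where F is nonzero; by
    \<open>cross\<close> every such translate gives the same value, which also yields holomorphy and
    periodicity.\<close>
  define V where "V = (\<lambda>s. if Re s > \<theta> then W s else
      (let k = SOME k::int. F (s + of_int k * \<tau>) \<noteq> 0 in f (s + of_int k * \<tau>) / F (s + of_int k * \<tau>)))"
  have V: "V s = f (s + of_int k * \<tau>) / F (s + of_int k * \<tau>)"
    if "Re s < 1" "F (s + of_int k * \<tau>) \<noteq> 0" for s k
  proof (cases "Re s > \<theta>")
    case True
    then show ?thesis
      using eq[of "s + of_int k * \<tau>"] perk[of s k] that \<tau> by (simp add: V_def)
  next
    case False
    define j where "j = (SOME k::int. F (s + of_int k * \<tau>) \<noteq> 0)"
    have j: "F (s + of_int j * \<tau>) \<noteq> 0"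
      unfolding j_def by (rule someI_ex) (use nz False in auto)
    have "V s = f (s + of_int j * \<tau>) / F (s + of_int j * \<tau>)"
      using False by (simp add: V_def Let_def flip: j_def)
    moreover have e: "s + of_int j * \<tau> + of_int (k - j) * \<tau> = s + of_int k * \<tau>"
      by (simp add: algebra_simps)
    have "f (s + of_int j * \<tau>) * F (s + of_int k * \<tau>) = f (s + of_int k * \<tau>) * F (s + of_int j * \<tau>)"
      using cross[of "s + of_int j * \<tau>" "k - j"] that \<tau> unfolding e by simp
    ultimately show ?thesis
      by (simp only: frac_eq_eq[OF j that(2)])
  qed
  have loc: "\<exists>U. open U \<and> s \<in> U \<and> V holomorphic_on U" for s
  proof (cases "Re s > \<theta>")
    case True
    have "V holomorphic_on {s. Re s > \<theta>}"
      by (rule holomorphic_transform[OF hW]) (auto simp: V_def)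
    with True show ?thesis
      by (intro exI[of _ "{s. Re s > \<theta>}"]) (auto simp: open_halfspace_Re_gt)
  next
    case False
    then obtain k where k: "F (s + of_int k * \<tau>) \<noteq> 0" using nz[of s] by force
    have sh: "(\<lambda>s. g (s + of_int k * \<tau>)) holomorphic_on ?U" if "g holomorphic_on ?U" for g
      by (rule holomorphic_on_compose_gen[OF _ that, unfolded o_def]) (auto intro!: holomorphic_intros simp: \<tau>)
    let ?N = "?U \<inter> (\<lambda>s. F (s + of_int k * \<tau>)) -` (- {0})"
    have "open ?N"
      by (rule continuous_open_preimage[OF holomorphic_on_imp_continuous_on[OF sh[OF hF]] opU]) auto
    moreover have "(\<lambda>s. f (s + of_int k * \<tau>) / F (s + of_int k * \<tau>)) holomorphic_on ?N"
      by (intro holomorphic_on_divide holomorphic_on_subset[OF sh[OF hF]] holomorphic_on_subset[OF sh[OF hf]]) auto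
    then have "V holomorphic_on ?N"
      by (rule holomorphic_transform) (auto simp: V)
    ultimately show ?thesis
      using k False \<theta> by (intro exI[of _ ?N]) auto
  qed
  show thesis
  proof (rule that[of V])
    show "V holomorphic_on UNIV"
      unfolding holomorphic_on_def using loc
      by (metis UNIV_I at_within_open field_differentiable_at_within holomorphic_on_imp_differentiable_at)
    show "V s = W s" if "Re s > \<theta>" for s using that by (simp add: V_def)
    show "V (s + of_int k * \<tau>) = V s" for s k
    proof (cases "Re s > \<theta>")
      case True
      then show ?thesis using \<tau> by (simp add: V_def perk)
    next
      case False
      then obtain j where j: "F (s + of_int k * \<tau> + of_int j * \<tau>) \<noteq> 0"
        using nz[of "s + of_int k * \<tau>"] \<tau> by auto
      have e: "s + of_int k * \<tau> + of_int j * \<tau> = s + of_int (k + j) * \<tau>" by (simp add: algebra_simps)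
      have "V (s + of_int k * \<tau>) = f (s + of_int (k + j) * \<tau>) / F (s + of_int (k + j) * \<tau>)"
        unfolding e[symmetric] by (rule V[OF _ j]) (use False \<theta> \<tau> in auto)
      also have "\<dots> = V s"
        by (rule V[symmetric]) (use False \<theta> j[unfolded e] in auto)
      finally show ?thesis .
    qed
    show "f s = F s * V s" if s: "Re s \<le> \<theta>" for s
    proof -
      obtain k where k: "F (s + of_int k * \<tau>) \<noteq> 0" using nz s by auto
      have "V s = f (s + of_int k * \<tau>) / F (s + of_int k * \<tau>)"
        by (rule V[OF _ k]) (use s \<theta> in auto)
      moreover have "f s = f (s + of_int k * \<tau>) * F s / F (s + of_int k * \<tau>)"
        using cross[of s k] s \<theta> k by (simp add: eq_divide_eq)
      ultimately show ?thesis by simp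
    qed
  qed
qed

text \<open>Away from 0, g(z) is V at -log z / L, and periodicity makes the branch of the logarithm
  irrelevant. At z = 0, which the exponential omits, g is supplied by W: the singularity is filled
  in by hypothesis.\<close>

lemma periodic_entire_factors_through_exp:
  fixes V W :: "complex \<Rightarrow> complex" and L R :: real
  assumes V: "V holomorphic_on UNIV" and W: "W holomorphic_on ball 0 R" and "L > 0" "R > 0"
    and per: "\<And>s k. V (s + of_int k * (2 * of_real pi * \<i> / of_real L)) = V s"
    and eq: "\<And>s. norm (exp (- of_real L * s)) < R \<Longrightarrow> V s = W (exp (- of_real L * s))"
  obtains g where "g holomorphic_on UNIV" "\<And>s. V s = g (exp (- of_real L * s))" "\<And>z. norm z < R \<Longrightarrow> g z = W z"
proof -
  define g where "g = (\<lambda>z. if z = 0 then W 0 else V (- Ln z / of_real L))"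
  have key: "V (- w / of_real L) = g (exp w)" for w
  proof -
    have "exp (Ln (exp w)) = exp w" by simp
    then obtain n :: int where n: "Ln (exp w) = w + of_int (2 * n) * of_real pi * \<i>"
      unfolding exp_eq by auto
    have "- Ln (exp w) / of_real L + of_int n * (2 * of_real pi * \<i> / of_real L) = - w / of_real L"
      unfolding n using \<open>L > 0\<close> by (simp add: field_simps)
    then have "V (- w / of_real L) = V (- Ln (exp w) / of_real L)"
      using per by metis
    then show ?thesis by (simp add: g_def)
  qed
  have Vg: "V s = g (exp (- of_real L * s))" for s
    using key[of "- of_real L * s"] \<open>L > 0\<close> by simp
  have gW: "g z = W z" if z: "norm z < R" for z
  proof (cases "z = 0")
    case False
    then have e: "exp (- of_real L * (- Ln z / of_real L)) = z" using \<open>L > 0\<close> by simp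
    have "V (- Ln z / of_real L) = W z" using eq[of "- Ln z / of_real L"] z unfolding e by blast
    with Vg[of "- Ln z / of_real L"] show ?thesis unfolding e by simp
  qed (simp add: g_def)
  have loc: "\<exists>U. open U \<and> z \<in> U \<and> g holomorphic_on U" for z
  proof -
    \<comment> \<open>A nonzero z avoids the negative or the positive real axis, so one of two
      branches of the logarithm is holomorphic near it.\<close>
    consider "z = 0" | "z \<notin> \<real>\<^sub>\<le>\<^sub>0" | "- z \<notin> \<real>\<^sub>\<le>\<^sub>0"
    proof -
      have "z = 0" if "z \<in> \<real>\<^sub>\<le>\<^sub>0" "- z \<in> \<real>\<^sub>\<le>\<^sub>0"
        using that by (auto simp: complex_nonpos_Reals_iff complex_eq_iff)
      then show ?thesis using that by blast
    qed
    then show ?thesis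
    proof cases
      case 1
      have "g holomorphic_on ball 0 R"
        by (rule holomorphic_transform[OF W]) (auto simp: gW)
      with 1 \<open>R > 0\<close> show ?thesis by (intro exI[of _ "ball 0 R"]) auto
    next
      case 2
      have "(\<lambda>z. V (- Ln z / of_real L)) holomorphic_on - \<real>\<^sub>\<le>\<^sub>0"
        by (rule holomorphic_on_compose_gen[OF _ V, unfolded o_def])
          (use \<open>L > 0\<close> in \<open>auto intro!: holomorphic_intros\<close>)
      then have "g holomorphic_on - \<real>\<^sub>\<le>\<^sub>0"
        by (rule holomorphic_transform) (auto simp: g_def)
      with 2 show ?thesis by (intro exI[of _ "- \<real>\<^sub>\<le>\<^sub>0"]) (auto intro!: open_Compl)
    next
      case 3
      \<comment> \<open>The branch log(-z) + i pi is cut along the positive axis and handles z on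
        the cut of \<open>Ln\<close>.\<close>
      let ?N = "uminus -` (- \<real>\<^sub>\<le>\<^sub>0) :: complex set"
      have "(\<lambda>z. V (- (Ln (- z) + \<i> * of_real pi) / of_real L)) holomorphic_on ?N"
        by (rule holomorphic_on_compose_gen[OF _ V, unfolded o_def])
          (use \<open>L > 0\<close> in \<open>auto intro!: holomorphic_intros\<close>)
      then have "g holomorphic_on ?N"
      proof (rule holomorphic_transform)
        fix z :: complex assume "z \<in> ?N"
        then have "z \<noteq> 0" by auto
        then have "exp (Ln (- z) + \<i> * of_real pi) = z" by (simp add: exp_add)
        then show "V (- (Ln (- z) + \<i> * of_real pi) / of_real L) = g z"
          using key[of "Ln (- z) + \<i> * of_real pi"] by simp
      qed
      moreover have "open ?N" by (intro open_vimage open_Compl continuous_intros) auto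
      ultimately show ?thesis using 3 by (intro exI[of _ ?N]) auto
    qed
  qed
  show thesis
  proof (rule that[OF _ Vg gW])
    show "g holomorphic_on UNIV"
      unfolding holomorphic_on_def using loc
      by (metis UNIV_I at_within_open field_differentiable_at_within holomorphic_on_imp_differentiable_at)
  qed
qed

section \<open>From growth to a polynomial and its factorisation\<close>

text \<open>Cauchy's estimate on the circle of radius r^x gives k! u^x x^C with u = b / r^k < 1,
  which tends to 0. The radius is written r^x because |p^(-s)| = p^x on Re s = -x.\<close>

lemma entire_coeff_zero_by_growth:
  fixes g :: "complex \<Rightarrow> complex" and b r C :: real
  assumes g: "g holomorphic_on UNIV" and r: "r > 1" and b: "b > 0" "b < r ^ k"
    and bound: "\<forall>\<^sub>F x in at_top. \<forall>z. norm z = r powr x \<longrightarrow> norm (g z) \<le> b powr x * x powr C"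
  shows "(deriv ^^ k) g 0 = 0"
proof -
  define u where "u = b / r ^ k"
  have u: "0 < u" "u < 1" using b r by (auto simp: u_def)
  have "((\<lambda>x. u powr x * x powr C) \<longlongrightarrow> 0) at_top"
    using u by real_asymp
  then have "((\<lambda>x. fact k * (u powr x * x powr C)) \<longlongrightarrow> 0) at_top"
    by (rule tendsto_mult_right_zero)
  moreover have "\<forall>\<^sub>F x in at_top. norm ((deriv ^^ k) g 0) \<le> fact k * (u powr x * x powr C)"
    using bound
  proof eventually_elim
    case (elim x)
    have "norm ((deriv ^^ k) g 0) \<le> fact k * (b powr x * x powr C) / (r powr x) ^ k"
    proof (rule Cauchy_inequality)
      show "g holomorphic_on ball 0 (r powr x)" using g by (rule holomorphic_on_subset) auto
      show "continuous_on (cball 0 (r powr x)) g"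
        using g by (intro holomorphic_on_imp_continuous_on holomorphic_on_subset[OF g]) auto
      show "norm (g w) \<le> b powr x * x powr C" if "norm (0 - w) = r powr x" for w
        using elim that by simp
    qed (use r in auto)
    also have "(r powr x) ^ k = (r ^ k) powr x"
      using r by (simp add: powr_powr mult.commute flip: powr_realpow)
    also have "fact k * (b powr x * x powr C) / (r ^ k) powr x = fact k * (u powr x * x powr C)"
      using b r by (simp add: u_def powr_divide)
    finally show ?case .
  qed
  ultimately have "norm ((deriv ^^ k) g 0) \<le> 0"
    using tendsto_lowerbound trivial_limit_at_top_linorder by blast
  then show ?thesis by simp
qed

text \<open>The alpha_j are the reciprocals of the roots; the constant term 1 excludes the root 0
  and leaves no leading constant, so splitting off one root at a time suffices.\<close>

lemma poly_factor_one_minus: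
  fixes R :: "complex poly"
  assumes "poly R 0 = 1"
  shows "\<exists>\<alpha>. \<forall>z. poly R z = (\<Prod>j=1..degree R. 1 - \<alpha> j * z)"
  using assms
proof (induction "degree R" arbitrary: R)
  case 0
  then have "\<exists>c. R = [:c:]" by (metis degree_eq_zeroE)
  with 0 show ?case by auto
next
  case (Suc n)
  then obtain w where w: "poly R w = 0"
    using alg_closed_imp_poly_has_root[of R] by auto
  then have w0: "w \<noteq> 0" using Suc.prems by auto
  from w obtain R1 where R1: "R = [:- w, 1:] * R1" by (auto simp: poly_eq_0_iff_dvd)
  define R2 where "R2 = Polynomial.smult (- w) R1"
  have "[:- w, 1:] = Polynomial.smult (- w) [:1, - 1 / w:]" using w0 by simp
  then have R2: "R = [:1, - 1 / w:] * R2"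
    by (simp only: R1 R2_def mult_smult_left mult_smult_right)
  have "R2 \<noteq> 0" using R2 Suc.prems by auto
  then have dR: "degree R = Suc (degree R2)"
    unfolding R2 using w0 by (subst degree_mult_eq) auto
  have "poly R2 0 = 1" using Suc.prems by (simp add: R2)
  then obtain \<alpha> where \<alpha>: "\<And>z. poly R2 z = (\<Prod>j=1..degree R2. 1 - \<alpha> j * z)"
    using Suc.hyps dR by (metis old.nat.inject)
  show ?case
  proof (intro exI[of _ "\<alpha>(Suc (degree R2) := 1 / w)"] allI)
    fix z
    have "(\<Prod>j=1..degree R2. 1 - (\<alpha>(Suc (degree R2) := 1 / w)) j * z) = (\<Prod>j=1..degree R2. 1 - \<alpha> j * z)"
      by (rule prod.cong) auto
    then have "(\<Prod>j=1..Suc (degree R2). 1 - (\<alpha>(Suc (degree R2) := 1 / w)) j * z) = (1 - z / w) * poly R2 z"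
      by (simp add: \<alpha>)
    moreover have "poly R z = (1 - z / w) * poly R2 z"
      unfolding R2 poly_mult by simp
    ultimately show "poly R z = (\<Prod>j=1..degree R. 1 - (\<alpha>(Suc (degree R2) := 1 / w)) j * z)"
      by (simp only: dR)
  qed
qed

section \<open>The Euler factor as a quotient\<close>

lemma selberg_nonzero: "selberg a F \<Longrightarrow> Re s > 1 \<Longrightarrow> F s \<noteq> 0"
  unfolding selberg_def by force

text \<open>\<open>zero_count\<close> is a \<open>card\<close>, which is 0 on infinite sets;
  finiteness is what lets exhibited zeros bound it from below.\<close>

lemma finite_zeros_in_rectangle:
  assumes S: "selberg a F"
  shows "finite {\<rho>. F \<rho> = 0 \<and> \<not> is_pole F \<rho> \<and> Re \<rho> > \<sigma> \<and> \<bar>Im \<rho>\<bar> \<le> T}"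
proof -
  obtain m g where g: "g holomorphic_on UNIV" "\<And>s. s \<noteq> 1 \<Longrightarrow> g s = (s - 1) ^ m * F s"
    using S by (auto simp: selberg_def extended_selberg_def entire_finite_order_def)
  have g2: "g 2 \<noteq> 0" using g(2)[of 2] selberg_nonzero[OF S, of 2] by simp
  let ?K = "cbox (Complex \<sigma> (- T)) (Complex 1 T)"
  have "finite {z \<in> ?K. g z = 0}"
  proof (cases "g constant_on UNIV")
    case True
    then have "g z \<noteq> 0" for z using g2 by (auto simp: constant_on_def)
    then show ?thesis by simp
  next
    case False
    then show ?thesis
      by (intro holomorphic_compact_finite_zeros[OF g(1)]) auto
  qed
  \<comment> \<open>At the point 1 the value of F is not tied to g, so this point is added by
    hand.\<close>
  then have "finite (insert 1 {z \<in> ?K. g z = 0})" by simp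
  moreover have "{\<rho>. F \<rho> = 0 \<and> \<not> is_pole F \<rho> \<and> Re \<rho> > \<sigma> \<and> \<bar>Im \<rho>\<bar> \<le> T} \<subseteq> insert 1 {z \<in> ?K. g z = 0}"
  proof
    fix \<rho> assume "\<rho> \<in> {\<rho>. F \<rho> = 0 \<and> \<not> is_pole F \<rho> \<and> Re \<rho> > \<sigma> \<and> \<bar>Im \<rho>\<bar> \<le> T}"
    moreover from this have "Re \<rho> \<le> 1" using selberg_nonzero[OF S, of \<rho>] by force
    ultimately show "\<rho> \<in> insert 1 {z \<in> ?K. g z = 0}"
      using g(2)[of \<rho>] by (auto simp: in_cbox_complex_iff)
  qed
  ultimately show ?thesis by (rule finite_subset[rotated])
qed

text \<open>Otherwise F vanishes on an arithmetic progression of step y on the line Re s = Re s0.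
  Its members that are high enough to be reflected give zeros of density 1/y on the line Re s = 1 -
  Re s0 > 1/2.\<close>

lemma translate_not_zero:
  assumes S: "selberg a F"
    and zeros: "\<forall>\<sigma> > 1 / 2. (\<lambda>T. real (zero_count F \<sigma> T)) \<in> o[at_top](\<lambda>T. T)"
    and y: "y > 0" and s0: "Re s0 < 1 / 2"
  shows "\<exists>k::int. F (s0 + of_int k * (\<i> * of_real y)) \<noteq> 0"
proof (rule ccontr)
  assume "\<not> ?thesis"
  then have zero: "F (s0 + of_int k * (\<i> * of_real y)) = 0" for k :: int by blast
  have es: "extended_selberg a F" using S by (simp add: selberg_def)
  have hol: "F holomorphic_on - {1}" by (rule extended_selberg_holomorphic[OF es])
  have "\<forall>\<^sub>F Y in at_top. \<forall>s. Im s = Y \<longrightarrow> Re s < 1 \<longrightarrow> F s = 0 \<longrightarrow> F (cnj (1 - s)) = 0"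
    by (rule functional_equation_zero_reflect[OF fe_of_functional_equation[OF es] hol])
  then obtain Y where Y: "\<And>s. Im s \<ge> Y \<Longrightarrow> Re s < 1 \<Longrightarrow> F s = 0 \<Longrightarrow> F (cnj (1 - s)) = 0"
    by (auto simp: eventually_at_top_linorder)
  define \<rho> where "\<rho> = (\<lambda>k::nat. cnj (1 - (s0 + of_int (int k) * (\<i> * of_real y))))"
  have \<rho>: "Re (\<rho> k) = 1 - Re s0" "Im (\<rho> k) = Im s0 + real k * y" for k
    by (simp_all add: \<rho>_def)
  have "filterlim (\<lambda>k::nat. Im s0 + real k * y) at_top sequentially" using y by real_asymp
  then have "\<forall>\<^sub>F k in sequentially. Im s0 + real k * y \<ge> max Y 1"
    unfolding filterlim_at_top by blast
  then obtain k0 where k0: "\<And>k. k \<ge> k0 \<Longrightarrow> Im s0 + real k * y \<ge> max Y 1"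
    by (auto simp del: max.bounded_iff simp: eventually_sequentially)
  have F\<rho>: "F (\<rho> k) = 0 \<and> \<not> is_pole F (\<rho> k)" if k: "k \<ge> k0" for k
  proof
    show "F (\<rho> k) = 0"
      unfolding \<rho>_def by (rule Y) (use k0[OF k] s0 zero[of "int k"] in auto)
    have "Im (\<rho> k) \<ge> 1" using k0[OF k] by (simp add: \<rho>)
    then have "\<rho> k \<noteq> 1" by auto
    then show "\<not> is_pole F (\<rho> k)"
      by (intro not_is_pole_holomorphic[OF _ _ hol]) auto
  qed
  \<comment> \<open>The midpoint of 1/2 and 1 - Re s0.\<close>
  define \<sigma> where "\<sigma> = 3 / 4 - Re s0 / 2"
  have \<sigma>: "\<sigma> > 1 / 2" "\<sigma> < 1 - Re s0" using s0 by (auto simp: \<sigma>_def)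
  define T where "T = (\<lambda>n::nat. \<bar>Im s0\<bar> + real n * y)"
  have card: "real (Suc n - k0) \<le> real (zero_count F \<sigma> (T n))" for n
  proof -
    have "inj_on \<rho> {k0..n}" by (rule inj_onI) (use y \<rho>(2) in \<open>metis add_left_cancel mult_cancel_right of_nat_eq_iff less_irrefl\<close>)
    then have "card (\<rho> ` {k0..n}) = Suc n - k0" by (simp add: card_image)
    moreover have "card (\<rho> ` {k0..n}) \<le> zero_count F \<sigma> (T n)"
      unfolding zero_count_def
    proof (rule card_mono[OF finite_zeros_in_rectangle[OF S]], safe)
      fix k assume k: "k \<in> {k0..n}"
      then show "F (\<rho> k) = 0" "is_pole F (\<rho> k) \<Longrightarrow> False" using F\<rho>[of k] by auto
      show "\<sigma> < Re (\<rho> k)" using \<sigma> by (simp add: \<rho>)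
      have "\<bar>Im (\<rho> k)\<bar> \<le> \<bar>Im s0\<bar> + \<bar>real k * y\<bar>" unfolding \<rho> by (rule abs_triangle_ineq)
      also have "\<dots> \<le> T n" using k y by (auto simp: T_def abs_mult intro!: mult_right_mono)
      finally show "\<bar>Im (\<rho> k)\<bar> \<le> T n" .
    qed
    ultimately show ?thesis by simp
  qed
  \<comment> \<open>Half of the density 1/y: at T(n) this allows about n/2 zeros, while n + 1 - k0
    have been exhibited.\<close>
  have "\<forall>\<^sub>F T in at_top. norm (real (zero_count F \<sigma> T)) \<le> 1 / (2 * y) * norm T"
    by (rule landau_o.smallD) (use zeros \<sigma> y in auto)
  moreover have "filterlim T at_top sequentially" unfolding T_def using y by real_asymp
  ultimately have "\<forall>\<^sub>F n in sequentially. norm (real (zero_count F \<sigma> (T n))) \<le> 1 / (2 * y) * norm (T n)"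
    by (rule eventually_compose_filterlim)
  moreover have "\<forall>\<^sub>F n in sequentially. real n > 2 * real k0 + \<bar>Im s0\<bar> / y"
    by real_asymp
  moreover have "\<forall>\<^sub>F n in sequentially. n \<ge> k0" by (rule eventually_ge_at_top)
  ultimately have "\<forall>\<^sub>F n in sequentially. False"
  proof eventually_elim
    case (elim n)
    have "T n \<ge> 0" using y by (simp add: T_def)
    have "real n + 1 - real k0 \<le> 1 / (2 * y) * T n"
      using card[of n] elim(1,3) \<open>T n \<ge> 0\<close> by (simp add: of_nat_diff)
    also have "\<dots> = (\<bar>Im s0\<bar> / y) / 2 + real n / 2"
      using y by (simp add: T_def field_simps)
    finally show False using elim(2) by (simp add: field_simps)
  qed
  then show False by simp
qed

lemma of_nat_powr_minus_eq_exp: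
  "p > 0 \<Longrightarrow> of_nat p powr (- s) = exp (- of_real (ln (real p)) * s :: complex)"
  by (simp add: powr_def Ln_of_nat mult.commute)

text \<open>The local factor is recovered as the quotient of \<open>f\<close> and \<open>F\<close>; periodicity along vertical lines
  together with the scarcity of zeros off the critical line excludes poles of the quotient.\<close>

lemma quotient_extends_to_entire:
  fixes W :: "complex \<Rightarrow> complex"
  assumes S: "selberg a F"
    and zeros: "\<forall>\<sigma> > 1 / 2. (\<lambda>T. real (zero_count F \<sigma> T)) \<in> o[at_top](\<lambda>T. T)"
    and p: "p > 1" and \<theta>: "0 \<le> \<theta>" "\<theta> < 1 / 2"
    and W: "W holomorphic_on ball 0 (real p powr (- \<theta>))"
    and f: "f meromorphic_on UNIV" "f holomorphic_on {s. Re s < 1}"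
    and eq: "\<And>s. Re s > 1 \<Longrightarrow> f s = F s * W (of_nat p powr (- s))"
  obtains g where "g holomorphic_on UNIV" "\<And>z. norm z < real p powr (- \<theta>) \<Longrightarrow> g z = W z"
    "\<And>s. Re s \<le> 0 \<Longrightarrow> f s = F s * g (of_nat p powr (- s))"
proof -
  define L where "L = ln (real p)"
  have L: "L > 0" using p by (simp add: L_def)
  have pexp: "of_nat p powr (- s) = exp (- of_real L * s :: complex)" for s
    using p by (simp add: of_nat_powr_minus_eq_exp L_def)
  have R: "real p powr (- \<theta>) = exp (- (L * \<theta>))" using p by (simp add: powr_def L_def mult.commute)
  have disc: "norm (exp (- of_real L * s)) < real p powr (- \<theta>) \<longleftrightarrow> Re s > \<theta>" for s
    unfolding R using L by simp
  define W0 where "W0 = (\<lambda>s. W (exp (- of_real L * s)))"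
  have holW0: "W0 holomorphic_on {s. Re s > \<theta>}"
    unfolding W0_def
    by (rule holomorphic_on_compose_gen[OF _ W, unfolded o_def]) (use disc in \<open>auto intro!: holomorphic_intros\<close>)
  have es: "extended_selberg a F" using S by (simp add: selberg_def)
  have holF: "F holomorphic_on - {1}" by (rule extended_selberg_holomorphic[OF es])
  have holF1: "F holomorphic_on {s. Re s < 1}" by (rule holomorphic_on_subset[OF holF]) auto
  have eq0: "f s = F s * W0 s" if s: "\<theta> < Re s" "Re s < 1" for s
  proof -
    \<comment> \<open>The equation is given for Re s > 1 and wanted for theta < Re s < 1, with
      possible poles of f and F in between. As a meromorphic function on a connected set, the
      difference vanishes off a sparse set or is nonzero off one; near 2 it vanishes, and continuity
      then removes the exceptional set left of 1.\<close>
    let ?D = "\<lambda>s. f s - F s * W0 s" and ?\<Omega> = "{s. \<theta> < Re s}"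
    have op: "open ?\<Omega>" by (simp add: open_halfspace_Re_gt)
    have "W0 meromorphic_on ?\<Omega>"
      using holW0 op by (intro analytic_on_imp_meromorphic_on) (simp add: analytic_on_open)
    moreover have "F meromorphic_on ?\<Omega>"
      using es by (auto simp: extended_selberg_def nicely_meromorphic_on_def intro: meromorphic_on_subset)
    ultimately have "?D meromorphic_on ?\<Omega>"
      using f(1) by (intro meromorphic_on_diff meromorphic_on_mult) (auto intro: meromorphic_on_subset)
    then have "eventually (\<lambda>z. ?D z = 0) (cosparse ?\<Omega>) \<or> eventually (\<lambda>z. ?D z \<noteq> 0) (cosparse ?\<Omega>)"
      by (rule meromorphic_imp_constant_or_avoid) (auto intro: op convex_connected convex_halfspace_Re_gt)
    moreover have "\<not> eventually (\<lambda>z. ?D z \<noteq> 0) (cosparse ?\<Omega>)"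
    proof
      assume "eventually (\<lambda>z. ?D z \<noteq> 0) (cosparse ?\<Omega>)"
      then have "eventually (\<lambda>z. ?D z \<noteq> 0) (at 2)"
        using \<theta> op by (simp add: eventually_cosparse_open_eq)
      moreover have "eventually (\<lambda>z. z \<in> {s. Re s > 1} - {2}) (at 2)"
        by (rule eventually_at_in_open) (auto simp: open_halfspace_Re_gt)
      ultimately have "eventually (\<lambda>z::complex. False) (at 2)"
        by eventually_elim (use eq pexp in \<open>auto simp: W0_def\<close>)
      then show False by simp
    qed
    ultimately have "eventually (\<lambda>z. ?D z = 0) (cosparse ?\<Omega>)" by blast
    then have ev: "eventually (\<lambda>z. ?D z = 0) (at s)"
      using s op by (simp add: eventually_cosparse_open_eq)
    have "?D holomorphic_on ({s. \<theta> < Re s} \<inter> {s. Re s < 1})"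
      by (intro holomorphic_intros holomorphic_on_subset[OF f(2)] holomorphic_on_subset[OF holF1]
          holomorphic_on_subset[OF holW0]) auto
    then have "isCont ?D s"
      using s by (intro continuous_on_interior[OF holomorphic_on_imp_continuous_on])
        (auto simp: interior_open open_Int open_halfspace_Re_gt open_halfspace_Re_lt)
    moreover have "(?D \<longlongrightarrow> 0) (at s)"
      using ev by (simp add: tendsto_eventually)
    ultimately have "?D s = 0"
      unfolding isCont_def using tendsto_unique[OF at_neq_bot] by blast
    then show ?thesis by simp
  qed
  \<comment> \<open>The period of p^(-s); translating by it stays on a vertical line, as
    \<open>translate_not_zero\<close> requires.\<close>
  let ?\<tau> = "2 * of_real pi * \<i> / of_real L :: complex"
  have \<tau>: "?\<tau> = \<i> * of_real (2 * pi / L)" by simp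
  have per: "exp (- of_real L * (s + ?\<tau>)) = exp (- of_real L * s)" for s
  proof -
    have "- of_real L * (s + ?\<tau>) = - of_real L * s - 2 * of_real pi * \<i>"
      using L by (simp add: field_simps)
    then show ?thesis by (simp add: exp_diff)
  qed
  obtain V where V: "V holomorphic_on UNIV" "\<And>s. Re s > \<theta> \<Longrightarrow> V s = W0 s"
    "\<And>s k. V (s + of_int k * ?\<tau>) = V s" "\<And>s. Re s \<le> \<theta> \<Longrightarrow> f s = F s * V s"
  proof (rule quotient_periodic_extension[OF holF1 f(2) holW0, of ?\<tau>])
    show "W0 (s + ?\<tau>) = W0 s" if "Re s > \<theta>" for s using per[of s] by (simp only: W0_def)
    show "\<exists>k::int. F (s + of_int k * ?\<tau>) \<noteq> 0" if "Re s \<le> \<theta>" for s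
      unfolding \<tau> by (rule translate_not_zero[OF S zeros]) (use L that \<theta> in auto)
  qed (use \<theta> eq0 in auto)
  obtain g where g: "g holomorphic_on UNIV" "\<And>s. V s = g (exp (- of_real L * s))"
    "\<And>z. norm z < real p powr (- \<theta>) \<Longrightarrow> g z = W z"
  proof (rule periodic_entire_factors_through_exp[OF V(1) W L _ V(3)])
    show "V s = W (exp (- of_real L * s))" if "norm (exp (- of_real L * s)) < real p powr (- \<theta>)" for s
      using V(2)[of s] that unfolding disc by (simp add: W0_def)
  qed (use p in auto)
  show thesis
  proof (rule that[OF g(1,3)])
    show "f s = F s * g (of_nat p powr (- s))" if "Re s \<le> 0" for s
      unfolding pexp using V(4)[of s] that \<theta> by (simp only: g(2))
  qed
qed

text \<open>As t runs through a window of length 2 pi / log p, p^(-s) with s = -x + it covers the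
  whole circle of radius p^x. Placing the window where F is bounded below controls g on all of the
  circle, and the factors x^(d x) cancel in f/F, leaving (h/q)^x.\<close>

lemma quotient_growth:
  assumes S: "selberg a F" and p: "p > 1" and h: "h > 0"
    and f: "f \<in> class_M (selberg_degree F) h"
    and eq: "\<And>s. Re s \<le> 0 \<Longrightarrow> f s = F s * g (of_nat p powr (- s))"
  shows "\<exists>C. \<forall>\<^sub>F x in at_top. \<forall>z. norm z = real p powr x \<longrightarrow>
    norm (g z) \<le> (h / selberg_conductor F) powr x * x powr C"
proof -
  define L where "L = ln (real p)"
  have L: "L > 0" using p by (simp add: L_def)
  define q where "q = selberg_conductor F"
  have q: "q > 0"
    unfolding q_def using S by (intro selberg_conductor_pos fe_of_functional_equation) (auto simp: selberg_def)
  let ?d = "selberg_degree F"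
  obtain A where A: "\<And>B. \<exists>C. \<forall>\<^sub>F x in at_top. \<forall>t\<in>{A..B}.
    norm (F (Complex (- x) t)) \<ge> growth_model ?d q x * x powr C"
    using eventually_happens'[OF trivial_limit_at_top_linorder selberg_growth_lower[OF S]]
    unfolding q_def by blast
  define B where "B = A + 2 * pi / L"
  have AB: "A < B" using L by (simp add: B_def)
  obtain C1 where C1: "\<forall>\<^sub>F x in at_top. \<forall>t\<in>{A..B}.
    norm (F (Complex (- x) t)) \<ge> growth_model ?d q x * x powr C1"
    using A by blast
  obtain C2 where C2: "\<forall>\<^sub>F x in at_top. \<forall>t\<in>{A..B}. norm (f (Complex (- x) t)) \<le> growth_model ?d h x * x powr C2"
    using f AB unfolding class_M_iff by meson
  show ?thesis
  proof (intro exI[of _ "C2 - C1"])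
    show "\<forall>\<^sub>F x in at_top. \<forall>z. norm z = real p powr x \<longrightarrow>
      norm (g z) \<le> (h / selberg_conductor F) powr x * x powr (C2 - C1)"
      using C1 C2 eventually_gt_at_top[of 0]
    proof eventually_elim
      case (elim x)
      show ?case
      proof (intro allI impI)
        fix z :: complex assume z: "norm z = real p powr x"
        then have z0: "z \<noteq> 0" using p by auto
        define t0 where "t0 = - Im (Ln z) / L"
        \<comment> \<open>The number of periods that carries the height given by the principal
          logarithm into [A, B].\<close>
        define n where "n = \<lceil>(A - t0) / (2 * pi / L)\<rceil>"
        define t where "t = t0 + of_int n * (2 * pi / L)"
        have step: "2 * pi / L > 0" using L by simp
        have "(A - t0) / (2 * pi / L) \<le> of_int n" "of_int n - 1 \<le> (A - t0) / (2 * pi / L)"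
          unfolding n_def by linarith+
        then have "A - t0 \<le> of_int n * (2 * pi / L)" "(of_int n - 1) * (2 * pi / L) \<le> A - t0"
          by (simp_all only: pos_divide_le_eq[OF step] pos_le_divide_eq[OF step])
        moreover have "A - t0 \<le> N * c \<Longrightarrow> (N - 1) * c \<le> A - t0 \<Longrightarrow> t0 + N * c \<in> {A..A + c}" for N c :: real
          by (simp add: left_diff_distrib)
        ultimately have t: "t \<in> {A..B}" unfolding t_def B_def by blast
        have Lnz: "- of_real L * Complex (- x) t = Ln z + of_int (- n) * (2 * of_real pi * \<i>)"
          using z0 z p L unfolding t_def t0_def
          by (simp add: complex_eq_iff ln_powr field_simps flip: L_def)
        have "exp (- of_real L * Complex (- x) t) = z * exp (of_int (- n) * (2 * of_real pi * \<i>))"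
          by (simp only: Lnz exp_add exp_Ln[OF z0])
        also have "exp (of_int (- n) * (2 * of_real pi * \<i>)) = (1 :: complex)"
          unfolding exp_eq_1 by (auto intro!: exI[of _ "- n"])
        finally have "of_nat p powr (- Complex (- x) t) = z"
          using p by (simp add: of_nat_powr_minus_eq_exp L_def)
        then have fF: "norm (f (Complex (- x) t)) = norm (F (Complex (- x) t)) * norm (g z)"
          using eq[of "Complex (- x) t"] elim(3) by (simp add: norm_mult)
        have G: "growth_model ?d q x > 0" using elim(3) q by (simp add: ln_growth_model)
        have "growth_model ?d q x * x powr C1 * norm (g z) \<le> norm (F (Complex (- x) t)) * norm (g z)"
          using elim(1) t by (intro mult_right_mono) auto
        also have "\<dots> \<le> growth_model ?d h x * x powr C2"
          using elim(2) t by (simp flip: fF)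
        also have "growth_model ?d h x = growth_model ?d q x * (h / q) powr x"
          using growth_model_mult[of q "h / q" ?d x] q h by simp
        finally have "growth_model ?d q x * (x powr C1 * norm (g z)) \<le> growth_model ?d q x * ((h / q) powr x * x powr C2)"
          by (simp add: mult_ac)
        then have "x powr C1 * norm (g z) \<le> (h / q) powr x * x powr C2"
          using G by simp
        then have "norm (g z) \<le> (h / q) powr x * x powr C2 / x powr C1"
          using elim(3) by (simp add: field_simps)
        then show "norm (g z) \<le> (h / selberg_conductor F) powr x * x powr (C2 - C1)"
          using elim(3) by (simp add: powr_diff q_def)
      qed
    qed
  qed
qed

section \<open>The Euler factor condition: its derivation and its use\<close>

lemma local_factor_product:
  assumes S: "selberg a F"
    and zeros: "\<forall>\<sigma> > 1 / 2. (\<lambda>T. real (zero_count F \<sigma> T)) \<in> o[at_top](\<lambda>T. T)"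
    and p: "prime p" and h: "h > 0"
    and M: "series_in_M (selberg_degree F) h (\<lambda>n. a n * (of_nat p - 1 - of_nat p * principal_character p n))"
  shows "\<exists>(N::nat) (\<alpha> :: nat \<Rightarrow> complex).
            int N \<le> \<lfloor>ln (h / selberg_conductor F) / ln (real p)\<rfloor> \<and>
            (\<forall>j\<in>{1..N}. norm (\<alpha> j) \<le> 1) \<and>
            (\<forall>s. Re s > 1 \<longrightarrow>
               local_factor a p s = (\<Prod>j=1..N. inverse (1 - \<alpha> j / of_nat p powr s)))"
proof -
  have p1: "p > 1" using p by (rule prime_gt_1_nat)
  define q where "q = selberg_conductor F"
  have q: "q > 0"
    unfolding q_def using S by (intro selberg_conductor_pos fe_of_functional_equation) (auto simp: selberg_def)
  let ?A = "Abs_fps (\<lambda>k. a (p ^ k))"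
  obtain \<theta> P where \<theta>: "0 \<le> \<theta>" "\<theta> < 1 / 2" and P: "P holomorphic_on ball 0 (real p powr (- \<theta>))" "P 0 = 1"
    "\<And>z. norm z < real p powr (- \<theta>) \<Longrightarrow> eval_fps ?A z * P z = 1"
    and rad: "1 \<le> fps_conv_radius ?A"
    using selberg_local_factor[OF S p] by metis
  let ?R = "real p powr (- \<theta>)"
  have R0: "?R > 0" using p1 by simp
  have R1: "?R \<le> 1" using p1 \<theta> powr_mono[of "- \<theta>" 0 "real p"] by simp
  define W where "W = (\<lambda>z. of_nat p - 1 - of_nat p * P z)"
  have exp: "abs_dirichlet_expansion a F" using S by (simp add: selberg_def extended_selberg_def)
  have small: "norm (of_nat p powr (- s) :: complex) < ?R" if "Re s > 1" for s
    using p1 that \<theta> by (simp add: norm_of_nat_powr)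
  obtain f where f: "f \<in> class_M (selberg_degree F) h"
    "\<And>s. Re s > 1 \<Longrightarrow> dirichlet_term (\<lambda>n. a n * (of_nat p - 1 - of_nat p * principal_character p n)) s sums f s"
    using M unfolding series_in_M_def by blast
  have fW: "f s = F s * W (of_nat p powr (- s))" if s: "Re s > 1" for s
  proof -
    obtain G where G: "((\<lambda>n. a n * principal_character p n * of_nat n powr (- s)) has_sum G) {1..}"
      and FG: "F s = local_factor a p s * G"
      by (rule euler_factor_split[OF exp p selberg_multiplicative(2)[OF S] s])
    have "((\<lambda>n. (of_nat p - 1) * (a n * of_nat n powr (- s)) +
        - of_nat p * (a n * principal_character p n * of_nat n powr (- s)))
        has_sum ((of_nat p - 1) * F s + - of_nat p * G)) {1..}"
      by (intro has_sum_add has_sum_cmult_right G abs_dirichlet_expansionD[OF exp s])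
    also have "(\<lambda>n. (of_nat p - 1) * (a n * of_nat n powr (- s)) +
        - of_nat p * (a n * principal_character p n * of_nat n powr (- s))) =
        (\<lambda>n. a n * (of_nat p - 1 - of_nat p * principal_character p n) * of_nat n powr (- s))"
      by (auto simp: algebra_simps)
    finally have "f s = (of_nat p - 1) * F s + - of_nat p * G"
      by (rule sums_unique2[OF f(2)[OF s] sums_if_has_sum])
    moreover have "F s * P (of_nat p powr (- s)) = G"
    proof -
      have "F s * P (of_nat p powr (- s)) =
          (eval_fps ?A (of_nat p powr (- s)) * P (of_nat p powr (- s))) * G"
        using p1 by (simp add: FG local_factor_eq_eval_fps)
      then show ?thesis using P(3)[OF small[OF s]] by simp
    qed
    ultimately show ?thesis by (auto simp: W_def algebra_simps)
  qed
  have holW: "W holomorphic_on ball 0 ?R"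
    unfolding W_def by (intro holomorphic_intros P(1))
  obtain g where g: "g holomorphic_on UNIV" "\<And>z. norm z < ?R \<Longrightarrow> g z = W z"
    "\<And>s. Re s \<le> 0 \<Longrightarrow> f s = F s * g (of_nat p powr (- s))"
    using quotient_extends_to_entire[OF S zeros p1 \<theta> holW _ _ fW] f(1) unfolding class_M_iff by metis
  obtain C where C: "\<forall>\<^sub>F x in at_top. \<forall>z. norm z = real p powr x \<longrightarrow> norm (g z) \<le> (h / q) powr x * x powr C"
    using quotient_growth[OF S p1 h f(1) g(3)] unfolding q_def by blast
  have coeff0: "(deriv ^^ k) g 0 = 0" if "h / q < real p ^ k" for k
    by (rule entire_coeff_zero_by_growth[OF g(1) _ _ that C]) (use p1 h q in auto)
  have "g 0 = - 1" using g(2)[of 0] R0 by (simp add: W_def P(2))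
  then have hq: "h / q \<ge> 1" using coeff0[of 0] by force
  \<comment> \<open>\<open>nat\<close> loses nothing: the quotient of logarithms is nonnegative
    because h >= q.\<close>
  define n where "n = nat \<lfloor>ln (h / q) / ln (real p)\<rfloor>"
  have lq0: "ln (h / q) / ln (real p) \<ge> 0" using hq p1 by simp
  have coeff: "(deriv ^^ k) g 0 = 0" if k: "k > n" for k
  proof (rule coeff0)
    have "ln (h / q) / ln (real p) < real k" using k lq0 unfolding n_def by linarith
    then have "ln (h / q) < ln (real p ^ k)" using p1 by (simp add: field_simps ln_realpow)
    then show "h / q < real p ^ k" using h q p1 by (subst (asm) ln_less_cancel_iff) auto
  qed
  \<comment> \<open>Solves W = p - 1 - p P for P, with W replaced by its extension g, whose Taylor
    series stops at n; so r is 1/F_p as a polynomial.\<close>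
  define r where "r = Polynomial.smult (1 / of_nat p)
    ([:of_nat p - 1:] - (\<Sum>k\<le>n. Polynomial.monom ((deriv ^^ k) g 0 / fact k) k))"
  have gpoly: "g z = (\<Sum>k\<le>n. (deriv ^^ k) g 0 / fact k * z ^ k)" for z
  proof -
    have "(\<lambda>k. (deriv ^^ k) g 0 / fact k * (z - 0) ^ k) sums g z"
      by (rule holomorphic_power_series[of g 0 "norm z + 1"]) (auto intro: holomorphic_on_subset[OF g(1)])
    moreover have "(\<lambda>k. (deriv ^^ k) g 0 / fact k * (z - 0) ^ k) sums
        (\<Sum>k\<le>n. (deriv ^^ k) g 0 / fact k * (z - 0) ^ k)"
      by (rule sums_finite) (auto simp: coeff not_le)
    ultimately show ?thesis using sums_unique2 by fastforce
  qed
  have poly_r: "poly r z = (of_nat p - 1 - g z) / of_nat p" for z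
    by (simp add: r_def poly_sum poly_monom gpoly)
  have rP: "poly r z = P z" if "norm z < ?R" for z
    using g(2)[OF that] p1 by (simp add: poly_r W_def field_simps)
  have deg: "degree r \<le> n"
    unfolding r_def by (intro order_trans[OF degree_smult_le] degree_diff_le degree_sum_le)
      (auto intro: order_trans[OF degree_monom_le])
  have "poly r 0 = 1" using rP[of 0] R0 P(2) by simp
  then obtain \<alpha> where \<alpha>: "\<And>z. poly r z = (\<Prod>j=1..degree r. 1 - \<alpha> j * z)"
    using poly_factor_one_minus by blast
  \<comment> \<open>The identity is known on the disc of radius p^(-theta), where r = P. It
    continues to the unit disc, where the series of F_p still converges, and so keeps the zeros
    1/alpha_j out of it.\<close>
  have Ar: "eval_fps ?A z * poly r z = 1" if z: "norm z < 1" for z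
  proof (rule analytic_continuation_open[of "ball 0 ?R" "ball 0 1" "\<lambda>z. eval_fps ?A z * poly r z" "\<lambda>_. 1"])
    show "(\<lambda>z. eval_fps ?A z * poly r z) holomorphic_on ball 0 1"
      using rad by (intro holomorphic_intros ball_eball_mono) (simp add: one_ereal_def)
    show "eval_fps ?A z * poly r z = 1" if "z \<in> ball 0 ?R" for z
      using P(3)[of z] rP[of z] that by simp
  qed (use R0 R1 z in auto)
  show ?thesis
  proof (intro exI conjI)
    show "int (degree r) \<le> \<lfloor>ln (h / selberg_conductor F) / ln (real p)\<rfloor>"
      using deg lq0 unfolding n_def q_def by linarith
    show "\<forall>j\<in>{1..degree r}. norm (\<alpha> j) \<le> 1"
    proof (rule ballI, rule ccontr)
      fix j assume j: "j \<in> {1..degree r}" "\<not> norm (\<alpha> j) \<le> 1"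
      then have "norm (\<alpha> j) > 1" by simp
      then have "\<alpha> j \<noteq> 0" "norm (1 / \<alpha> j) < 1" by (auto simp: norm_divide divide_less_eq)
      moreover have "poly r (1 / \<alpha> j) = 0"
        unfolding \<alpha> using j \<open>\<alpha> j \<noteq> 0\<close> by (intro prod_zero) (auto intro!: bexI[of _ j])
      ultimately show False using Ar[of "1 / \<alpha> j"] by simp
    qed
    show "\<forall>s. Re s > 1 \<longrightarrow> local_factor a p s = (\<Prod>j=1..degree r. inverse (1 - \<alpha> j / of_nat p powr s))"
    proof (intro allI impI)
      fix s :: complex assume s: "Re s > 1"
      have "local_factor a p s * poly r (of_nat p powr (- s)) = 1"
        using Ar[of "of_nat p powr (- s)"] small[OF s] R1 p1 by (simp add: local_factor_eq_eval_fps)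
      then have "local_factor a p s = inverse (poly r (of_nat p powr (- s)))"
        by (metis inverse_unique mult.commute)
      also have "\<dots> = (\<Prod>j=1..degree r. inverse (1 - \<alpha> j / of_nat p powr s))"
        unfolding \<alpha> prod_inversef[symmetric] by (simp add: powr_minus o_def divide_inverse)
      finally show "local_factor a p s = (\<Prod>j=1..degree r. inverse (1 - \<alpha> j / of_nat p powr s))" .
    qed
  qed
qed

text \<open>The bound on N says q p^N <= h, and in particular q <= h. So F, which lies in M(d, q),
  also lies in M(d, h), and it may be multiplied by the inverse Euler factor, of size p^(N |sigma|),
  without leaving M(d, h).\<close>

lemma untwisted_series_in_M:
  assumes S: "selberg a F" and p: "prime p" and h: "h > 0"
    and N: "int N \<le> \<lfloor>ln (h / selberg_conductor F) / ln (real p)\<rfloor>"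
    and \<alpha>: "\<forall>j\<in>{1..N}. norm (\<alpha> j) \<le> 1"
    and fac: "\<forall>s. Re s > 1 \<longrightarrow> local_factor a p s = (\<Prod>j=1..N. inverse (1 - \<alpha> j / of_nat p powr s))"
  shows "series_in_M (selberg_degree F) h a"
    "series_in_M (selberg_degree F) h (char_twist a (principal_character p))"
proof -
  have p1: "p > 1" using p by (rule prime_gt_1_nat)
  define q where "q = selberg_conductor F"
  have q: "q > 0"
    unfolding q_def using S by (intro selberg_conductor_pos fe_of_functional_equation) (auto simp: selberg_def)
  have "real N \<le> ln (h / q) / ln (real p)"
    using N unfolding q_def by (simp add: le_floor_iff)
  then have "ln (real p ^ N) \<le> ln (h / q)"
    using p1 by (simp add: field_simps ln_realpow)
  then have pN: "real p ^ N \<le> h / q"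
    using p1 h q by (subst (asm) ln_le_cancel_iff) auto
  then have hq: "q * real p ^ N \<le> h" using q by (simp add: field_simps)
  have "real p ^ N \<ge> 1" using p1 by (intro one_le_power) auto
  then have "q * 1 \<le> q * real p ^ N" using q by (intro mult_left_mono) auto
  with hq have qh: "q * 1 \<le> h" by linarith
  have FM: "F \<in> class_M (selberg_degree F) q"
    unfolding q_def by (rule selberg_in_class_M[OF S])
  have exp: "abs_dirichlet_expansion a F" using S by (simp add: selberg_def extended_selberg_def)
  have "(\<lambda>s. F s * 1) \<in> class_M (selberg_degree F) h"
    by (rule class_M_mult[OF FM, of _ 1 1]) (use q qh in auto)
  then show "series_in_M (selberg_degree F) h a"
    unfolding series_in_M_def using exp
    by (intro bexI[of _ F]) (auto simp: abs_dirichlet_expansion_def)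
  define E where "E = (\<lambda>s. \<Prod>j=1..N. 1 - \<alpha> j * of_nat p powr (- s))"
  have "(\<lambda>s. F s * E s) \<in> class_M (selberg_degree F) h"
  proof (rule class_M_mult[OF FM, of _ "2 ^ N" "real p ^ N"])
    show "E holomorphic_on UNIV" unfolding E_def by (intro holomorphic_intros)
    show "norm (E s) \<le> 2 ^ N * (real p ^ N) powr (- Re s)" if s: "Re s \<le> 0" for s
    proof -
      \<comment> \<open>For Re s <= 0 this lets the summand 1 of each factor be absorbed, giving 2
        p^(-Re s).\<close>
      have one: "1 \<le> real p powr (- Re s)" using p1 s by (intro ge_one_powr_ge_zero) auto
      have "norm (E s) = (\<Prod>j=1..N. norm (1 - \<alpha> j * of_nat p powr (- s)))"
        by (simp add: E_def prod_norm)
      also have "\<dots> \<le> (\<Prod>j=1..N. 2 * real p powr (- Re s))"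
      proof (rule prod_mono, safe)
        fix j assume "j \<in> {1..N}"
        then have "norm (\<alpha> j * of_nat p powr (- s)) \<le> 1 * real p powr (- Re s)"
          unfolding norm_mult using \<alpha> p1 by (intro mult_mono) (auto simp: norm_of_nat_powr)
        then show "norm (1 - \<alpha> j * of_nat p powr (- s)) \<le> 2 * real p powr (- Re s)"
          using one norm_triangle_ineq4[of 1 "\<alpha> j * of_nat p powr (- s)"] by simp
      qed auto
      also have "\<dots> = 2 ^ N * (real p powr (- Re s)) ^ N"
        by (simp add: power_mult_distrib)
      also have "(real p powr (- Re s)) ^ N = (real p ^ N) powr (- Re s)"
        using p1 by (simp add: powr_powr mult.commute flip: powr_realpow)
      finally show ?thesis .
    qed
  qed (use q hq in auto)
  moreover have "dirichlet_term (char_twist a (principal_character p)) s sums (F s * E s)" if s: "Re s > 1" for s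
  proof -
    obtain G where G: "((\<lambda>n. a n * principal_character p n * of_nat n powr (- s)) has_sum G) {1..}"
      and FG: "F s = local_factor a p s * G"
      by (rule euler_factor_split[OF exp p selberg_multiplicative(2)[OF S] s])
    \<comment> \<open>Since \<open>inverse 0\<close> is 0, the product formula alone does not
      exclude that both sides vanish; F(s) being nonzero does.\<close>
    have "F s \<noteq> 0" by (rule selberg_nonzero[OF S s])
    then have nz: "local_factor a p s \<noteq> 0" using FG by auto
    have "local_factor a p s = inverse (E s)"
      using fac s unfolding E_def prod_inversef[symmetric] by (simp add: powr_minus o_def divide_inverse)
    then have "F s * E s = G" using FG nz by auto
    with G show ?thesis
      by (intro sums_if_has_sum) (simp add: char_twist_def)
  qed
  ultimately show "series_in_M (selberg_degree F) h (char_twist a (principal_character p))"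
    unfolding series_in_M_def by (intro bexI[of _ "\<lambda>s. F s * E s"]) auto
qed

theorem theorem1:
  fixes a :: "nat \<Rightarrow> complex" and F :: "complex \<Rightarrow> complex"
    and d h :: real and p :: nat
  assumes "d > 0"
    and "selberg a F" and "selberg_degree F = d"
    and "\<forall>\<sigma> > 1 / 2. (\<lambda>T. real (zero_count F \<sigma> T)) \<in> o[at_top](\<lambda>T. T)"
    and "prime p" and "h > 0"
  shows "(\<forall>k::int. \<not> int p dvd k \<longrightarrow>
            series_in_M d h (linear_twist a (of_int k / of_nat p)))
     \<longleftrightarrow>
         (\<forall>X. dirichlet_character p X \<and> X \<noteq> principal_character p \<longrightarrow>
            series_in_M d h (char_twist a X)) \<and>
         (\<exists>(N::nat) (\<alpha> :: nat \<Rightarrow> complex).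
            int N \<le> \<lfloor>ln (h / selberg_conductor F) / ln (real p)\<rfloor> \<and>
            (\<forall>j\<in>{1..N}. norm (\<alpha> j) \<le> 1) \<and>
            (\<forall>s. Re s > 1 \<longrightarrow>
               local_factor a p s = (\<Prod>j=1..N. inverse (1 - \<alpha> j / of_nat p powr s))))"
  (is "?linear \<longleftrightarrow> ?char \<and> ?euler")
proof
  assume lin: ?linear
  have ?char
    using char_twist_as_linear_twists[of p d h a] lin prime_gt_1_nat[OF \<open>prime p\<close>] \<open>h > 0\<close> by blast
  moreover have ?euler
    using local_factor_product[OF assms(2,4,5,6)] principal_twist_from_linear_twists[of p d h a] lin assms(3,5,6)
    by blast
  ultimately show "?char \<and> ?euler" ..
next
  assume ce: "?char \<and> ?euler"
  then obtain N \<alpha> where "int N \<le> \<lfloor>ln (h / selberg_conductor F) / ln (real p)\<rfloor>"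
    "\<forall>j\<in>{1..N}. norm (\<alpha> j) \<le> 1"
    "\<forall>s. Re s > 1 \<longrightarrow> local_factor a p s = (\<Prod>j=1..N. inverse (1 - \<alpha> j / of_nat p powr s))"
    by blast
  from untwisted_series_in_M[OF assms(2,5,6) this] show ?linear
    using linear_twist_from_char_twists[of d h a p] ce assms(3,5,6) by blast
qed

end
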